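(* Let $X$ be a proper cocompact CAT(0) space with basepoint $x_0$, and let $\omega$ be a non-principal ultrafilter on $\mathbb N$. Then the inverse limit $\lim\limits_{\leftarrow}\bigl(\mathrm{Con}^\omega(X,(x_0),d),\Theta^d_{d'}\bigr)$ of the asymptotic cones of $X$ over all scaling sequences, with the inverse limit metric, is a complete metric space (in particular the inverse limit metric takes only finite values), and $\mathrm{Cone}(\partial^\omega_\angle X)$ (equivalently, via the natural isometry $(t,(\alpha_n))\mapsto((t,\alpha_n))$, the ultraproduct $(\mathrm{Cone}(\partial_TX))^\omega$ of the Euclidean cone on the Tits boundary) isometrically embeds into this inverse limit via the canonical map $(t,(\alpha_n))\mapsto\bigl(\Psi^\omega_d(t,(\alpha_n))\bigr)_d$.
   Context: A metric space is proper if closed balls are compact; it is cocompact if the translates of some compact set under its full isometry group cover it. Boundaries. Fix $x_0\in X$. $\partial X$ is the set of geodesic rays $\alpha:[0,\infty)\to X$ with $\alpha(0)=x_0$. With $\overline\angle_{x_0}$ denoting the Euclidean comparison angle at $x_0$, the angle metric is $\angle(\alpha,\beta)=\lim_{t\to\infty}\overline\angle_{x_0}(\alpha(t),\beta(t))$; $\partial_\angle X$ is $\partial X$ with this metric. The Tits metric $d_T$ is the (extended) path metric induced by $\angle$, and $\partial_TX$ is $\partial X$ with $d_T$. Euclidean cone. For a metric space $Z$, $\mathrm{Cone}(Z)=([0,\infty)\times Z)/\sim$ with $(0,z)\sim(0,z')$, and metric given by $\mathrm{dist}^2((t,z),(t',z'))=t^2+t'^2-2tt'\cos(\min\{\pi,\mathrm{dist}(z,z')\})$;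 if $Z=\emptyset$ the cone is a single point. The identity of $\partial X$ induces an isometry $\mathrm{Cone}(\partial_\angle X)\to\mathrm{Cone}(\partial_TX)$, and these two are identified. Ultraproducts. $\omega$ is a non-principal ultrafilter on $\mathbb N$; $\lim^\omega$ is the ultralimit; a property holds $\omega$-almost surely if it holds on a set in $\omega$. For metric spaces $(X_n,d_n)$ and $e=(e_n)\in\prod X_n$, the ultraproduct $\prod^\omega_eX_n$ is the set of sequences $(x_n)$ with $d_n(x_n,e_n)$ bounded, modulo $\lim^\omega d_n(x_n,y_n)=0$, with metric $\lim^\omega d_n(x_n,y_n)$. A scaling sequence is a sequence $d=(d_n)$ of positive reals with $\lim^\omega d_n=\infty$. $\mathrm{Con}^\omega(X,(x_0),d)$ is the ultraproduct of the spaces $(X,\mathrm{dist}/d_n)$ with respect to the constant sequence $(x_0)$. $\partial^\omega_\angle X$ is the ultraproduct of copies of $\partial_\angle X$. $(\mathrm{Cone}(Z))^\omega$ is the ultraproduct of copies of $\mathrm{Cone}(Z)$ with respect to the constant sequence at the cone point. The map $\Psi^\omega_d:\mathrm{Cone}(\partial^\omega_\angle X)\to\mathrm{Con}^\omega(X,(x_0),d)$ is $\Psi^\omega_d(t,(\alpha_n))=(\alpha_n(td_n))$. Connecting maps. Write $d'\preceq d$ if $d'_n\le d_n$ $\omega$-almost surely (a total order on scaling sequences, up to $\omega$-almost sure equality). Let $\Xi(x,t)=x$ if $t\ge \mathrm{dist}(x_0,x)$, and otherwise the point of the geodesic $[x_0,x]$ at distance $t$ from $x_0$. For $d'\preceq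 d$, $\Theta^d_{d'}:\mathrm{Con}^\omega(X,(x_0),d)\to\mathrm{Con}^\omega(X,(x_0),d')$ is $\Theta^d_{d'}((x_n))=\bigl(\Xi(x_n,\tfrac{d'_n}{d_n}\mathrm{dist}(x_n,x_0))\bigr)$; this is a well-defined 1-Lipschitz map. Inverse limit. For a system of metric spaces $(X_j,d_j)$ indexed by a totally ordered set $J$ with non-expansive maps $f_{i,j}:X_i\to X_j$ for $i\ge j$, satisfying $f_{i,k}=f_{j,k}\circ f_{i,j}$ for $i\ge j\ge k$, the inverse limit is the set of $x\in\prod_jX_j$ with $x(j)=f_{i,j}(x(i))$ for all $i\ge j$, with the (a priori extended) metric $\overline{\mathrm d}(x,y)=\sup_jd_j(x(j),y(j))$. *)

theory Defs
  imports "HOL-Analysis.Analysis"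
begin

section \<open>Proper cocompact CAT(0) spaces\<close>

text \<open>The space \<open>X\<close> is a type of class \<open>metric_space\<close>; since it has a basepoint, it is nonempty.\<close>

definition is_geodesic :: "(real \<Rightarrow> 'a::metric_space) \<Rightarrow> 'a \<Rightarrow> 'a \<Rightarrow> bool" where
  "is_geodesic c x y \<longleftrightarrow> c 0 = x \<and> c (dist x y) = y \<and>
     (\<forall>s\<in>{0..dist x y}. \<forall>t\<in>{0..dist x y}. dist (c s) (c t) = \<bar>s - t\<bar>)"

definition geodesic_segment :: "'a::metric_space set \<Rightarrow> 'a \<Rightarrow> 'a \<Rightarrow> bool" where
  "geodesic_segment S x y \<longleftrightarrow> (\<exists>c. is_geodesic c x y \<and> S = c ` {0..dist x y})"

text \<open>
  \<open>x'\<close>, \<open>y'\<close>, \<open>z'\<close> span a comparison triangle in the Euclidean plane and \<open>p'\<close>, \<open>q'\<close> are the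
  comparison points of \<open>p\<close>, \<open>q\<close>.  It suffices to mention two sides with a common vertex: any two
  distinct sides of a triangle have one, and for two points on the same side equality is trivial.
\<close>

definition CAT0_space :: "'a::metric_space itself \<Rightarrow> bool" where
  "CAT0_space _ \<longleftrightarrow>
     (\<forall>x y :: 'a. \<exists>c. is_geodesic c x y) \<and>
     (\<forall>(x::'a) y z S T (x'::real^2) y' z'.
        geodesic_segment S x y \<longrightarrow> geodesic_segment T x z \<longrightarrow>
        dist x' y' = dist x y \<longrightarrow> dist x' z' = dist x z \<longrightarrow> dist y' z' = dist y z \<longrightarrow>
        (\<forall>p\<in>S. \<forall>q\<in>T. \<forall>p'\<in>closed_segment x' y'. \<forall>q'\<in>closed_segment x' z'.
           dist x' p' = dist x p \<longrightarrow> dist x' q' = dist x q \<longrightarrow> dist p q \<le> dist p' q'))"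

definition proper_space :: "'a::metric_space itself \<Rightarrow> bool" where
  "proper_space _ \<longleftrightarrow> (\<forall>(x::'a) r. compact (cball x r))"

definition self_isometries :: "('a::metric_space \<Rightarrow> 'a) set" where
  "self_isometries = {g. bij g \<and> (\<forall>x y. dist (g x) (g y) = dist x y)}"

definition cocompact_space :: "'a::metric_space itself \<Rightarrow> bool" where
  "cocompact_space _ \<longleftrightarrow>
     (\<exists>K::'a set. compact K \<and> (\<Union>g\<in>self_isometries. g ` K) = UNIV)"


section \<open>Boundaries\<close>

text \<open>Rays are made extensional so that distinct functions are distinct maps on \<open>[0,\<infinity>)\<close>.\<close>

definition bdry :: "'a::metric_space \<Rightarrow> (real \<Rightarrow> 'a) set" where
  "bdry x0 = {\<alpha> \<in> extensional {0..}. \<alpha> 0 = x0 \<and>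
     (\<forall>s\<ge>0. \<forall>t\<ge>0. dist (\<alpha> s) (\<alpha> t) = \<bar>s - t\<bar>)}"

definition comparison_angle :: "'a::metric_space \<Rightarrow> 'a \<Rightarrow> 'a \<Rightarrow> real" where
  "comparison_angle p x y =
     arccos (((dist p x)\<^sup>2 + (dist p y)\<^sup>2 - (dist x y)\<^sup>2) / (2 * dist p x * dist p y))"

definition angle_metric :: "'a::metric_space \<Rightarrow> (real \<Rightarrow> 'a) \<Rightarrow> (real \<Rightarrow> 'a) \<Rightarrow> real" where
  "angle_metric x0 \<alpha> \<beta> = Lim at_top (\<lambda>t. comparison_angle x0 (\<alpha> t) (\<beta> t))"

definition metric_path :: "'b set \<Rightarrow> ('b \<Rightarrow> 'b \<Rightarrow> real) \<Rightarrow> (real \<Rightarrow> 'b) \<Rightarrow> bool" where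
  "metric_path M d c \<longleftrightarrow> c ` {0..1} \<subseteq> M \<and>
     (\<forall>s\<in>{0..1}. ((\<lambda>u. d (c s) (c u)) \<longlongrightarrow> 0) (at s within {0..1}))"

text \<open>The partition \<open>s 0 \<le> \<dots> \<le> s n\<close> is the initial part of a monotone sequence in \<open>[0,1]\<close>.\<close>

definition metric_path_length :: "('b \<Rightarrow> 'b \<Rightarrow> real) \<Rightarrow> (real \<Rightarrow> 'b) \<Rightarrow> ennreal" where
  "metric_path_length d c =
     (SUP (n, s) \<in> {(n::nat, s). mono s \<and> range s \<subseteq> {0..1}}.
        \<Sum>i<n. ennreal (d (c (s i)) (c (s (Suc i)))))"

definition induced_path_metric :: "'b set \<Rightarrow> ('b \<Rightarrow> 'b \<Rightarrow> real) \<Rightarrow> 'b \<Rightarrow> 'b \<Rightarrow> ennreal" where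
  "induced_path_metric M d x y =
     (INF c \<in> {c. metric_path M d c \<and> c 0 = x \<and> c 1 = y}. metric_path_length d c)"

definition tits_metric :: "'a::metric_space \<Rightarrow> (real \<Rightarrow> 'a) \<Rightarrow> (real \<Rightarrow> 'a) \<Rightarrow> ennreal" where
  "tits_metric x0 = induced_path_metric (bdry x0) (angle_metric x0)"


section \<open>Euclidean cones\<close>

text \<open>
  Points of the cone are equivalence classes.  The apex \<open>{0} \<times> Z\<close> is inserted separately so that
  the cone on the empty space is a single point, namely the empty class.
  The metric of the base is allowed to be extended.
\<close>

definition cone_rel :: "'z set \<Rightarrow> ((real \<times> 'z) \<times> (real \<times> 'z)) set" where
  "cone_rel Z = {(p, q). p \<in> {0..} \<times> Z \<and> q \<in> {0..} \<times> Z \<and> (p = q \<or> fst p = 0 \<and> fst q = 0)}"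

definition cone_pt :: "'z set \<Rightarrow> real \<Rightarrow> 'z \<Rightarrow> (real \<times> 'z) set" where
  "cone_pt Z t z = cone_rel Z `` {(t, z)}"

definition cone_apex :: "'z set \<Rightarrow> (real \<times> 'z) set" where
  "cone_apex Z = {0} \<times> Z"

definition euclidean_cone :: "'z set \<Rightarrow> (real \<times> 'z) set set" where
  "euclidean_cone Z = insert (cone_apex Z) (({0..} \<times> Z) // cone_rel Z)"

definition cone_pre_dist ::
    "('z \<Rightarrow> 'z \<Rightarrow> ennreal) \<Rightarrow> real \<times> 'z \<Rightarrow> real \<times> 'z \<Rightarrow> real" where
  "cone_pre_dist D = (\<lambda>(t, z) (t', z').
     sqrt (t\<^sup>2 + t'\<^sup>2 - 2 * t * t' * cos (enn2real (min (ennreal pi) (D z z')))))"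

definition cone_dist ::
    "('z \<Rightarrow> 'z \<Rightarrow> ennreal) \<Rightarrow> (real \<times> 'z) set \<Rightarrow> (real \<times> 'z) set \<Rightarrow> real" where
  "cone_dist D C C' =
     (if C = {} \<or> C' = {} then 0 else THE r. \<exists>p\<in>C. \<exists>q\<in>C'. r = cone_pre_dist D p q)"


section \<open>Ultraproducts\<close>

definition nonprincipal_ultrafilter :: "'i filter \<Rightarrow> bool" where
  "nonprincipal_ultrafilter \<omega> \<longleftrightarrow> \<omega> \<noteq> bot \<and>
     (\<forall>P. eventually P \<omega> \<or> eventually (\<lambda>n. \<not> P n) \<omega>) \<and> (\<forall>n. \<omega> \<noteq> principal {n})"

definition ultra_seqs ::
    "(nat \<Rightarrow> 'b set) \<Rightarrow> (nat \<Rightarrow> 'b \<Rightarrow> 'b \<Rightarrow> real) \<Rightarrow> (nat \<Rightarrow> 'b) \<Rightarrow> (nat \<Rightarrow> 'b) set" where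
  "ultra_seqs M D e = {x. (\<forall>n. x n \<in> M n) \<and> (\<exists>B. \<forall>n. D n (x n) (e n) \<le> B)}"

definition ultra_rel ::
    "nat filter \<Rightarrow> (nat \<Rightarrow> 'b set) \<Rightarrow> (nat \<Rightarrow> 'b \<Rightarrow> 'b \<Rightarrow> real) \<Rightarrow> (nat \<Rightarrow> 'b)
       \<Rightarrow> ((nat \<Rightarrow> 'b) \<times> (nat \<Rightarrow> 'b)) set" where
  "ultra_rel \<omega> M D e = {(x, y). x \<in> ultra_seqs M D e \<and> y \<in> ultra_seqs M D e \<and>
     ((\<lambda>n. D n (x n) (y n)) \<longlongrightarrow> 0) \<omega>}"

definition ultra_class ::
    "nat filter \<Rightarrow> (nat \<Rightarrow> 'b set) \<Rightarrow> (nat \<Rightarrow> 'b \<Rightarrow> 'b \<Rightarrow> real) \<Rightarrow> (nat \<Rightarrow> 'b)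
       \<Rightarrow> (nat \<Rightarrow> 'b) \<Rightarrow> (nat \<Rightarrow> 'b) set" where
  "ultra_class \<omega> M D e x = ultra_rel \<omega> M D e `` {x}"

definition ultraproduct ::
    "nat filter \<Rightarrow> (nat \<Rightarrow> 'b set) \<Rightarrow> (nat \<Rightarrow> 'b \<Rightarrow> 'b \<Rightarrow> real) \<Rightarrow> (nat \<Rightarrow> 'b)
       \<Rightarrow> (nat \<Rightarrow> 'b) set set" where
  "ultraproduct \<omega> M D e = ultra_seqs M D e // ultra_rel \<omega> M D e"

definition ultra_dist ::
    "nat filter \<Rightarrow> (nat \<Rightarrow> 'b \<Rightarrow> 'b \<Rightarrow> real) \<Rightarrow> (nat \<Rightarrow> 'b) set \<Rightarrow> (nat \<Rightarrow> 'b) set \<Rightarrow> real" where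
  "ultra_dist \<omega> D A B = (THE r. \<exists>x\<in>A. \<exists>y\<in>B. ((\<lambda>n. D n (x n) (y n)) \<longlongrightarrow> r) \<omega>)"

text \<open>
  The angle metric is bounded by \<open>\<pi>\<close>, so the choice of the base sequence is irrelevant; if there
  are no rays, the ultraproduct is empty.
\<close>

definition omega_bdry :: "nat filter \<Rightarrow> 'a::metric_space \<Rightarrow> (nat \<Rightarrow> real \<Rightarrow> 'a) set set" where
  "omega_bdry \<omega> x0 =
     ultraproduct \<omega> (\<lambda>_. bdry x0) (\<lambda>_. angle_metric x0) (\<lambda>_. SOME \<alpha>. \<alpha> \<in> bdry x0)"

definition omega_bdry_class ::
    "nat filter \<Rightarrow> 'a::metric_space \<Rightarrow> (nat \<Rightarrow> real \<Rightarrow> 'a) \<Rightarrow> (nat \<Rightarrow> real \<Rightarrow> 'a) set" where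
  "omega_bdry_class \<omega> x0 =
     ultra_class \<omega> (\<lambda>_. bdry x0) (\<lambda>_. angle_metric x0) (\<lambda>_. SOME \<alpha>. \<alpha> \<in> bdry x0)"

definition omega_bdry_dist ::
    "nat filter \<Rightarrow> 'a::metric_space \<Rightarrow> (nat \<Rightarrow> real \<Rightarrow> 'a) set \<Rightarrow> (nat \<Rightarrow> real \<Rightarrow> 'a) set \<Rightarrow> real" where
  "omega_bdry_dist \<omega> x0 = ultra_dist \<omega> (\<lambda>_. angle_metric x0)"

abbreviation cone_omega_bdry where
  "cone_omega_bdry \<omega> x0 \<equiv> euclidean_cone (omega_bdry \<omega> x0)"

abbreviation cone_omega_bdry_dist where
  "cone_omega_bdry_dist \<omega> x0 \<equiv> cone_dist (\<lambda>A B. ennreal (omega_bdry_dist \<omega> x0 A B))"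

definition omega_tits_cone ::
    "nat filter \<Rightarrow> 'a::metric_space \<Rightarrow> (nat \<Rightarrow> (real \<times> (real \<Rightarrow> 'a)) set) set set" where
  "omega_tits_cone \<omega> x0 =
     ultraproduct \<omega> (\<lambda>_. euclidean_cone (bdry x0)) (\<lambda>_. cone_dist (tits_metric x0)) (\<lambda>_. cone_apex (bdry x0))"

definition omega_tits_cone_class ::
    "nat filter \<Rightarrow> 'a::metric_space \<Rightarrow> (nat \<Rightarrow> (real \<times> (real \<Rightarrow> 'a)) set)
       \<Rightarrow> (nat \<Rightarrow> (real \<times> (real \<Rightarrow> 'a)) set) set" where
  "omega_tits_cone_class \<omega> x0 =
     ultra_class \<omega> (\<lambda>_. euclidean_cone (bdry x0)) (\<lambda>_. cone_dist (tits_metric x0)) (\<lambda>_. cone_apex (bdry x0))"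

definition omega_tits_cone_dist ::
    "nat filter \<Rightarrow> 'a::metric_space \<Rightarrow> (nat \<Rightarrow> (real \<times> (real \<Rightarrow> 'a)) set) set
       \<Rightarrow> (nat \<Rightarrow> (real \<times> (real \<Rightarrow> 'a)) set) set \<Rightarrow> real" where
  "omega_tits_cone_dist \<omega> x0 = ultra_dist \<omega> (\<lambda>_. cone_dist (tits_metric x0))"


section \<open>Asymptotic cones and connecting maps\<close>

definition scaling_seqs :: "nat filter \<Rightarrow> (nat \<Rightarrow> real) set" where
  "scaling_seqs \<omega> = {d. (\<forall>n. 0 < d n) \<and> filterlim d at_top \<omega>}"

definition scaling_le :: "nat filter \<Rightarrow> (nat \<Rightarrow> real) \<Rightarrow> (nat \<Rightarrow> real) \<Rightarrow> bool" where
  "scaling_le \<omega> d' d \<longleftrightarrow> (\<forall>\<^sub>F n in \<omega>. d' n \<le> d n)"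

definition asym_cone :: "nat filter \<Rightarrow> 'a::metric_space \<Rightarrow> (nat \<Rightarrow> real) \<Rightarrow> (nat \<Rightarrow> 'a) set set" where
  "asym_cone \<omega> x0 d = ultraproduct \<omega> (\<lambda>_. UNIV) (\<lambda>n x y. dist x y / d n) (\<lambda>_. x0)"

definition asym_cone_class ::
    "nat filter \<Rightarrow> 'a::metric_space \<Rightarrow> (nat \<Rightarrow> real) \<Rightarrow> (nat \<Rightarrow> 'a) \<Rightarrow> (nat \<Rightarrow> 'a) set" where
  "asym_cone_class \<omega> x0 d = ultra_class \<omega> (\<lambda>_. UNIV) (\<lambda>n x y. dist x y / d n) (\<lambda>_. x0)"

definition asym_cone_dist ::
    "nat filter \<Rightarrow> (nat \<Rightarrow> real) \<Rightarrow> (nat \<Rightarrow> 'a::metric_space) set \<Rightarrow> (nat \<Rightarrow> 'a) set \<Rightarrow> real" where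
  "asym_cone_dist \<omega> d = ultra_dist \<omega> (\<lambda>n x y. dist x y / d n)"

definition Xi_map :: "'a::metric_space \<Rightarrow> 'a \<Rightarrow> real \<Rightarrow> 'a" where
  "Xi_map x0 x t =
     (if t \<ge> dist x0 x then x else THE y. \<exists>c. is_geodesic c x0 x \<and> y = c t)"

text \<open>
  Maps on quotients are lifted from representatives by taking the union of the image classes, all of
  which coincide when the map is well-defined.
\<close>

definition Theta_map ::
    "nat filter \<Rightarrow> 'a::metric_space \<Rightarrow> (nat \<Rightarrow> real) \<Rightarrow> (nat \<Rightarrow> real)
       \<Rightarrow> (nat \<Rightarrow> 'a) set \<Rightarrow> (nat \<Rightarrow> 'a) set" where
  "Theta_map \<omega> x0 d d' A =
     (\<Union>x\<in>A. asym_cone_class \<omega> x0 d' (\<lambda>n. Xi_map x0 (x n) (d' n / d n * dist (x n) x0)))"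

text \<open>
  In the next two maps, \<open>C = {}\<close> only occurs as the apex of the cone on the empty space.
\<close>

definition Psi_map ::
    "nat filter \<Rightarrow> 'a::metric_space \<Rightarrow> (nat \<Rightarrow> real)
       \<Rightarrow> (real \<times> (nat \<Rightarrow> real \<Rightarrow> 'a) set) set \<Rightarrow> (nat \<Rightarrow> 'a) set" where
  "Psi_map \<omega> x0 d C =
     (if C = {} then asym_cone_class \<omega> x0 d (\<lambda>_. x0)
      else \<Union>(t, A)\<in>C. \<Union>\<alpha>\<in>A. asym_cone_class \<omega> x0 d (\<lambda>n. \<alpha> n (t * d n)))"

definition cone_ultra_map ::
    "nat filter \<Rightarrow> 'a::metric_space
       \<Rightarrow> (real \<times> (nat \<Rightarrow> real \<Rightarrow> 'a) set) set \<Rightarrow> (nat \<Rightarrow> (real \<times> (real \<Rightarrow> 'a)) set) set" where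
  "cone_ultra_map \<omega> x0 C =
     (if C = {} then omega_tits_cone_class \<omega> x0 (\<lambda>_. cone_apex (bdry x0))
      else \<Union>(t, A)\<in>C. \<Union>\<alpha>\<in>A. omega_tits_cone_class \<omega> x0 (\<lambda>n. cone_pt (bdry x0) t (\<alpha> n)))"


section \<open>Inverse limits\<close>

definition inverse_limit ::
    "'j set \<Rightarrow> ('j \<Rightarrow> 'j \<Rightarrow> bool) \<Rightarrow> ('j \<Rightarrow> 'b set) \<Rightarrow> ('j \<Rightarrow> 'j \<Rightarrow> 'b \<Rightarrow> 'b) \<Rightarrow> ('j \<Rightarrow> 'b) set" where
  "inverse_limit J le M f =
     {x \<in> (\<Pi>\<^sub>E j\<in>J. M j). \<forall>i\<in>J. \<forall>j\<in>J. le j i \<longrightarrow> x j = f i j (x i)}"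

definition inverse_limit_edist ::
    "'j set \<Rightarrow> ('j \<Rightarrow> 'b \<Rightarrow> 'b \<Rightarrow> real) \<Rightarrow> ('j \<Rightarrow> 'b) \<Rightarrow> ('j \<Rightarrow> 'b) \<Rightarrow> ennreal" where
  "inverse_limit_edist J D x y = (SUP j\<in>J. ennreal (D j (x j) (y j)))"

definition cone_limit ::
    "nat filter \<Rightarrow> 'a::metric_space \<Rightarrow> ((nat \<Rightarrow> real) \<Rightarrow> (nat \<Rightarrow> 'a) set) set" where
  "cone_limit \<omega> x0 =
     inverse_limit (scaling_seqs \<omega>) (scaling_le \<omega>) (asym_cone \<omega> x0) (Theta_map \<omega> x0)"

definition cone_limit_edist ::
    "nat filter \<Rightarrow> ((nat \<Rightarrow> real) \<Rightarrow> (nat \<Rightarrow> 'a::metric_space) set)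
       \<Rightarrow> ((nat \<Rightarrow> real) \<Rightarrow> (nat \<Rightarrow> 'a) set) \<Rightarrow> ennreal" where
  "cone_limit_edist \<omega> = inverse_limit_edist (scaling_seqs \<omega>) (asym_cone_dist \<omega>)"

definition cone_limit_dist ::
    "nat filter \<Rightarrow> ((nat \<Rightarrow> real) \<Rightarrow> (nat \<Rightarrow> 'a::metric_space) set)
       \<Rightarrow> ((nat \<Rightarrow> real) \<Rightarrow> (nat \<Rightarrow> 'a) set) \<Rightarrow> real" where
  "cone_limit_dist \<omega> \<xi> \<eta> = enn2real (cone_limit_edist \<omega> \<xi> \<eta>)"

definition canonical_map ::
    "nat filter \<Rightarrow> 'a::metric_space
       \<Rightarrow> (real \<times> (nat \<Rightarrow> real \<Rightarrow> 'a) set) set \<Rightarrow> ((nat \<Rightarrow> real) \<Rightarrow> (nat \<Rightarrow> 'a) set)" where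
  "canonical_map \<omega> x0 C = (\<lambda>d\<in>scaling_seqs \<omega>. Psi_map \<omega> x0 d C)"

definition isometric_embedding ::
    "'b set \<Rightarrow> ('b \<Rightarrow> 'b \<Rightarrow> real) \<Rightarrow> 'c set \<Rightarrow> ('c \<Rightarrow> 'c \<Rightarrow> real) \<Rightarrow> ('b \<Rightarrow> 'c) \<Rightarrow> bool" where
  "isometric_embedding M d M' d' f \<longleftrightarrow>
     f \<in> M \<rightarrow> M' \<and> (\<forall>x\<in>M. \<forall>y\<in>M. d' (f x) (f y) = d x y)"

definition isometry_onto ::
    "'b set \<Rightarrow> ('b \<Rightarrow> 'b \<Rightarrow> real) \<Rightarrow> 'c set \<Rightarrow> ('c \<Rightarrow> 'c \<Rightarrow> real) \<Rightarrow> ('b \<Rightarrow> 'c) \<Rightarrow> bool" where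
  "isometry_onto M d M' d' f \<longleftrightarrow>
     bij_betw f M M' \<and> (\<forall>x\<in>M. \<forall>y\<in>M. d' (f x) (f y) = d x y)"

end

theory Submission
  imports Defs
begin

text \<open>
  The law of cosines identifies \<open>lim dist (\<alpha> (t * s)) (\<beta> (t' * s)) / s\<close> with the cone distance of
  \<open>(t, \<alpha>)\<close> and \<open>(t', \<beta>)\<close>, and by the CAT(0) inequality the quotient increases to its limit.
  Hence the triangle inequality of the space passes to the cone over the boundary, and from there to
  the angle metric.  The same monotonicity bounds the distances in every asymptotic cone by the
  cone distance, with equality for a scaling sequence that grows fast enough, so the canonical map
  is isometric.

  In a proper space, bounded sequences have \<open>\<omega>\<close>-limits.  Applied to the geodesics from the base
  point to the midpoints of \<open>\<alpha> n\<close> and \<open>\<beta> n\<close>, this yields midpoints for the angle metric at angles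
  below \<open>\<pi>\<close>; iterated bisection and another \<open>\<omega>\<close>-limit yield geodesics, so the angle metric is the
  truncation of the Tits metric at \<open>\<pi>\<close>.

  The inverse limit is complete since asymptotic cones are complete and the connecting maps are
  non-expansive; its distances are finite since these maps preserve the distance to the base point.
\<close>

section \<open>Ultrafilters and ultraproducts\<close>

text \<open>The restriction to angles below pi in the bisection is forced: for rays in opposite
  directions the midpoints may stay near the base point and have no limiting ray. Below pi the chord
  is shorter than twice the radius, so the midpoints escape linearly. At angle pi a lower bound for
  the Tits metric is enough, because the cone truncates at pi. Pointwise limits of rays can only
  decrease angles. This is the right direction for bounding path lengths from above; the bound from
  below comes from a partition with a single step. Two features of the definitions shape the
  details. There may be no rays at all; the cone is then one point, represented by the empty class,
  which asks for separate cases. And scaling sequences are compared only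
  \<open>\<omega>\<close>-almost surely, whereas a sequence that represents a point must be bounded
  at every index; so the estimates on connecting maps come in two strengths.\<close>

lemma nonprincipal_ultrafilter_not_bot: "nonprincipal_ultrafilter \<omega> \<Longrightarrow> \<omega> \<noteq> bot"
  by (simp add: nonprincipal_ultrafilter_def)

lemma nonprincipal_ultrafilter_dichotomy:
  "nonprincipal_ultrafilter \<omega> \<Longrightarrow> \<not> eventually P \<omega> \<Longrightarrow> eventually (\<lambda>n. \<not> P n) \<omega>"
  unfolding nonprincipal_ultrafilter_def by blast

lemma nonprincipal_ultrafilter_neq:
  assumes "nonprincipal_ultrafilter \<omega>"
  shows "eventually (\<lambda>n. n \<noteq> m) \<omega>"
proof (rule ccontr)
  assume "\<not> eventually (\<lambda>n. n \<noteq> m) \<omega>"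
  then have ev: "eventually (\<lambda>n. n = m) \<omega>"
    using nonprincipal_ultrafilter_dichotomy[OF assms] by force
  have "\<omega> = principal {m}"
  proof (rule filter_eqI)
    fix P
    have "P m" if "eventually P \<omega>"
    proof -
      have "eventually (\<lambda>n. P m) \<omega>"
        using ev that by eventually_elim auto
      then show ?thesis
        using nonprincipal_ultrafilter_not_bot[OF assms] by (simp add: eventually_const_iff)
    qed
    moreover have "eventually P \<omega>" if "P m"
      using ev by eventually_elim (use that in auto)
    ultimately show "eventually P \<omega> = eventually P (principal {m})"
      by (auto simp: eventually_principal)
  qed
  then show False
    using assms by (auto simp: nonprincipal_ultrafilter_def)
qed

text \<open>The complement of a tail is finite, and each of its points is avoided
  \<open>\<omega>\<close>-almost surely. Ordinary limits of sequences thereby become limits along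
  \<open>\<omega>\<close>.\<close>

lemma nonprincipal_ultrafilter_le_sequentially:
  assumes "nonprincipal_ultrafilter \<omega>"
  shows "\<omega> \<le> sequentially"
proof (rule filter_leI)
  fix P :: "nat \<Rightarrow> bool"
  assume "eventually P sequentially"
  then obtain N where N: "\<And>n. n \<ge> N \<Longrightarrow> P n"
    by (auto simp: eventually_sequentially)
  have "eventually (\<lambda>n. \<forall>m\<in>{..<N}. n \<noteq> m) \<omega>"
    by (intro eventually_ball_finite ballI nonprincipal_ultrafilter_neq assms) auto
  then show "eventually P \<omega>"
    by eventually_elim (rule N, force simp: not_less[symmetric])
qed

lemma nonprincipal_ultrafilter_tendsto:
  assumes "nonprincipal_ultrafilter \<omega>" "filterlim f F sequentially"
  shows "filterlim f F \<omega>"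
  using assms nonprincipal_ultrafilter_le_sequentially filterlim_mono by blast

text \<open>Compactness gives the image filter a cluster point \<open>l\<close>. If some
  neighbourhood of \<open>l\<close> were not \<open>\<omega>\<close>-large, its complement would be,
  and \<open>l\<close> could not be a cluster point.\<close>

lemma nonprincipal_ultrafilter_compact:
  fixes f :: "'i \<Rightarrow> 'b::topological_space"
  assumes U: "nonprincipal_ultrafilter \<omega>" and "compact K" and "eventually (\<lambda>n. f n \<in> K) \<omega>"
  obtains l where "l \<in> K" "(f \<longlongrightarrow> l) \<omega>"
proof -
  have "filtermap f \<omega> \<noteq> bot" "eventually (\<lambda>x. x \<in> K) (filtermap f \<omega>)"
    using assms nonprincipal_ultrafilter_not_bot
    by (auto simp: filtermap_bot_iff eventually_filtermap)
  then obtain l where l: "l \<in> K" "inf (nhds l) (filtermap f \<omega>) \<noteq> bot"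
    using \<open>compact K\<close> unfolding compact_filter by blast
  have "(f \<longlongrightarrow> l) \<omega>"
  proof (rule topological_tendstoI, rule ccontr)
    fix S assume S: "open S" "l \<in> S" "\<not> eventually (\<lambda>n. f n \<in> S) \<omega>"
    then have "eventually (\<lambda>n. f n \<notin> S) \<omega>"
      using nonprincipal_ultrafilter_dichotomy[OF U] by blast
    then have "eventually (\<lambda>x. x \<notin> S) (filtermap f \<omega>)"
      by (simp add: eventually_filtermap)
    moreover have "eventually (\<lambda>x. x \<in> S) (nhds l)"
      using S by (auto simp: eventually_nhds)
    ultimately have "eventually (\<lambda>x. False) (inf (nhds l) (filtermap f \<omega>))"
      unfolding eventually_inf by blast
    with l(2) show False
      by (simp add: eventually_False)
  qed
  with l(1) that show thesis by blast
qed

lemma nonprincipal_ultrafilter_bounded: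
  fixes f :: "'i \<Rightarrow> real"
  assumes "nonprincipal_ultrafilter \<omega>" "\<And>n. a \<le> f n" "\<And>n. f n \<le> b"
  obtains l where "a \<le> l" "l \<le> b" "(f \<longlongrightarrow> l) \<omega>"
proof -
  have "eventually (\<lambda>n. f n \<in> {a..b}) \<omega>"
    using assms(2,3) by simp
  then obtain l where "l \<in> {a..b}" "(f \<longlongrightarrow> l) \<omega>"
    using nonprincipal_ultrafilter_compact[OF assms(1) compact_Icc] by blast
  then show thesis by (intro that[of l]) auto
qed

lemma tendsto_zero_le:
  fixes f g :: "'i \<Rightarrow> real"
  assumes "(g \<longlongrightarrow> 0) F" "\<And>n. 0 \<le> f n" "\<And>n. f n \<le> g n"
  shows "(f \<longlongrightarrow> 0) F"
  using assms by (intro tendsto_sandwich[of "\<lambda>_. 0" f F g]) auto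

text \<open>A common setting for the boundary, the Tits cone and all asymptotic cones. Pseudometrics
  suffice because passing to classes creates separation. The assumption \<open>base\<close> is
  conditional since there may be no rays, and a base point given by \<open>SOME\<close> is then
  unspecified.\<close>

locale pseudometric_ultraproduct =
  fixes \<omega> :: "nat filter" and M :: "nat \<Rightarrow> 'b set" and D :: "nat \<Rightarrow> 'b \<Rightarrow> 'b \<Rightarrow> real" and e :: "nat \<Rightarrow> 'b"
  assumes ultrafilter: "nonprincipal_ultrafilter \<omega>"
    and base: "x \<in> M n \<Longrightarrow> e n \<in> M n"
    and nonneg: "x \<in> M n \<Longrightarrow> y \<in> M n \<Longrightarrow> 0 \<le> D n x y"
    and refl: "x \<in> M n \<Longrightarrow> D n x x = 0"
    and sym: "x \<in> M n \<Longrightarrow> y \<in> M n \<Longrightarrow> D n x y = D n y x"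
    and triangle: "x \<in> M n \<Longrightarrow> y \<in> M n \<Longrightarrow> z \<in> M n \<Longrightarrow> D n x z \<le> D n x y + D n y z"
begin

abbreviation "cls \<equiv> ultra_class \<omega> M D e"
abbreviation "seqs \<equiv> ultra_seqs M D e"
abbreviation "udist \<equiv> ultra_dist \<omega> D"
abbreviation "carrier \<equiv> ultraproduct \<omega> M D e"

lemma not_bot [simp]: "\<omega> \<noteq> bot"
  using ultrafilter by (rule nonprincipal_ultrafilter_not_bot)

lemma seqs_mem: "x \<in> seqs \<Longrightarrow> x n \<in> M n"
  by (simp add: ultra_seqs_def)

lemma seqs_tendsto:
  assumes "x \<in> seqs" "y \<in> seqs"
  obtains r where "0 \<le> r" "((\<lambda>n. D n (x n) (y n)) \<longlongrightarrow> r) \<omega>"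
proof -
  from assms obtain B B' where B: "\<And>n. D n (x n) (e n) \<le> B" "\<And>n. D n (y n) (e n) \<le> B'"
    by (auto simp: ultra_seqs_def)
  have "D n (x n) (y n) \<le> B + B'" for n
    using triangle[of "x n" n "e n" "y n"] sym[of "e n" n "y n"] B(1)[of n]
      seqs_mem[OF assms(1), of n] seqs_mem[OF assms(2), of n] base[of "x n" n] B(2)[of n] by simp
  moreover have "0 \<le> D n (x n) (y n)" for n
    by (intro nonneg seqs_mem assms)
  ultimately show thesis
    using nonprincipal_ultrafilter_bounded[OF ultrafilter, of 0 "\<lambda>n. D n (x n) (y n)" "B + B'"] that
    by blast
qed

lemma equiv_ultra_rel: "equiv seqs (ultra_rel \<omega> M D e)"
proof (rule equivI)
  show "ultra_rel \<omega> M D e \<subseteq> seqs \<times> seqs"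
    by (auto simp: ultra_rel_def)
  show "refl_on seqs (ultra_rel \<omega> M D e)"
    by (auto simp: refl_on_def ultra_rel_def refl seqs_mem)
  show "Relation.sym (ultra_rel \<omega> M D e)"
    by (auto simp: sym_def ultra_rel_def seqs_mem sym)
  show "trans (ultra_rel \<omega> M D e)"
  proof (rule transI)
    fix x y z assume xyz: "(x, y) \<in> ultra_rel \<omega> M D e" "(y, z) \<in> ultra_rel \<omega> M D e"
    then have mem: "x \<in> seqs" "y \<in> seqs" "z \<in> seqs"
      by (auto simp: ultra_rel_def)
    have "((\<lambda>n. D n (x n) (y n) + D n (y n) (z n)) \<longlongrightarrow> 0) \<omega>"
      using xyz tendsto_add[of "\<lambda>n. D n (x n) (y n)" 0 \<omega> "\<lambda>n. D n (y n) (z n)" 0]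
      by (simp add: ultra_rel_def)
    then have "((\<lambda>n. D n (x n) (z n)) \<longlongrightarrow> 0) \<omega>"
      by (rule tendsto_zero_le) (auto simp: mem seqs_mem intro: nonneg triangle)
    with mem show "(x, z) \<in> ultra_rel \<omega> M D e"
      by (simp add: ultra_rel_def)
  qed
qed

lemma mem_cls_iff:
  "y \<in> cls x \<longleftrightarrow> x \<in> seqs \<and> y \<in> seqs \<and> ((\<lambda>n. D n (x n) (y n)) \<longlongrightarrow> 0) \<omega>"
  by (auto simp: ultra_class_def ultra_rel_def)

lemma mem_cls_self: "x \<in> seqs \<Longrightarrow> x \<in> cls x"
  by (simp add: mem_cls_iff refl seqs_mem)

lemma cls_eq_iff:
  "x \<in> seqs \<Longrightarrow> y \<in> seqs \<Longrightarrow> cls x = cls y \<longleftrightarrow> ((\<lambda>n. D n (x n) (y n)) \<longlongrightarrow> 0) \<omega>"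
  using equiv_class_eq_iff[OF equiv_ultra_rel, of x y] by (auto simp: ultra_class_def ultra_rel_def)

lemma cls_eqI:
  assumes "x \<in> seqs" "y \<in> seqs" "eventually (\<lambda>n. x n = y n) \<omega>"
  shows "cls x = cls y"
proof -
  have "eventually (\<lambda>n. D n (x n) (y n) = 0) \<omega>"
    using assms(3) by eventually_elim (metis refl seqs_mem assms(2))
  then show ?thesis
    using assms by (simp add: cls_eq_iff tendsto_eventually)
qed

lemma cls_mem_carrier: "x \<in> seqs \<Longrightarrow> cls x \<in> carrier"
  by (simp add: ultraproduct_def ultra_class_def quotientI)

lemma carrierE:
  assumes "A \<in> carrier"
  obtains x where "x \<in> seqs" "A = cls x"
  using assms by (auto simp: ultraproduct_def ultra_class_def quotient_def)

lemma carrier_mem_eq: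
  assumes "A \<in> carrier" "x \<in> A"
  shows "x \<in> seqs \<and> A = cls x"
proof -
  obtain a where "a \<in> seqs" "A = cls a"
    using assms carrierE by blast
  with assms(2) show ?thesis
    by (simp add: mem_cls_iff cls_eq_iff)
qed

text \<open>A change of representatives alters the \<open>n\<close>th distance by at most
  \<open>D n (x n) (x' n) + D n (y n) (y' n)\<close>, which tends to 0. So all representatives have
  the same limit, and the description in \<open>ultra_dist\<close> is well defined.\<close>

lemma udist_eq:
  assumes x: "x \<in> seqs" and y: "y \<in> seqs" and r: "((\<lambda>n. D n (x n) (y n)) \<longlongrightarrow> r) \<omega>"
  shows "udist (cls x) (cls y) = r"
  unfolding ultra_dist_def
proof (rule the_equality)
  show "\<exists>x'\<in>cls x. \<exists>y'\<in>cls y. ((\<lambda>n. D n (x' n) (y' n)) \<longlongrightarrow> r) \<omega>"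
    using x y r mem_cls_self by blast
next
  fix r' assume "\<exists>x'\<in>cls x. \<exists>y'\<in>cls y. ((\<lambda>n. D n (x' n) (y' n)) \<longlongrightarrow> r') \<omega>"
  then obtain x' y' where x': "x' \<in> cls x" and y': "y' \<in> cls y"
    and r': "((\<lambda>n. D n (x' n) (y' n)) \<longlongrightarrow> r') \<omega>"
    by blast
  have mem: "x' \<in> seqs" "y' \<in> seqs"
    using x' y' by (auto simp: mem_cls_iff)
  have "((\<lambda>n. D n (x n) (x' n) + D n (y n) (y' n)) \<longlongrightarrow> 0) \<omega>"
    using x' y' tendsto_add[of "\<lambda>n. D n (x n) (x' n)" 0 \<omega> "\<lambda>n. D n (y n) (y' n)" 0]
    by (simp add: mem_cls_iff)
  moreover have "\<bar>D n (x n) (y n) - D n (x' n) (y' n)\<bar> \<le> D n (x n) (x' n) + D n (y n) (y' n)" for n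
  proof -
    note m = seqs_mem[OF x, of n] seqs_mem[OF y, of n] seqs_mem[OF mem(1), of n] seqs_mem[OF mem(2), of n]
    show ?thesis
      using triangle[OF m(1) m(3) m(2)] triangle[OF m(3) m(4) m(2)] triangle[OF m(3) m(1) m(4)]
        triangle[OF m(1) m(2) m(4)] sym[OF m(1) m(3)] sym[OF m(2) m(4)]
      by linarith
  qed
  ultimately have "((\<lambda>n. \<bar>D n (x n) (y n) - D n (x' n) (y' n)\<bar>) \<longlongrightarrow> 0) \<omega>"
    by (auto intro: tendsto_zero_le)
  then have "((\<lambda>n. D n (x n) (y n) - D n (x' n) (y' n)) \<longlongrightarrow> 0) \<omega>"
    using tendsto_rabs_zero_iff by blast
  moreover have "((\<lambda>n. D n (x n) (y n) - D n (x' n) (y' n)) \<longlongrightarrow> r - r') \<omega>"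
    by (intro tendsto_diff r r')
  ultimately have "0 = r - r'"
    by (rule tendsto_unique[OF not_bot])
  then show "r' = r" by simp
qed

lemma tendsto_udist:
  assumes "x \<in> seqs" "y \<in> seqs"
  shows "((\<lambda>n. D n (x n) (y n)) \<longlongrightarrow> udist (cls x) (cls y)) \<omega>"
proof -
  obtain r where "((\<lambda>n. D n (x n) (y n)) \<longlongrightarrow> r) \<omega>"
    using seqs_tendsto[OF assms] by blast
  with udist_eq[OF assms] show ?thesis by simp
qed

lemma udist_nonneg:
  assumes "A \<in> carrier" "B \<in> carrier"
  shows "0 \<le> udist A B"
proof -
  obtain x where x: "x \<in> seqs" "A = cls x"
    using assms(1) by (rule carrierE)
  obtain y where y: "y \<in> seqs" "B = cls y"
    using assms(2) by (rule carrierE)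
  note xy = x y
  then obtain r where "0 \<le> r" "((\<lambda>n. D n (x n) (y n)) \<longlongrightarrow> r) \<omega>"
    using seqs_tendsto by blast
  with xy show ?thesis
    using udist_eq by simp
qed

lemma udist_eq_0_iff:
  assumes "A \<in> carrier" "B \<in> carrier"
  shows "udist A B = 0 \<longleftrightarrow> A = B"
proof -
  obtain x where x: "x \<in> seqs" "A = cls x"
    using assms(1) by (rule carrierE)
  obtain y where y: "y \<in> seqs" "B = cls y"
    using assms(2) by (rule carrierE)
  note xy = x y
  then show ?thesis
    using tendsto_udist[of x y] udist_eq[of x y 0] by (auto simp: cls_eq_iff)
qed

lemma udist_triangle:
  assumes "A \<in> carrier" "B \<in> carrier" "C \<in> carrier"
  shows "udist A C \<le> udist A B + udist B C"
proof -
  obtain x where x: "x \<in> seqs" "A = cls x"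
    using assms(1) by (rule carrierE)
  obtain y where y: "y \<in> seqs" "B = cls y"
    using assms(2) by (rule carrierE)
  obtain z where z: "z \<in> seqs" "C = cls z"
    using assms(3) by (rule carrierE)
  from x y z show ?thesis
    using tendsto_le[OF not_bot tendsto_add[OF tendsto_udist[of x y] tendsto_udist[of y z]]
        tendsto_udist[of x z]]
    by (simp add: seqs_mem triangle)
qed

text \<open>Completeness by a diagonal argument along \<open>\<omega>\<close>. It works for
  ultraproducts of incomplete factors too, since the limit is assembled coordinate by coordinate
  from the representatives.\<close>

lemma udist_Cauchy_convergent:
  assumes X: "\<And>k. X k \<in> carrier"
    and Cauchy: "\<And>\<epsilon>. \<epsilon> > 0 \<Longrightarrow> \<exists>N. \<forall>i\<ge>N. \<forall>j\<ge>N. udist (X i) (X j) < \<epsilon>"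
  obtains L where "L \<in> carrier" "(\<lambda>k. udist (X k) L) \<longlonglongrightarrow> 0"
proof -
  have "\<forall>k. \<exists>x. x \<in> seqs \<and> X k = cls x"
    by (meson X carrierE)
  then obtain x where x: "\<And>k. x k \<in> seqs" "\<And>k. X k = cls (x k)"
    by (rule choice[THEN exE]) blast
  have "\<forall>j. \<exists>N. \<forall>i\<ge>N. \<forall>k\<ge>N. udist (X i) (X k) < 1 / real (Suc j)"
    by (intro allI Cauchy) simp
  then obtain N0 where "\<forall>j. \<forall>i\<ge>N0 j. \<forall>k\<ge>N0 j. udist (X i) (X k) < 1 / real (Suc j)"
    by (rule choice[THEN exE])
  then have N0: "\<And>j i k. i \<ge> N0 j \<Longrightarrow> k \<ge> N0 j \<Longrightarrow> udist (X i) (X k) < 1 / real (Suc j)"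
    by blast
  \<comment> \<open>The maximum over earlier stages makes the thresholds monotone in
    \<open>j\<close>.\<close>
  define N where "N j = Max (N0 ` {..j})" for j
  have N0_le: "N0 i \<le> N j" if "i \<le> j" for i j
    unfolding N_def using that by (intro Max_ge) auto
  have N: "udist (X i) (X k) < 1 / real (Suc j)" if "i \<ge> N j" "k \<ge> N j" for i j k
    using that N0[of j i k] N0_le[of j j] by auto
  \<comment> \<open>\<open>Q j n\<close> says that the selected points up to stage \<open>j\<close>
    already satisfy their Cauchy estimates in coordinate \<open>n\<close>. For fixed
    \<open>j\<close> this holds \<open>\<omega>\<close>-almost surely.\<close>
  define Q where "Q j n \<longleftrightarrow> (\<forall>i\<in>{..j}. \<forall>k\<in>{..j}. i \<le> k \<longrightarrow> D n (x (N i) n) (x (N k) n) < 1 / real (Suc i))" for j n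
  have Q_ev: "eventually (Q j) \<omega>" for j
    unfolding Q_def
  proof (intro eventually_ball_finite ballI)
    fix i k assume "i \<in> {..j}" "k \<in> {..j}"
    show "eventually (\<lambda>n. i \<le> k \<longrightarrow> D n (x (N i) n) (x (N k) n) < 1 / real (Suc i)) \<omega>"
    proof (cases "i \<le> k")
      case True
      have "N i \<le> N k"
        unfolding N_def using True by (intro Max_mono) auto
      then have "udist (X (N i)) (X (N k)) < 1 / real (Suc i)"
        by (intro N) auto
      then have "eventually (\<lambda>n. D n (x (N i) n) (x (N k) n) < 1 / real (Suc i)) \<omega>"
        using order_tendstoD(2)[OF tendsto_udist[OF x(1) x(1)]] x(2) by metis
      then show ?thesis by eventually_elim simp
    qed simp
  qed simp_all
  have Q0: "Q 0 n" for n
    by (simp add: Q_def refl seqs_mem x)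
  \<comment> \<open>Coordinate \<open>n\<close> of the limit is taken from the latest stage valid at
    \<open>n\<close>. The bound \<open>j \<le> n\<close> keeps the set finite, and \<open>Q0\<close>
    keeps it nonempty.\<close>
  define J where "J n = Max {j. j \<le> n \<and> Q j n}" for n
  define y where "y n = x (N (J n)) n" for n
  have J: "Q (J n) n" for n
  proof -
    have "J n \<in> {j. j \<le> n \<and> Q j n}"
      unfolding J_def using Q0 by (intro Max_in) auto
    then show ?thesis by simp
  qed
  have J_ge: "i \<le> J n" if "i \<le> n" "Q i n" for i n
    unfolding J_def using that by (intro Max_ge) auto
  have near: "D n (x (N i) n) (y n) < 1 / real (Suc i)" if "i \<le> n" "Q i n" for i n
    using J[of n] J_ge[OF that] unfolding Q_def y_def by auto
  \<comment> \<open>Stage 0 is valid at every index, so \<open>y n\<close> stays within 1 of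
    \<open>x (N 0) n\<close>. This gives a bound at all \<open>n\<close>, as
    \<open>ultra_seqs\<close> demands.\<close>
  have y: "y \<in> seqs"
  proof -
    obtain B where B: "\<And>n. D n (x (N 0) n) (e n) \<le> B"
      using x(1)[of "N 0"] by (auto simp: ultra_seqs_def)
    have m: "y n \<in> M n" "x (N 0) n \<in> M n" "e n \<in> M n" for n
      using x seqs_mem base unfolding y_def by blast+
    have "D n (y n) (e n) \<le> 1 + B" for n
      using triangle[OF m(1,2,3), of n] near[of 0 n] Q0 B[of n] sym[OF m(1,2), of n] by simp
    then show ?thesis
      using m by (auto simp: ultra_seqs_def)
  qed
  have lim: "udist (X (N i)) (cls y) \<le> 1 / real (Suc i)" for i
  proof -
    have "eventually (\<lambda>n. i \<le> n) \<omega>"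
      using nonprincipal_ultrafilter_le_sequentially[OF ultrafilter] eventually_ge_at_top filter_leD by blast
    then have "eventually (\<lambda>n. D n (x (N i) n) (y n) \<le> 1 / real (Suc i)) \<omega>"
      using Q_ev[of i] by eventually_elim (use near less_imp_le in blast)
    then show ?thesis
      unfolding x(2) using tendsto_upperbound[OF tendsto_udist[OF x(1) y]] not_bot by blast
  qed
  have "(\<lambda>k. udist (X k) (cls y)) \<longlonglongrightarrow> 0"
  proof (rule metric_LIMSEQ_I)
    fix r :: real assume "r > 0"
    then obtain i where i: "1 / real (Suc i) < r / 2"
      using nat_approx_posE half_gt_zero by metis
    have "dist (udist (X k) (cls y)) 0 < r" if "k \<ge> N i" for k
      using udist_triangle[of "X k" "X (N i)" "cls y"] N[of i k "N i"] lim[of i] i that X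
        udist_nonneg[of "X k" "cls y"] cls_mem_carrier[OF y] by auto
    then show "\<exists>no. \<forall>n\<ge>no. dist (udist (X n) (cls y)) 0 < r" by blast
  qed
  then show thesis
    using that cls_mem_carrier[OF y] by blast
qed

end

section \<open>Comparison inequalities in CAT(0) spaces\<close>

text \<open>The third vertex is the origin. For \<open>a > 0\<close>, \<open>y\<close> is put on the
  first axis and \<open>z\<close> gets the first coordinate \<open>p\<close> prescribed by the law
  of cosines; the triangle inequalities amount to \<open>\<bar>p\<bar> \<le> b\<close>, so that a
  second coordinate exists.\<close>

lemma ex_comparison_triangle:
  fixes a b c :: real
  assumes "0 \<le> a" "0 \<le> b" "0 \<le> c" "a \<le> b + c" "b \<le> a + c" "c \<le> a + b"
  obtains y z :: "real^2" where "norm y = a" "norm z = b" "dist y z = c"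
proof -
  define v where "v p q = (\<chi> i. if i = (1::2) then p else q)" for p q :: real
  have norm_v: "norm (v p q) = sqrt (p\<^sup>2 + q\<^sup>2)" for p q
    by (simp add: norm_vec_def L2_set_def UNIV_2 v_def)
  have diff_v: "v p q - v p' q' = v (p - p') (q - q')" for p q p' q'
    by (simp add: vec_eq_iff v_def)
  show thesis
  proof (cases "a = 0")
    case True
    then have "b = c" using assms by simp
    then show thesis
      using that[of 0 "v b 0"] True assms by (simp add: norm_v dist_norm norm_minus_commute)
  next
    case False
    define p where "p = (a\<^sup>2 + b\<^sup>2 - c\<^sup>2) / (2 * a)"
    have a: "a > 0" using False assms by simp
    have "\<bar>a\<^sup>2 + b\<^sup>2 - c\<^sup>2\<bar> \<le> 2 * a * b"
    proof -
      have "\<bar>a - b\<bar>\<^sup>2 \<le> c\<^sup>2" "c\<^sup>2 \<le> (a + b)\<^sup>2"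
        using assms by (intro power_mono; simp)+
      then show ?thesis
        by (simp add: power2_eq_square algebra_simps abs_if split: if_splits)
    qed
    then have "\<bar>p\<bar> \<le> b"
      using a by (simp add: p_def field_simps abs_mult)
    then have "p\<^sup>2 \<le> b\<^sup>2"
      using power_mono[of "\<bar>p\<bar>" b 2] by simp
    then have q: "(sqrt (b\<^sup>2 - p\<^sup>2))\<^sup>2 = b\<^sup>2 - p\<^sup>2"
      by simp
    have "(a - p)\<^sup>2 + (b\<^sup>2 - p\<^sup>2) = c\<^sup>2"
      using a by (simp add: p_def power2_eq_square field_simps)
    then have "dist (v a 0) (v p (sqrt (b\<^sup>2 - p\<^sup>2))) = c"
      using assms q by (simp add: dist_norm diff_v norm_v)
    moreover have "norm (v a 0) = a" "norm (v p (sqrt (b\<^sup>2 - p\<^sup>2))) = b"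
      using assms q by (simp_all add: norm_v)
    ultimately show thesis
      using that by blast
  qed
qed

lemma is_geodesic_dist_start:
  "is_geodesic c x y \<Longrightarrow> s \<in> {0..dist x y} \<Longrightarrow> dist x (c s) = s"
  by (force simp: is_geodesic_def)

text \<open>With comparison vertices \<open>0\<close>, \<open>Y\<close>, \<open>Z\<close>, the
  comparison points are \<open>u *\<^sub>R Y\<close> and \<open>v *\<^sub>R Z\<close>. Expanding
  their squared distance and eliminating the inner product of \<open>Y\<close> and \<open>Z\<close>
  turns the CAT(0) condition into a polynomial inequality, the form in which it is used from here
  on.\<close>

lemma CAT0_comparison:
  fixes x y z :: "'a::metric_space"
  assumes CAT0: "CAT0_space TYPE('a)"
    and c: "is_geodesic c x y" and c': "is_geodesic c' x z"
    and u: "0 \<le> u" "u \<le> 1" and v: "0 \<le> v" "v \<le> 1"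
  shows "(dist (c (u * dist x y)) (c' (v * dist x z)))\<^sup>2 \<le>
           u\<^sup>2 * (dist x y)\<^sup>2 + v\<^sup>2 * (dist x z)\<^sup>2
           - u * v * ((dist x y)\<^sup>2 + (dist x z)\<^sup>2 - (dist y z)\<^sup>2)"
proof -
  obtain Y Z :: "real^2" where Y: "norm Y = dist x y" and Z: "norm Z = dist x z" and YZ: "dist Y Z = dist y z"
    using dist_triangle[of x y z] dist_triangle[of x z y] dist_triangle[of y z x]
    by (elim ex_comparison_triangle[rotated -1]) (auto simp: dist_commute)
  have ud: "u * dist x y \<in> {0..dist x y}" and vd: "v * dist x z \<in> {0..dist x z}"
    using u v by (auto simp: mult_left_le_one_le)
  have "dist (c (u * dist x y)) (c' (v * dist x z)) \<le> dist (u *\<^sub>R Y) (v *\<^sub>R Z)"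
  proof (rule CAT0[unfolded CAT0_space_def, THEN conjunct2, rule_format])
    show "geodesic_segment (c ` {0..dist x y}) x y" "geodesic_segment (c' ` {0..dist x z}) x z"
      using c c' by (auto simp: geodesic_segment_def)
    show "dist 0 Y = dist x y" "dist 0 Z = dist x z" "dist Y Z = dist y z"
      using Y Z YZ by auto
    show "c (u * dist x y) \<in> c ` {0..dist x y}" "c' (v * dist x z) \<in> c' ` {0..dist x z}"
      using ud vd by blast+
    show "u *\<^sub>R Y \<in> closed_segment 0 Y" "v *\<^sub>R Z \<in> closed_segment 0 Z"
      using u v by (auto simp: closed_segment_def)
    show "dist 0 (u *\<^sub>R Y) = dist x (c (u * dist x y))" "dist 0 (v *\<^sub>R Z) = dist x (c' (v * dist x z))"
      using is_geodesic_dist_start[OF c ud] is_geodesic_dist_start[OF c' vd] u v Y Z by simp_all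
  qed
  then have "(dist (c (u * dist x y)) (c' (v * dist x z)))\<^sup>2 \<le> (dist (u *\<^sub>R Y) (v *\<^sub>R Z))\<^sup>2"
    by (intro power_mono) auto
  also have "\<dots> = u\<^sup>2 * (norm Y)\<^sup>2 + v\<^sup>2 * (norm Z)\<^sup>2 - u * v * ((norm Y)\<^sup>2 + (norm Z)\<^sup>2 - (dist Y Z)\<^sup>2)"
    unfolding dist_norm power2_norm_eq_inner
    by (simp add: algebra_simps inner_commute power2_eq_square)
  finally show ?thesis
    by (simp add: Y Z YZ)
qed

lemma CAT0_ex_geodesic:
  fixes x y :: "'a::metric_space"
  assumes "CAT0_space TYPE('a)"
  obtains c where "is_geodesic c x y"
proof -
  have "\<forall>x y :: 'a. \<exists>c. is_geodesic c x y"
    using assms unfolding CAT0_space_def by (rule conjunct1)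
  then show thesis
    using that by blast
qed

text \<open>For equal fractions the right-hand side of \<open>CAT0_comparison\<close> collapses to
  the square of \<open>u * dist y z\<close>. Uniqueness of geodesics and non-expansiveness of the
  connecting maps both come from this.\<close>

lemma CAT0_contraction:
  fixes x y z :: "'a::metric_space"
  assumes CAT0: "CAT0_space TYPE('a)"
    and c: "is_geodesic c x y" and c': "is_geodesic c' x z" and u: "0 \<le> u" "u \<le> 1"
  shows "dist (c (u * dist x y)) (c' (u * dist x z)) \<le> u * dist y z"
proof -
  have "(dist (c (u * dist x y)) (c' (u * dist x z)))\<^sup>2 \<le> (u * dist y z)\<^sup>2"
    using CAT0_comparison[OF CAT0 c c' u u] by (simp add: power2_eq_square algebra_simps)
  then show ?thesis
    by (rule power2_le_imp_le) (use u in simp)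
qed

lemma CAT0_geodesic_unique:
  fixes x y :: "'a::metric_space"
  assumes CAT0: "CAT0_space TYPE('a)"
    and c: "is_geodesic c x y" and c': "is_geodesic c' x y" and s: "s \<in> {0..dist x y}"
  shows "c s = c' s"
proof (cases "dist x y = 0")
  case True
  with s c c' show ?thesis by (auto simp: is_geodesic_def)
next
  case False
  then have "0 < dist x y" by simp
  with s CAT0_contraction[OF CAT0 c c', of "s / dist x y"] show ?thesis
    by simp
qed

lemma comparison_cos_bounds:
  fixes p x y :: "'a::metric_space"
  shows "\<bar>((dist p x)\<^sup>2 + (dist p y)\<^sup>2 - (dist x y)\<^sup>2) / (2 * dist p x * dist p y)\<bar> \<le> 1"
proof -
  have "\<bar>dist p x - dist p y\<bar>\<^sup>2 \<le> (dist x y)\<^sup>2" "(dist x y)\<^sup>2 \<le> (dist p x + dist p y)\<^sup>2"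
    using dist_triangle[of p x y] dist_triangle[of p y x] dist_triangle[of x y p]
    by (intro power_mono; simp add: dist_commute abs_le_iff)+
  then have *: "\<bar>(dist p x)\<^sup>2 + (dist p y)\<^sup>2 - (dist x y)\<^sup>2\<bar> \<le> 2 * dist p x * dist p y"
    by (simp add: power2_eq_square algebra_simps abs_if split: if_splits)
  show ?thesis
  proof (cases "dist p x * dist p y = 0")
    case False
    then have "0 < dist p x * dist p y"
      by (simp add: zero_less_mult_iff)
    with * show ?thesis
      by (simp add: abs_divide abs_mult mult.assoc)
  qed auto
qed

lemma cos_comparison_angle:
  "cos (comparison_angle p x y) =
     ((dist p x)\<^sup>2 + (dist p y)\<^sup>2 - (dist x y)\<^sup>2) / (2 * dist p x * dist p y)"
  unfolding comparison_angle_def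
  using comparison_cos_bounds[of p x y] by (intro cos_arccos_abs)

lemma comparison_angle_bounds: "0 \<le> comparison_angle p x y" "comparison_angle p x y \<le> pi"
  unfolding comparison_angle_def
  using comparison_cos_bounds[of p x y] by (intro arccos_lbound arccos_ubound; linarith)+

text \<open>Degenerate triangles are covered: if \<open>p\<close> equals \<open>x\<close> or
  \<open>y\<close>, the factor in front of the cosine vanishes, so the default value of the quotient
  does no harm.\<close>

lemma law_of_cosines:
  "(dist x y)\<^sup>2 = (dist p x)\<^sup>2 + (dist p y)\<^sup>2 - 2 * dist p x * dist p y * cos (comparison_angle p x y)"
  by (cases "dist p x * dist p y = 0") (auto simp: cos_comparison_angle dist_commute field_simps)

lemma comparison_angle_commute: "comparison_angle p x y = comparison_angle p y x"
  by (simp add: comparison_angle_def dist_commute algebra_simps)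

text \<open>Cosine decreases between 0 and pi, so a bound on an angle becomes a polynomial
  inequality between distances; positive sides allow the denominator to be cleared.\<close>

lemma comparison_angle_leI:
  assumes "0 \<le> \<theta>" "\<theta> \<le> pi" "0 < dist p x" "0 < dist p y"
    "2 * dist p x * dist p y * cos \<theta> \<le> (dist p x)\<^sup>2 + (dist p y)\<^sup>2 - (dist x y)\<^sup>2"
  shows "comparison_angle p x y \<le> \<theta>"
proof -
  have "cos \<theta> \<le> cos (comparison_angle p x y)"
    using assms by (simp add: cos_comparison_angle field_simps)
  then show ?thesis
    using assms comparison_angle_bounds[of p x y] cos_mono_le_eq by blast
qed

text \<open>Take fractions \<open>s / a\<close> and \<open>t / b\<close> in
  \<open>CAT0_comparison\<close>: the distance of \<open>c s\<close> and \<open>c' t\<close> is at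
  most the third side of a Euclidean triangle with sides \<open>s\<close>, \<open>t\<close>
  enclosing the comparison angle of the large triangle.\<close>

lemma CAT0_comparison_angle_mono:
  fixes x y z :: "'a::metric_space"
  assumes CAT0: "CAT0_space TYPE('a)"
    and c: "is_geodesic c x y" and c': "is_geodesic c' x z"
    and s: "0 < s" "s \<le> dist x y" and t: "0 < t" "t \<le> dist x z"
  shows "comparison_angle x (c s) (c' t) \<le> comparison_angle x y z"
proof (rule comparison_angle_leI)
  have dc: "dist x (c s) = s" "dist x (c' t) = t"
    using s t by (auto intro!: is_geodesic_dist_start[OF c] is_geodesic_dist_start[OF c'])
  then show "0 < dist x (c s)" "0 < dist x (c' t)"
    using s t by auto
  define a b where "a = dist x y" and "b = dist x z"
  have ab: "a > 0" "b > 0" using s t by (auto simp: a_def b_def)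
  have "(dist (c s) (c' t))\<^sup>2 \<le> s\<^sup>2 + t\<^sup>2 - s / a * (t / b) * (a\<^sup>2 + b\<^sup>2 - (dist y z)\<^sup>2)"
    using CAT0_comparison[OF CAT0 c c', of "s / a" "t / b"] s t ab
    by (simp add: a_def[symmetric] b_def[symmetric] power_divide)
  also have "a\<^sup>2 + b\<^sup>2 - (dist y z)\<^sup>2 = 2 * a * b * cos (comparison_angle x y z)"
    using law_of_cosines[of y z x] by (simp add: a_def b_def)
  finally show "2 * dist x (c s) * dist x (c' t) * cos (comparison_angle x y z)
      \<le> (dist x (c s))\<^sup>2 + (dist x (c' t))\<^sup>2 - (dist (c s) (c' t))\<^sup>2"
    using ab by (simp add: dc)
qed (use comparison_angle_bounds in auto)

lemma CAT0_midpoint: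
  fixes x y :: "'a::metric_space"
  assumes CAT0: "CAT0_space TYPE('a)"
  obtains m where "dist x m = dist x y / 2" "dist y m = dist x y / 2"
proof -
  obtain c where c: "is_geodesic c x y"
    using CAT0_ex_geodesic[OF CAT0] by blast
  then have c1: "c 0 = x" "c (dist x y) = y"
    and c2: "\<And>s t. s \<in> {0..dist x y} \<Longrightarrow> t \<in> {0..dist x y} \<Longrightarrow> dist (c s) (c t) = \<bar>s - t\<bar>"
    by (auto simp: is_geodesic_def)
  show thesis
    using that[of "c (dist x y / 2)"] c1 c2[of 0 "dist x y / 2"] c2[of "dist x y" "dist x y / 2"]
    by simp
qed

text \<open>Let \<open>\<phi>\<close> be half the comparison angle at \<open>p\<close>. The
  comparison triangle is isosceles with height \<open>k = t * cos \<phi>\<close>, and the squared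
  half base is \<open>t\<^sup>2 - k\<^sup>2\<close>. With \<open>h = dist p m\<close> the claim
  reduces to \<open>2 * h * k \<le> h\<^sup>2 + k\<^sup>2\<close>.\<close>

lemma comparison_angle_midpoint:
  assumes "dist x m = dist x y / 2"
    and "dist p x = t" "dist p y = t" "0 < t" "0 < dist p m"
  shows "comparison_angle p x m \<le> comparison_angle p x y / 2"
proof (rule comparison_angle_leI)
  define \<phi> where "\<phi> = comparison_angle p x y / 2"
  define h where "h = dist p m"
  have \<phi>: "0 \<le> \<phi>" "\<phi> \<le> pi / 2"
    using comparison_angle_bounds[of p x y] by (auto simp: \<phi>_def)
  have "(dist x y)\<^sup>2 = 2 * t\<^sup>2 - 2 * t\<^sup>2 * cos (2 * \<phi>)"
    using law_of_cosines[of x y p] assms by (simp add: \<phi>_def power2_eq_square)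
  then have d: "(dist x y)\<^sup>2 = 4 * t\<^sup>2 - 4 * t\<^sup>2 * (cos \<phi>)\<^sup>2"
    by (simp only: cos_double_cos) (simp add: algebra_simps)
  define k where "k = t * cos \<phi>"
  have "0 \<le> (k - h)\<^sup>2" by simp
  then have "2 * h * k \<le> k\<^sup>2 + h\<^sup>2"
    by (simp add: power2_eq_square algebra_simps)
  moreover have "(dist x m)\<^sup>2 = t\<^sup>2 - k\<^sup>2"
    unfolding assms(1) by (simp add: d k_def power_divide power_mult_distrib)
  ultimately show "2 * dist p x * dist p m * cos (comparison_angle p x y / 2)
      \<le> (dist p x)\<^sup>2 + (dist p m)\<^sup>2 - (dist x m)\<^sup>2"
    using assms(2) by (simp add: h_def k_def \<phi>_def[symmetric] algebra_simps)
qed (use assms comparison_angle_bounds[of p x y] in auto)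

section \<open>The angle metric\<close>

text \<open>The third side in the law of cosines and, for angles between 0 and pi, the distance in
  the Euclidean cone. Sharing one formula connects distances along rays with distances in the
  cone.\<close>

definition euclidean_side :: "real \<Rightarrow> real \<Rightarrow> real \<Rightarrow> real" where
  "euclidean_side a b \<theta> = sqrt (a\<^sup>2 + b\<^sup>2 - 2 * a * b * cos \<theta>)"

lemma euclidean_side_arg_nonneg:
  fixes a b \<theta> :: real
  shows "0 \<le> a \<Longrightarrow> 0 \<le> b \<Longrightarrow> (a - b)\<^sup>2 \<le> a\<^sup>2 + b\<^sup>2 - 2 * a * b * cos \<theta>"
  using mult_left_mono[of "cos \<theta>" 1 "2 * a * b"] by (simp add: power2_eq_square algebra_simps)

lemma power2_euclidean_side:
  assumes "0 \<le> a" "0 \<le> b"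
  shows "(euclidean_side a b \<theta>)\<^sup>2 = a\<^sup>2 + b\<^sup>2 - 2 * a * b * cos \<theta>"
  using euclidean_side_arg_nonneg[OF assms, of \<theta>] unfolding euclidean_side_def
  by (intro real_sqrt_pow2) (meson order_trans zero_le_power2)

lemma euclidean_side_nonneg: "0 \<le> a \<Longrightarrow> 0 \<le> b \<Longrightarrow> 0 \<le> euclidean_side a b \<theta>"
  using euclidean_side_arg_nonneg[of a b \<theta>] unfolding euclidean_side_def
  by (intro real_sqrt_ge_zero) (meson order_trans zero_le_power2)

lemma euclidean_side_commute: "euclidean_side a b \<theta> = euclidean_side b a \<theta>"
  by (simp add: euclidean_side_def algebra_simps)

lemma euclidean_side_zero: "euclidean_side a b 0 = \<bar>a - b\<bar>"
  by (simp add: euclidean_side_def power2_diff[symmetric])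

lemma euclidean_side_radius_zero [simp]: "euclidean_side 0 b \<theta> = \<bar>b\<bar>" "euclidean_side a 0 \<theta> = \<bar>a\<bar>"
  by (simp_all add: euclidean_side_def)

lemma euclidean_side_eq_0_iff:
  assumes "0 \<le> a" "0 \<le> b" "0 \<le> \<theta>" "\<theta> \<le> pi"
  shows "euclidean_side a b \<theta> = 0 \<longleftrightarrow> a = b \<and> (a = 0 \<or> \<theta> = 0)"
proof
  assume 0: "euclidean_side a b \<theta> = 0"
  then have *: "a\<^sup>2 + b\<^sup>2 - 2 * a * b * cos \<theta> = 0"
    using power2_euclidean_side[OF assms(1,2), of \<theta>] by simp
  then have ab: "a = b"
    using euclidean_side_arg_nonneg[OF assms(1,2), of \<theta>] by simp
  have "cos \<theta> = 1" if "a \<noteq> 0"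
    using * that ab by (simp add: power2_eq_square field_simps)
  then have "\<theta> = 0" if "a \<noteq> 0"
    using that assms cos_inj_pi[of \<theta> 0] by simp
  with ab show "a = b \<and> (a = 0 \<or> \<theta> = 0)" by blast
qed (auto simp: euclidean_side_zero)

lemma tendsto_euclidean_side [tendsto_intros]:
  "(f \<longlongrightarrow> a) F \<Longrightarrow> (g \<longlongrightarrow> b) F \<Longrightarrow> (h \<longlongrightarrow> \<theta>) F \<Longrightarrow>
     ((\<lambda>x. euclidean_side (f x) (g x) (h x)) \<longlongrightarrow> euclidean_side a b \<theta>) F"
  unfolding euclidean_side_def by (intro tendsto_intros isCont_tendsto_compose[OF isCont_cos])

text \<open>
  \<open>q\<close> is the distance from the origin at which the direction of angle \<open>A\<close> meets the segment from
  the unit vector of angle \<open>0\<close> to that of angle \<open>A + B\<close>.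
\<close>

lemma ex_collinear_point:
  assumes "0 \<le> A" "0 \<le> B" "A + B < pi"
  obtains q where "0 \<le> q"
    "euclidean_side 1 q A + euclidean_side q 1 B = euclidean_side 1 1 (A + B)"
proof -
  have sA: "0 \<le> sin A" and sB: "0 \<le> sin B" and sAB: "0 \<le> sin (A + B)"
    using assms by (auto intro!: sin_ge_zero)
  \<comment> \<open>The point dividing the segment in the ratio \<open>u : 1 - u\<close> lies on the
    direction of angle \<open>A\<close> when its normal component vanishes, which is
    \<open>eq\<close> below; \<open>q\<close> is its component along that direction. If both sines
    are 0, then \<open>u\<close> is 0 by the convention for division.\<close>
  define u where "u = sin A / (sin A + sin B)"
  define q where "q = (1 - u) * cos A + u * cos B"
  define C where "C = cos (A + B)"
  have u: "0 \<le> u" "u \<le> 1"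
    using sA sB by (auto simp: u_def divide_le_eq_1)
  have eq: "(1 - u) * sin A = u * sin B"
  proof (cases "sin A + sin B = 0")
    case True
    then have "sin A = 0" "sin B = 0" using sA sB by linarith+
    then show ?thesis by simp
  next
    case False
    then show ?thesis by (simp add: u_def field_simps)
  qed
  have "0 \<le> q"
  proof (cases "sin A + sin B = 0")
    case True
    then have "sin A = 0" using sA sB by linarith
    then have "A = 0" using assms sin_gt_zero[of A] by force
    with True show ?thesis by (simp add: q_def u_def)
  next
    case False
    then have u1: "1 - u = sin B / (sin A + sin B)"
      by (simp add: u_def field_simps)
    have "q = sin (A + B) / (sin A + sin B)"
      unfolding q_def u1 by (simp add: u_def sin_add add_divide_distrib mult.commute)
    with sA sB sAB show ?thesis by simp
  qed
  have C: "C = cos A * cos B - sin A * sin B"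
    by (simp add: C_def cos_add)
  have sc: "(sin A)\<^sup>2 = 1 - (cos A)\<^sup>2" "(sin B)\<^sup>2 = 1 - (cos B)\<^sup>2"
    by (simp_all add: sin_squared_eq)
  have "q\<^sup>2 + ((1 - u) * sin A - u * sin B)\<^sup>2 = (1 - u)\<^sup>2 + u\<^sup>2 + 2 * u * (1 - u) * C"
  proof -
    have "q\<^sup>2 + ((1 - u) * sin A - u * sin B)\<^sup>2 =
       (1 - u)\<^sup>2 * ((cos A)\<^sup>2 + (sin A)\<^sup>2) + u\<^sup>2 * ((cos B)\<^sup>2 + (sin B)\<^sup>2)
       + 2 * u * (1 - u) * (cos A * cos B - sin A * sin B)"
      unfolding q_def by algebra
    then show ?thesis by (simp add: C)
  qed
  then have q2: "q\<^sup>2 = (1 - u)\<^sup>2 + u\<^sup>2 + 2 * u * (1 - u) * C"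
    using eq by simp
  have qA: "q * cos A = (1 - u) + u * C"
  proof -
    have "q * cos A = (1 - u) * (cos A)\<^sup>2 + u * (cos A * cos B)"
      by (simp add: q_def power2_eq_square algebra_simps)
    also have "\<dots> = (1 - u) - (1 - u) * sin A * sin A + u * (cos A * cos B)"
      using sc(1) by algebra
    also have "\<dots> = (1 - u) + u * C"
      unfolding eq C by (simp add: algebra_simps)
    finally show ?thesis .
  qed
  have qB: "q * cos B = u + (1 - u) * C"
  proof -
    have "q * cos B = u * (cos B)\<^sup>2 + (1 - u) * (cos A * cos B)"
      by (simp add: q_def power2_eq_square algebra_simps)
    also have "\<dots> = u - (u * sin B) * sin B + (1 - u) * (cos A * cos B)"
      using sc(2) by algebra
    also have "\<dots> = u + (1 - u) * C"
      unfolding eq[symmetric] C by (simp add: algebra_simps)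
    finally show ?thesis .
  qed
  \<comment> \<open>The two pieces of the segment turn out to be \<open>u\<close> and
    \<open>1 - u\<close> times the whole chord.\<close>
  have "1 + q\<^sup>2 - 2 * (q * cos A) = u\<^sup>2 * (2 - 2 * C)"
    unfolding q2 qA by (simp add: power2_eq_square algebra_simps)
  then have "euclidean_side 1 q A = u * sqrt (2 - 2 * C)"
    using u by (simp add: euclidean_side_def real_sqrt_mult mult.assoc)
  moreover have "q\<^sup>2 + 1 - 2 * (q * cos B) = (1 - u)\<^sup>2 * (2 - 2 * C)"
    unfolding q2 qB by (simp add: power2_eq_square algebra_simps)
  then have "euclidean_side q 1 B = (1 - u) * sqrt (2 - 2 * C)"
    using u by (simp add: euclidean_side_def real_sqrt_mult mult.assoc)
  moreover have "euclidean_side 1 1 (A + B) = sqrt (2 - 2 * C)"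
    by (simp add: euclidean_side_def C_def)
  ultimately show thesis
    using that[OF \<open>0 \<le> q\<close>] by (simp add: algebra_simps)
qed

lemma comparison_angle_self: "x \<noteq> p \<Longrightarrow> comparison_angle p x x = 0"
  by (simp add: comparison_angle_def power2_eq_square)

lemma angle_metric_commute: "angle_metric x0 \<alpha> \<beta> = angle_metric x0 \<beta> \<alpha>"
  by (simp add: angle_metric_def comparison_angle_commute)

section \<open>Rays from a base point: comparison angles, cone distances and the triangle
  inequality\<close>

locale CAT0_basepoint =
  fixes x0 :: "'a::metric_space"
  assumes CAT0: "CAT0_space TYPE('a)"
begin

abbreviation rays where "rays \<equiv> bdry x0"
abbreviation angle where "angle \<equiv> angle_metric x0"

lemma ray_zero: "\<alpha> \<in> rays \<Longrightarrow> \<alpha> 0 = x0"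
  by (simp add: bdry_def)

lemma dist_ray: "\<alpha> \<in> rays \<Longrightarrow> 0 \<le> s \<Longrightarrow> 0 \<le> t \<Longrightarrow> dist (\<alpha> s) (\<alpha> t) = \<bar>s - t\<bar>"
  by (simp add: bdry_def)

lemma dist_base_ray: "\<alpha> \<in> rays \<Longrightarrow> 0 \<le> t \<Longrightarrow> dist x0 (\<alpha> t) = t"
  using dist_ray[of \<alpha> 0 t] by (simp add: ray_zero)

lemma ray_is_geodesic: "\<alpha> \<in> rays \<Longrightarrow> 0 \<le> t \<Longrightarrow> is_geodesic \<alpha> x0 (\<alpha> t)"
  by (simp add: is_geodesic_def dist_base_ray ray_zero dist_ray)

lemma comparison_angle_ray_mono:
  assumes "\<alpha> \<in> rays" "\<beta> \<in> rays" "0 < s" "s \<le> s'" "0 < t" "t \<le> t'"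
  shows "comparison_angle x0 (\<alpha> s) (\<beta> t) \<le> comparison_angle x0 (\<alpha> s') (\<beta> t')"
  using assms
  by (intro CAT0_comparison_angle_mono[OF CAT0 ray_is_geodesic ray_is_geodesic])
    (auto simp: dist_base_ray)

text \<open>Monotone and bounded by pi, the comparison angles converge to their supremum. This gives
  the \<open>Lim\<close> in \<open>angle_metric\<close> its meaning.\<close>

lemma tendsto_angle:
  assumes "\<alpha> \<in> rays" "\<beta> \<in> rays"
  shows "((\<lambda>t. comparison_angle x0 (\<alpha> t) (\<beta> t)) \<longlongrightarrow> angle \<alpha> \<beta>) at_top"
proof -
  let ?f = "\<lambda>t. comparison_angle x0 (\<alpha> t) (\<beta> t)"
  have bdd: "bdd_above (?f ` {0<..})"
    using comparison_angle_bounds(2) by (auto simp: bdd_above_def)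
  have "(?f \<longlongrightarrow> (SUP t\<in>{0<..}. ?f t)) at_top"
  proof (rule increasing_tendsto)
    show "eventually (\<lambda>t. ?f t \<le> (SUP t\<in>{0<..}. ?f t)) at_top"
      using eventually_gt_at_top[of 0] by eventually_elim (auto intro!: cSUP_upper bdd)
  next
    fix l assume "l < (SUP t\<in>{0<..}. ?f t)"
    then obtain t where t: "t \<in> {0<..}" "l < ?f t"
      using less_cSUP_iff[OF _ bdd, of l] by auto
    show "eventually (\<lambda>s. l < ?f s) at_top"
      using eventually_ge_at_top[of t]
    proof eventually_elim
      case (elim s)
      then show ?case
        using t comparison_angle_ray_mono[OF assms, of t s t s] by auto
    qed
  qed
  then show ?thesis
    unfolding angle_metric_def by (simp add: tendsto_Lim)
qed

lemma angle_bounds: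
  assumes "\<alpha> \<in> rays" "\<beta> \<in> rays"
  shows "0 \<le> angle \<alpha> \<beta>" "angle \<alpha> \<beta> \<le> pi"
  using tendsto_lowerbound[OF tendsto_angle[OF assms], of 0] tendsto_upperbound[OF tendsto_angle[OF assms], of pi]
  by (simp_all add: comparison_angle_bounds)

lemma comparison_angle_le_angle:
  assumes "\<alpha> \<in> rays" "\<beta> \<in> rays" "0 < s" "0 < t"
  shows "comparison_angle x0 (\<alpha> s) (\<beta> t) \<le> angle \<alpha> \<beta>"
proof (rule tendsto_lowerbound[OF tendsto_angle[OF assms(1,2)]])
  show "eventually (\<lambda>r. comparison_angle x0 (\<alpha> s) (\<beta> t) \<le> comparison_angle x0 (\<alpha> r) (\<beta> r)) at_top"
    using eventually_ge_at_top[of s] eventually_ge_at_top[of t]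
    by eventually_elim (use assms in \<open>auto intro: comparison_angle_ray_mono\<close>)
qed simp

lemma angle_leI:
  assumes "\<alpha> \<in> rays" "\<beta> \<in> rays" "\<And>t. 0 < t \<Longrightarrow> comparison_angle x0 (\<alpha> t) (\<beta> t) \<le> \<theta>"
  shows "angle \<alpha> \<beta> \<le> \<theta>"
proof (rule tendsto_upperbound[OF tendsto_angle[OF assms(1,2)]])
  show "eventually (\<lambda>t. comparison_angle x0 (\<alpha> t) (\<beta> t) \<le> \<theta>) at_top"
    using eventually_gt_at_top[of "0::real"] by eventually_elim (rule assms(3))
qed simp

lemma angle_self:
  assumes "\<alpha> \<in> rays"
  shows "angle \<alpha> \<alpha> = 0"
proof -
  have "angle \<alpha> \<alpha> \<le> 0"
  proof (rule angle_leI[OF assms assms])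
    fix t :: real assume "0 < t"
    then have "\<alpha> t \<noteq> x0"
      using dist_base_ray[OF assms, of t] by auto
    then show "comparison_angle x0 (\<alpha> t) (\<alpha> t) \<le> 0"
      by (simp add: comparison_angle_self)
  qed
  with angle_bounds[OF assms assms] show ?thesis by simp
qed

lemma dist_rays_eq:
  assumes "\<alpha> \<in> rays" "\<beta> \<in> rays" "0 \<le> a" "0 \<le> b" "0 \<le> s"
  shows "dist (\<alpha> (a * s)) (\<beta> (b * s)) =
    s * euclidean_side a b (comparison_angle x0 (\<alpha> (a * s)) (\<beta> (b * s)))"
proof -
  let ?c = "comparison_angle x0 (\<alpha> (a * s)) (\<beta> (b * s))"
  have "(dist (\<alpha> (a * s)) (\<beta> (b * s)))\<^sup>2 = (s * euclidean_side a b ?c)\<^sup>2"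
    using law_of_cosines[of "\<alpha> (a * s)" "\<beta> (b * s)" x0] assms
    unfolding power_mult_distrib power2_euclidean_side[OF assms(3,4)]
    by (simp add: dist_base_ray power2_eq_square algebra_simps)
  then show ?thesis
    using assms by (simp add: power2_eq_iff_nonneg euclidean_side_nonneg)
qed

lemma dist_rays_le:
  assumes "\<alpha> \<in> rays" "\<beta> \<in> rays" "0 \<le> a" "0 \<le> b" "0 \<le> s"
  shows "dist (\<alpha> (a * s)) (\<beta> (b * s)) \<le> s * euclidean_side a b (angle \<alpha> \<beta>)"
proof (cases "a = 0 \<or> b = 0 \<or> s = 0")
  case True
  with assms show ?thesis
    by (auto simp: dist_rays_eq)
next
  case False
  then have pos: "0 < a" "0 < b" "0 < s" using assms by auto
  let ?c = "comparison_angle x0 (\<alpha> (a * s)) (\<beta> (b * s))"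
  have "cos (angle \<alpha> \<beta>) \<le> cos ?c"
    using comparison_angle_le_angle[OF assms(1,2), of "a * s" "b * s"] pos angle_bounds[OF assms(1,2)]
      comparison_angle_bounds by (intro cos_monotone_0_pi_le) auto
  then have "euclidean_side a b ?c \<le> euclidean_side a b (angle \<alpha> \<beta>)"
    using pos by (simp add: euclidean_side_def)
  with pos assms show ?thesis
    by (simp add: dist_rays_eq)
qed

lemma dist_rays_tendsto:
  assumes "\<alpha> \<in> rays" "\<beta> \<in> rays" "0 \<le> a" "0 \<le> b"
  shows "((\<lambda>s. dist (\<alpha> (a * s)) (\<beta> (b * s)) / s) \<longlongrightarrow> euclidean_side a b (angle \<alpha> \<beta>)) at_top"
proof -
  have "((\<lambda>s. euclidean_side a b (comparison_angle x0 (\<alpha> (a * s)) (\<beta> (b * s))))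
      \<longlongrightarrow> euclidean_side a b (angle \<alpha> \<beta>)) at_top"
  proof (cases "a = 0 \<or> b = 0")
    case True
    then show ?thesis by auto
  next
    case False
    \<comment> \<open>The two points have different radii, so their comparison angle is squeezed
      between the one at the common radius \<open>m * s\<close> and the limit angle.\<close>
    define m where "m = min a b"
    have pos: "0 < a" "0 < b" "0 < m" "m \<le> a" "m \<le> b" using assms False by (auto simp: m_def)
    have "filterlim (\<lambda>s. m * s) at_top at_top"
      using pos by (simp add: filterlim_tendsto_pos_mult_at_top[OF tendsto_const] filterlim_ident)
    then have lower: "((\<lambda>s. comparison_angle x0 (\<alpha> (m * s)) (\<beta> (m * s))) \<longlongrightarrow> angle \<alpha> \<beta>) at_top"
      by (rule filterlim_compose[OF tendsto_angle[OF assms(1,2)]])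
    have "((\<lambda>s. comparison_angle x0 (\<alpha> (a * s)) (\<beta> (b * s))) \<longlongrightarrow> angle \<alpha> \<beta>) at_top"
    proof (rule tendsto_sandwich[OF _ _ lower tendsto_const])
      show "eventually (\<lambda>s. comparison_angle x0 (\<alpha> (m * s)) (\<beta> (m * s))
          \<le> comparison_angle x0 (\<alpha> (a * s)) (\<beta> (b * s))) at_top"
        using eventually_gt_at_top[of 0]
        by eventually_elim (use pos assms in \<open>auto intro!: comparison_angle_ray_mono\<close>)
      show "eventually (\<lambda>s. comparison_angle x0 (\<alpha> (a * s)) (\<beta> (b * s)) \<le> angle \<alpha> \<beta>) at_top"
        using eventually_gt_at_top[of 0]
        by eventually_elim (use pos assms in \<open>auto intro!: comparison_angle_le_angle\<close>)
    qed
    then show ?thesis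
      by (intro tendsto_intros)
  qed
  moreover have "eventually (\<lambda>s. euclidean_side a b (comparison_angle x0 (\<alpha> (a * s)) (\<beta> (b * s))) =
      dist (\<alpha> (a * s)) (\<beta> (b * s)) / s) at_top"
    using eventually_gt_at_top[of 0] by eventually_elim (use assms in \<open>simp add: dist_rays_eq\<close>)
  ultimately show ?thesis
    by (rule Lim_transform_eventually)
qed

lemma euclidean_side_angle_triangle:
  assumes "\<alpha> \<in> rays" "\<beta> \<in> rays" "\<gamma> \<in> rays" "0 \<le> a" "0 \<le> b" "0 \<le> c"
  shows "euclidean_side a c (angle \<alpha> \<gamma>) \<le> euclidean_side a b (angle \<alpha> \<beta>) + euclidean_side b c (angle \<beta> \<gamma>)"
proof (rule tendsto_le)
  show "((\<lambda>s. dist (\<alpha> (a * s)) (\<gamma> (c * s)) / s) \<longlongrightarrow> euclidean_side a c (angle \<alpha> \<gamma>)) at_top"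
    by (intro dist_rays_tendsto assms)
  show "((\<lambda>s. dist (\<alpha> (a * s)) (\<beta> (b * s)) / s + dist (\<beta> (b * s)) (\<gamma> (c * s)) / s)
      \<longlongrightarrow> euclidean_side a b (angle \<alpha> \<beta>) + euclidean_side b c (angle \<beta> \<gamma>)) at_top"
    by (intro tendsto_add dist_rays_tendsto assms)
  show "eventually (\<lambda>s. dist (\<alpha> (a * s)) (\<gamma> (c * s)) / s
      \<le> dist (\<alpha> (a * s)) (\<beta> (b * s)) / s + dist (\<beta> (b * s)) (\<gamma> (c * s)) / s) at_top"
    using eventually_gt_at_top[of 0]
    by eventually_elim (simp add: add_divide_distrib[symmetric] divide_right_mono dist_triangle)
qed simp

text \<open>If the sum is below pi, put the middle ray at the radius \<open>q\<close> for which the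
  two Euclidean triangles line up along a straight chord. The cone triangle inequality with radii 1,
  \<open>q\<close>, 1 then compares the chord for \<open>angle \<alpha> \<gamma>\<close> with the
  chord for the sum, and chords increase with the angle.\<close>

lemma angle_triangle:
  assumes "\<alpha> \<in> rays" "\<beta> \<in> rays" "\<gamma> \<in> rays"
  shows "angle \<alpha> \<gamma> \<le> angle \<alpha> \<beta> + angle \<beta> \<gamma>"
proof (cases "angle \<alpha> \<beta> + angle \<beta> \<gamma> < pi")
  case True
  have nonneg: "0 \<le> angle \<alpha> \<beta>" "0 \<le> angle \<beta> \<gamma>"
    by (intro angle_bounds assms)+
  obtain q where q: "0 \<le> q" "euclidean_side 1 q (angle \<alpha> \<beta>) + euclidean_side q 1 (angle \<beta> \<gamma>) =
      euclidean_side 1 1 (angle \<alpha> \<beta> + angle \<beta> \<gamma>)"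
    using ex_collinear_point[OF nonneg True] by blast
  have "euclidean_side 1 1 (angle \<alpha> \<gamma>) \<le> euclidean_side 1 1 (angle \<alpha> \<beta> + angle \<beta> \<gamma>)"
    using euclidean_side_angle_triangle[OF assms, of 1 q 1] q by simp
  then have "cos (angle \<alpha> \<beta> + angle \<beta> \<gamma>) \<le> cos (angle \<alpha> \<gamma>)"
    by (simp add: euclidean_side_def)
  then show ?thesis
    using True nonneg angle_bounds[OF assms(1,3)] cos_mono_le_eq by auto
next
  case False
  then show ?thesis
    using angle_bounds[OF assms(1,3)] by linarith
qed

end

section \<open>The Tits metric\<close>

text \<open>The limit is taken in the law of cosines, where all terms are continuous, instead of in
  a quotient under \<open>arccos\<close>. That \<open>a\<close> and \<open>b\<close> differ from
  \<open>p\<close> allows the return to angles at the end.\<close>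

lemma comparison_angle_limit_le:
  assumes F: "F \<noteq> bot" and x: "(x \<longlongrightarrow> a) F" and y: "(y \<longlongrightarrow> b) F" and \<theta>: "(\<theta> \<longlongrightarrow> t) F"
    and le: "eventually (\<lambda>n. comparison_angle p (x n) (y n) \<le> \<theta> n) F"
    and pi: "eventually (\<lambda>n. \<theta> n \<le> pi) F" and neq: "a \<noteq> p" "b \<noteq> p"
  shows "comparison_angle p a b \<le> t"
proof (rule comparison_angle_leI)
  have nonneg: "eventually (\<lambda>n. 0 \<le> \<theta> n) F"
    using le by eventually_elim (meson comparison_angle_bounds(1) order_trans)
  show "0 \<le> t"
    by (rule tendsto_lowerbound[OF \<theta> nonneg F])
  show "t \<le> pi"
    by (rule tendsto_upperbound[OF \<theta> pi F])
  show "2 * dist p a * dist p b * cos t \<le> (dist p a)\<^sup>2 + (dist p b)\<^sup>2 - (dist a b)\<^sup>2"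
  proof (rule tendsto_le[OF F])
    show "((\<lambda>n. 2 * dist p (x n) * dist p (y n) * cos (\<theta> n)) \<longlongrightarrow> 2 * dist p a * dist p b * cos t) F"
      by (intro tendsto_intros isCont_tendsto_compose[OF isCont_cos] x y \<theta>)
    show "((\<lambda>n. (dist p (x n))\<^sup>2 + (dist p (y n))\<^sup>2 - (dist (x n) (y n))\<^sup>2)
        \<longlongrightarrow> (dist p a)\<^sup>2 + (dist p b)\<^sup>2 - (dist a b)\<^sup>2) F"
      by (intro tendsto_intros x y)
    show "eventually (\<lambda>n. 2 * dist p (x n) * dist p (y n) * cos (\<theta> n)
        \<le> (dist p (x n))\<^sup>2 + (dist p (y n))\<^sup>2 - (dist (x n) (y n))\<^sup>2) F"
      using le pi
    proof eventually_elim
      case (elim n)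
      then have "cos (\<theta> n) \<le> cos (comparison_angle p (x n) (y n))"
        by (intro cos_monotone_0_pi_le comparison_angle_bounds)
      then have "2 * dist p (x n) * dist p (y n) * cos (\<theta> n)
          \<le> 2 * dist p (x n) * dist p (y n) * cos (comparison_angle p (x n) (y n))"
        by (intro mult_left_mono) auto
      then show ?case
        using law_of_cosines[of "x n" "y n" p] by simp
    qed
  qed
qed (use neq in auto)

lemma dyadic_floor_tendsto: "(\<lambda>k. real (nat \<lfloor>s * 2 ^ k\<rfloor>) / 2 ^ k) \<longlonglongrightarrow> s" if "0 \<le> s" for s :: real
proof (rule tendsto_sandwich)
  have "(\<lambda>k. s - (1/2) ^ k) \<longlonglongrightarrow> s - 0"
    by (intro tendsto_intros LIMSEQ_power_zero) auto
  then show "(\<lambda>k. s - 1 / 2 ^ k) \<longlonglongrightarrow> s"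
    by (simp add: power_one_over)
  show "eventually (\<lambda>k. s - 1 / 2 ^ k \<le> real (nat \<lfloor>s * 2 ^ k\<rfloor>) / 2 ^ k) sequentially"
  proof (intro always_eventually allI)
    fix k :: nat
    have "s * 2 ^ k - 1 \<le> real (nat \<lfloor>s * 2 ^ k\<rfloor>)"
      using that by linarith
    then have "(s * 2 ^ k - 1) / 2 ^ k \<le> real (nat \<lfloor>s * 2 ^ k\<rfloor>) / 2 ^ k"
      by (intro divide_right_mono) auto
    then show "s - 1 / 2 ^ k \<le> real (nat \<lfloor>s * 2 ^ k\<rfloor>) / 2 ^ k"
      by (simp add: diff_divide_distrib)
  qed
  show "eventually (\<lambda>k. real (nat \<lfloor>s * 2 ^ k\<rfloor>) / 2 ^ k \<le> s) sequentially"
    using that by (intro always_eventually allI) (simp add: field_simps)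
qed simp

section \<open>Limits of rays in proper spaces; midpoints and geodesics for the angle metric\<close>

locale proper_CAT0_basepoint = CAT0_basepoint x0 for x0 :: "'a::metric_space" +
  fixes \<omega> :: "nat filter"
  assumes proper: "proper_space TYPE('a)"
    and ultrafilter: "nonprincipal_ultrafilter \<omega>"
begin

lemma not_bot [simp]: "\<omega> \<noteq> bot"
  using ultrafilter by (rule nonprincipal_ultrafilter_not_bot)

text \<open>For \<open>\<omega>\<close>-almost all \<open>n\<close> the point \<open>c n s\<close>
  lies in the compact ball of radius \<open>s\<close>, so limits exist pointwise. The ultrafilter
  replaces the diagonal subsequence of an Arzela-Ascoli argument, since it serves all
  \<open>s\<close> at once.\<close>

lemma ex_ray_limit:
  assumes T: "filterlim T at_top \<omega>"
    and c0: "\<And>n. c n 0 = x0"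
    and c: "\<And>n s t. s \<in> {0..T n} \<Longrightarrow> t \<in> {0..T n} \<Longrightarrow> dist (c n s) (c n t) = \<bar>s - t\<bar>"
  obtains \<mu> where "\<mu> \<in> rays" "\<And>s. 0 \<le> s \<Longrightarrow> ((\<lambda>n. c n s) \<longlongrightarrow> \<mu> s) \<omega>"
proof -
  have ev: "eventually (\<lambda>n. s \<le> T n) \<omega>" for s
    using T by (simp add: filterlim_at_top)
  have "\<exists>l. ((\<lambda>n. c n s) \<longlongrightarrow> l) \<omega>" if "0 \<le> s" for s
  proof -
    have "compact (cball x0 s)"
      using proper by (simp add: proper_space_def)
    moreover have "eventually (\<lambda>n. c n s \<in> cball x0 s) \<omega>"
      using ev[of s]
    proof eventually_elim
      case (elim n)
      then show ?case
        using c[of 0 n s] that by (simp add: c0)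
    qed
    ultimately show ?thesis
      using nonprincipal_ultrafilter_compact[OF ultrafilter, of "cball x0 s" "\<lambda>n. c n s"] by blast
  qed
  then have "\<forall>s\<in>{0..}. \<exists>l. ((\<lambda>n. c n s) \<longlongrightarrow> l) \<omega>"
    by simp
  then obtain l where "\<forall>s\<in>{0..}. ((\<lambda>n. c n s) \<longlongrightarrow> l s) \<omega>"
    by (rule bchoice[THEN exE])
  then have l: "\<And>s. 0 \<le> s \<Longrightarrow> ((\<lambda>n. c n s) \<longlongrightarrow> l s) \<omega>"
    by simp
  have "l 0 = x0"
    using l[of 0] tendsto_unique[OF not_bot _ tendsto_const] by (simp add: c0)
  moreover have "dist (l s) (l t) = \<bar>s - t\<bar>" if "0 \<le> s" "0 \<le> t" for s t
  proof -
    have "eventually (\<lambda>n. dist (c n s) (c n t) = \<bar>s - t\<bar>) \<omega>"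
      using ev[of s] ev[of t] by eventually_elim (use that in \<open>auto intro: c\<close>)
    then have "((\<lambda>n. dist (c n s) (c n t)) \<longlongrightarrow> \<bar>s - t\<bar>) \<omega>"
      by (rule tendsto_eventually)
    then show ?thesis
      using tendsto_unique[OF not_bot tendsto_dist[OF l[OF that(1)] l[OF that(2)]]] by blast
  qed
  ultimately have "restrict l {0..} \<in> rays"
    by (simp add: bdry_def)
  then show thesis
    using that[of "restrict l {0..}"] l by simp
qed

text \<open>The angle of two rays bounds their comparison angles at every radius and is the least
  such bound, and at a fixed radius these angles pass to pointwise limits. So the angle is lower
  semicontinuous.\<close>

lemma angle_limit_le:
  assumes "\<alpha> \<in> rays" "\<beta> \<in> rays"
    and "\<And>s. 0 \<le> s \<Longrightarrow> ((\<lambda>n. c n s) \<longlongrightarrow> \<alpha> s) \<omega>" "\<And>s. 0 \<le> s \<Longrightarrow> ((\<lambda>n. c' n s) \<longlongrightarrow> \<beta> s) \<omega>"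
    and "(\<theta> \<longlongrightarrow> t) \<omega>" "\<And>n. \<theta> n \<le> pi"
    and "\<And>s. 0 < s \<Longrightarrow> eventually (\<lambda>n. comparison_angle x0 (c n s) (c' n s) \<le> \<theta> n) \<omega>"
  shows "angle \<alpha> \<beta> \<le> t"
proof (rule angle_leI[OF assms(1,2)])
  fix s :: real assume s: "0 < s"
  then have "\<alpha> s \<noteq> x0" "\<beta> s \<noteq> x0"
    using dist_base_ray[OF assms(1), of s] dist_base_ray[OF assms(2), of s] by auto
  then show "comparison_angle x0 (\<alpha> s) (\<beta> s) \<le> t"
    using s by (intro comparison_angle_limit_le[OF not_bot assms(3,4,5,7)]) (auto simp: assms(6))
qed

lemma ex_angle_midpoint:
  assumes rays: "\<alpha> \<in> rays" "\<beta> \<in> rays" and lt: "angle \<alpha> \<beta> < pi"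
  obtains \<mu> where "\<mu> \<in> rays" "angle \<alpha> \<mu> \<le> angle \<alpha> \<beta> / 2" "angle \<mu> \<beta> \<le> angle \<alpha> \<beta> / 2"
proof -
  define d where "d n = dist (\<alpha> (real n)) (\<beta> (real n))" for n :: nat
  have "\<forall>n. \<exists>m. dist (\<alpha> (real n)) m = d n / 2 \<and> dist (\<beta> (real n)) m = d n / 2"
    unfolding d_def by (meson CAT0_midpoint[OF CAT0])
  then obtain m where "\<forall>n. dist (\<alpha> (real n)) (m n) = d n / 2 \<and> dist (\<beta> (real n)) (m n) = d n / 2"
    by (rule choice[THEN exE])
  then have m: "\<And>n. dist (\<alpha> (real n)) (m n) = d n / 2" "\<And>n. dist (\<beta> (real n)) (m n) = d n / 2"
    by auto
  have "\<forall>n. \<exists>c. is_geodesic c x0 (m n)"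
    by (meson CAT0_ex_geodesic[OF CAT0])
  then obtain c where "\<forall>n. is_geodesic (c n) x0 (m n)"
    by (rule choice[THEN exE])
  then have c: "\<And>n. is_geodesic (c n) x0 (m n)"
    by blast
  define h where "h n = dist x0 (m n)" for n
  \<comment> \<open>\<open>L * n\<close> bounds the distance of the rays at radius \<open>n\<close>.
    Since the angle is below pi, \<open>L < 2\<close>, and the triangle inequality through the ray
    pushes the midpoints to infinity at a linear rate.\<close>
  define L where "L = euclidean_side 1 1 (angle \<alpha> \<beta>)"
  have "cos pi < cos (angle \<alpha> \<beta>)"
    using angle_bounds[OF rays] lt by (intro cos_monotone_0_pi) auto
  then have "L < 2"
    using real_sqrt_less_mono[of "2 - 2 * cos (angle \<alpha> \<beta>)" 4] by (simp add: L_def euclidean_side_def)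
  have h_ge: "(1 - L / 2) * real n \<le> h n" for n
    using dist_rays_le[OF rays, of 1 1 "real n"] dist_triangle[of x0 "\<alpha> (real n)" "m n"]
      dist_base_ray[OF rays(1), of "real n"] m(1)[of n]
    by (simp add: d_def h_def L_def dist_commute algebra_simps)
  have "filterlim (\<lambda>n. (1 - L / 2) * real n) at_top sequentially"
    using \<open>L < 2\<close> by (intro filterlim_tendsto_pos_mult_at_top[OF tendsto_const] filterlim_real_sequentially) auto
  then have "filterlim h at_top sequentially"
    by (rule filterlim_at_top_mono) (simp add: h_ge)
  then have h: "filterlim h at_top \<omega>"
    by (rule nonprincipal_ultrafilter_tendsto[OF ultrafilter])
  obtain \<mu> where \<mu>: "\<mu> \<in> rays" "\<And>s. 0 \<le> s \<Longrightarrow> ((\<lambda>n. c n s) \<longlongrightarrow> \<mu> s) \<omega>"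
    using c by (elim ex_ray_limit[OF h, of c, rotated -1]) (auto simp: is_geodesic_def h_def)
  \<comment> \<open>Formulated for a generic pair so that it applies to \<open>\<alpha>\<close>,
    \<open>\<beta>\<close> in either order.\<close>
  have bound: "angle \<gamma> \<mu> \<le> angle \<alpha> \<beta> / 2"
    if \<gamma>: "\<gamma> \<in> rays" and \<gamma>': "\<gamma>' \<in> rays"
      and m: "\<And>n. dist (\<gamma> (real n)) (m n) = dist (\<gamma> (real n)) (\<gamma>' (real n)) / 2"
      and eq: "angle \<gamma> \<gamma>' = angle \<alpha> \<beta>" for \<gamma> \<gamma>'
  proof (rule angle_limit_le[OF \<gamma> \<mu>(1) tendsto_const \<mu>(2) tendsto_const])
    show "angle \<alpha> \<beta> / 2 \<le> pi"
      using lt pi_gt_zero by linarith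
    fix s :: real assume s: "0 < s"
    have "eventually (\<lambda>n. s \<le> h n) \<omega>"
      using h by (simp add: filterlim_at_top)
    moreover have "eventually (\<lambda>n. s \<le> real n) \<omega>"
      using nonprincipal_ultrafilter_tendsto[OF ultrafilter filterlim_real_sequentially]
      by (simp add: filterlim_at_top)
    ultimately show "eventually (\<lambda>n. comparison_angle x0 (\<gamma> s) (c n s) \<le> angle \<alpha> \<beta> / 2) \<omega>"
    proof eventually_elim
      case (elim n)
      have "comparison_angle x0 (\<gamma> s) (c n s) \<le> comparison_angle x0 (\<gamma> (real n)) (m n)"
        using elim s by (intro CAT0_comparison_angle_mono[OF CAT0 ray_is_geodesic[OF \<gamma>] c])
          (auto simp: dist_base_ray[OF \<gamma>] h_def)
      also have "\<dots> \<le> comparison_angle x0 (\<gamma> (real n)) (\<gamma>' (real n)) / 2"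
        using elim s by (intro comparison_angle_midpoint[where t = "real n"] m)
          (auto simp: dist_base_ray \<gamma> \<gamma>' h_def)
      also have "\<dots> \<le> angle \<gamma> \<gamma>' / 2"
        using comparison_angle_le_angle[OF \<gamma> \<gamma>', of "real n" "real n"] elim s by simp
      finally show ?case
        by (simp add: eq)
    qed
  qed
  have "angle \<alpha> \<mu> \<le> angle \<alpha> \<beta> / 2"
    by (rule bound[OF rays]) (auto simp: m d_def)
  moreover have "angle \<beta> \<mu> \<le> angle \<alpha> \<beta> / 2"
    by (rule bound[OF rays(2,1)])
      (simp_all add: m(2) d_def dist_commute[of "\<beta> _" "\<alpha> _"] angle_metric_commute)
  ultimately show thesis
    using that \<mu>(1) angle_metric_commute[of x0 \<beta> \<mu>] by simp
qed

text \<open>Bisection only bounds the angles of the halves from above. A bound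
  \<open>\<theta>\<close> separate from the angle is therefore carried through the induction, and
  both halves enter with \<open>\<theta> / 2\<close>.\<close>

lemma ex_dyadic_chain:
  assumes "\<alpha> \<in> rays" "\<beta> \<in> rays" "angle \<alpha> \<beta> \<le> \<theta>" "\<theta> < pi"
  shows "\<exists>z. z 0 = \<alpha> \<and> z (2 ^ k) = \<beta> \<and> (\<forall>i. z i \<in> rays) \<and>
    (\<forall>i<2 ^ k. angle (z i) (z (Suc i)) \<le> \<theta> / 2 ^ k)"
  using assms
proof (induction k arbitrary: \<alpha> \<beta> \<theta>)
  case 0
  then show ?case
    by (intro exI[of _ "\<lambda>i. if i = 0 then \<alpha> else \<beta>"]) auto
next
  case (Suc k)
  then obtain \<mu> where \<mu>: "\<mu> \<in> rays" "angle \<alpha> \<mu> \<le> angle \<alpha> \<beta> / 2" "angle \<mu> \<beta> \<le> angle \<alpha> \<beta> / 2"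
    using ex_angle_midpoint[of \<alpha> \<beta>] by (metis order_le_less_trans)
  have *: "angle \<alpha> \<mu> \<le> \<theta> / 2" "angle \<mu> \<beta> \<le> \<theta> / 2" "\<theta> / 2 < pi"
    using \<mu> Suc.prems pi_gt_zero by linarith+
  obtain z where z: "z 0 = \<alpha>" "z (2 ^ k) = \<mu>" "\<And>i. z i \<in> rays"
      "\<And>i. i < 2 ^ k \<Longrightarrow> angle (z i) (z (Suc i)) \<le> \<theta> / 2 / 2 ^ k"
    using Suc.IH[OF Suc.prems(1) \<mu>(1) *(1,3)] by blast
  obtain z' where z': "z' 0 = \<mu>" "z' (2 ^ k) = \<beta>" "\<And>i. z' i \<in> rays"
      "\<And>i. i < 2 ^ k \<Longrightarrow> angle (z' i) (z' (Suc i)) \<le> \<theta> / 2 / 2 ^ k"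
    using Suc.IH[OF \<mu>(1) Suc.prems(2) *(2,3)] by blast
  define w where "w i = (if i \<le> 2 ^ k then z i else z' (i - 2 ^ k))" for i
  have "angle (w i) (w (Suc i)) \<le> \<theta> / 2 ^ Suc k" if "i < 2 ^ Suc k" for i
  proof (cases "i < 2 ^ k")
    case True
    then show ?thesis
      using z(4)[OF True] by (simp add: w_def)
  next
    case False
    then have "w i = z' (i - 2 ^ k)" "w (Suc i) = z' (Suc (i - 2 ^ k))"
      using z(2) z'(1) by (auto simp: w_def Suc_diff_le)
    then show ?thesis
      using z'(4)[of "i - 2 ^ k"] False that by simp
  qed
  moreover have "w 0 = \<alpha>" "w (2 ^ Suc k) = \<beta>" "\<forall>i. w i \<in> rays"
    using z z' by (auto simp: w_def)
  ultimately show ?case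
    by blast
qed

lemma angle_chain_le:
  assumes z: "\<And>i. z i \<in> rays" "\<And>i. i < N \<Longrightarrow> angle (z i) (z (Suc i)) \<le> \<delta>"
    and "i \<le> j" "j \<le> N"
  shows "angle (z i) (z j) \<le> (real j - real i) * \<delta>"
  using assms(3,4)
proof (induction j rule: dec_induct)
  case base
  then show ?case by (simp add: angle_self z)
next
  case (step m)
  then have "angle (z i) (z (Suc m)) \<le> (real m - real i) * \<delta> + \<delta>"
    using angle_triangle[OF z(1) z(1) z(1), of i "Suc m" m] z(2)[of m] by simp
  then show ?case
    by (simp add: algebra_simps)
qed

text \<open>Chains for different \<open>k\<close> are chosen independently and need not refine each
  other. So the ray at parameter \<open>s\<close> is the \<open>\<omega>\<close>-limit over
  \<open>k\<close> of the ray at index \<open>I s k\<close> in the \<open>k\<close>th chain; lower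
  semicontinuity carries the Lipschitz bound of the chains to the limit.\<close>

lemma ex_angle_geodesic:
  assumes rays: "\<alpha> \<in> rays" "\<beta> \<in> rays" and lt: "angle \<alpha> \<beta> < pi"
  obtains \<gamma> where "\<gamma> 0 = \<alpha>" "\<gamma> 1 = \<beta>" "\<And>s. s \<in> {0..1} \<Longrightarrow> \<gamma> s \<in> rays"
    "\<And>s t. s \<in> {0..1} \<Longrightarrow> t \<in> {0..1} \<Longrightarrow> angle (\<gamma> s) (\<gamma> t) \<le> \<bar>s - t\<bar> * angle \<alpha> \<beta>"
proof -
  define \<theta> where "\<theta> = angle \<alpha> \<beta>"
  have \<theta>: "0 \<le> \<theta>" "\<theta> < pi"
    using angle_bounds[OF rays] lt by (auto simp: \<theta>_def)
  have "\<forall>k. \<exists>z. z 0 = \<alpha> \<and> z (2 ^ k) = \<beta> \<and> (\<forall>i. z i \<in> rays) \<and>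
      (\<forall>i<2 ^ k. angle (z i) (z (Suc i)) \<le> \<theta> / 2 ^ k)"
    using ex_dyadic_chain[OF rays _ \<theta>(2)] by (simp add: \<theta>_def)
  then obtain z where z0: "\<forall>k. z k 0 = \<alpha> \<and> z k (2 ^ k) = \<beta> \<and> (\<forall>i. z k i \<in> rays) \<and>
      (\<forall>i<2 ^ k. angle (z k i) (z k (Suc i)) \<le> \<theta> / 2 ^ k)"
    by (rule choice[THEN exE])
  then have z: "\<And>k. z k 0 = \<alpha>" "\<And>k. z k (2 ^ k) = \<beta>" "\<And>k i. z k i \<in> rays"
      "\<And>k i. i < 2 ^ k \<Longrightarrow> angle (z k i) (z k (Suc i)) \<le> \<theta> / 2 ^ k"
    by auto
  define I where "I s k = nat \<lfloor>s * 2 ^ k\<rfloor>" for s :: real and k :: nat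
  have "\<exists>\<mu>. \<mu> \<in> rays \<and> (\<forall>t\<ge>0. ((\<lambda>k. z k (I s k) t) \<longlongrightarrow> \<mu> t) \<omega>)" for s
  proof -
    have T: "filterlim real at_top \<omega>"
      using nonprincipal_ultrafilter_tendsto[OF ultrafilter filterlim_real_sequentially] .
    have "\<And>k. z k (I s k) 0 = x0"
      by (simp add: ray_zero z(3))
    moreover have "\<And>k r t. r \<in> {0..real k} \<Longrightarrow> t \<in> {0..real k} \<Longrightarrow>
        dist (z k (I s k) r) (z k (I s k) t) = \<bar>r - t\<bar>"
      by (simp add: dist_ray z(3))
    ultimately obtain \<mu> where "\<mu> \<in> rays" "\<And>t. 0 \<le> t \<Longrightarrow> ((\<lambda>k. z k (I s k) t) \<longlongrightarrow> \<mu> t) \<omega>"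
      using ex_ray_limit[OF T, of "\<lambda>k. z k (I s k)"] by blast
    then show ?thesis
      by blast
  qed
  then have "\<forall>s. \<exists>\<mu>. \<mu> \<in> rays \<and> (\<forall>t\<ge>0. ((\<lambda>k. z k (I s k) t) \<longlongrightarrow> \<mu> t) \<omega>)"
    by blast
  then obtain \<gamma> where "\<forall>s. \<gamma> s \<in> rays \<and> (\<forall>t\<ge>0. ((\<lambda>k. z k (I s k) t) \<longlongrightarrow> \<gamma> s t) \<omega>)"
    by (rule choice[THEN exE])
  then have \<gamma>: "\<And>s. \<gamma> s \<in> rays" "\<And>s t. 0 \<le> t \<Longrightarrow> ((\<lambda>k. z k (I s k) t) \<longlongrightarrow> \<gamma> s t) \<omega>"
    by auto
  \<comment> \<open>At parameters 0 and 1 the sampled rays do not change with \<open>k\<close>, so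
    the limit is that ray. Equality as functions comes from extensionality.\<close>
  have const: "\<gamma> s = \<delta>" if "\<delta> \<in> rays" "\<And>k. z k (I s k) = \<delta>" for s \<delta>
  proof (rule extensionalityI)
    show "\<gamma> s \<in> extensional {0..}" "\<delta> \<in> extensional {0..}"
      using that \<gamma>(1) by (auto simp: bdry_def)
    fix t :: real assume "t \<in> {0..}"
    then show "\<gamma> s t = \<delta> t"
      using \<gamma>(2)[of t s] tendsto_unique[OF not_bot _ tendsto_const] that by simp
  qed
  have ends: "\<gamma> 0 = \<alpha>" "\<gamma> 1 = \<beta>"
    by (auto intro!: const rays simp: I_def z nat_power_eq)
  have le: "angle (\<gamma> s) (\<gamma> t) \<le> (t - s) * \<theta>" if st: "0 \<le> s" "s \<le> t" "t \<le> 1" for s t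
  proof (rule angle_limit_le[OF \<gamma>(1) \<gamma>(1) \<gamma>(2) \<gamma>(2)])
    have lim: "((\<lambda>k. real (I r k) / 2 ^ k) \<longlongrightarrow> r) \<omega>" if "0 \<le> r" for r
      unfolding I_def using nonprincipal_ultrafilter_tendsto[OF ultrafilter dyadic_floor_tendsto[OF that]] .
    show "((\<lambda>k. (real (I t k) / 2 ^ k - real (I s k) / 2 ^ k) * \<theta>) \<longlongrightarrow> (t - s) * \<theta>) \<omega>"
      using st by (intro tendsto_intros lim) auto
    have "I t k \<le> 2 ^ k" for k
    proof -
      have "t * 2 ^ k \<le> 2 ^ k" using st by simp
      then have "\<lfloor>t * 2 ^ k\<rfloor> \<le> 2 ^ k"
        by (metis floor_mono floor_numeral_power)
      then show ?thesis
        by (simp add: I_def nat_le_iff)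
    qed
    moreover have "I s k \<le> I t k" for k
      unfolding I_def using st by (intro nat_mono floor_mono mult_right_mono) auto
    ultimately have I: "I s k \<le> I t k" "I t k \<le> 2 ^ k" for k
      by auto
    show "(real (I t k) / 2 ^ k - real (I s k) / 2 ^ k) * \<theta> \<le> pi" for k
    proof -
      have "real (I t k) \<le> 2 ^ k"
        using I(2)[of k] by (metis of_nat_le_iff of_nat_numeral of_nat_power)
      then have "real (I t k) / 2 ^ k \<le> 1"
        by simp
      then have "(real (I t k) / 2 ^ k - real (I s k) / 2 ^ k) * \<theta> \<le> 1 * \<theta>"
        using \<theta> by (intro mult_right_mono) (auto intro: order_trans[of _ "real (I t k) / 2 ^ k"])
      then show ?thesis using \<theta> by simp
    qed
    fix r :: real assume r: "0 < r"
    have "comparison_angle x0 (z k (I s k) r) (z k (I t k) r)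
        \<le> (real (I t k) / 2 ^ k - real (I s k) / 2 ^ k) * \<theta>" for k
      using comparison_angle_le_angle[OF z(3) z(3) r r, of k "I s k" k "I t k"]
        angle_chain_le[of "z k" "2 ^ k" "\<theta> / 2 ^ k" "I s k" "I t k", OF z(3) z(4) I] 
      by (simp add: algebra_simps diff_divide_distrib)
    then show "eventually (\<lambda>k. comparison_angle x0 (z k (I s k) r) (z k (I t k) r)
        \<le> (real (I t k) / 2 ^ k - real (I s k) / 2 ^ k) * \<theta>) \<omega>"
      by simp
  qed auto
  show thesis
  proof (rule that[OF ends \<gamma>(1)])
    fix s t :: real assume "s \<in> {0..1}" "t \<in> {0..1}"
    then show "angle (\<gamma> s) (\<gamma> t) \<le> \<bar>s - t\<bar> * angle \<alpha> \<beta>"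
      using le[of s t] le[of t s] angle_metric_commute[of x0 "\<gamma> s" "\<gamma> t"]
      by (cases "s \<le> t") (auto simp: \<theta>_def)
  qed
qed

lemma angle_le_tits_metric: "ennreal (angle \<alpha> \<beta>) \<le> tits_metric x0 \<alpha> \<beta>"
  unfolding tits_metric_def induced_path_metric_def
proof (rule INF_greatest)
  fix c assume c: "c \<in> {c. metric_path rays angle c \<and> c 0 = \<alpha> \<and> c 1 = \<beta>}"
  \<comment> \<open>This encodes the partition of the unit interval into one step.\<close>
  define s :: "nat \<Rightarrow> real" where "s i = (if i = 0 then 0 else 1)" for i
  have "(1, s) \<in> {(n::nat, s). mono s \<and> range s \<subseteq> {0..1}}"
    by (auto simp: s_def mono_def)
  then have "(\<Sum>i<1. ennreal (angle (c (s i)) (c (s (Suc i))))) \<le> metric_path_length angle c"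
    unfolding metric_path_length_def by (rule SUP_upper2) simp
  then show "ennreal (angle \<alpha> \<beta>) \<le> metric_path_length angle c"
    using c by (simp add: s_def)
qed

text \<open>The path from \<open>ex_angle_geodesic\<close> is Lipschitz with constant
  \<open>\<theta>\<close>, so the sum over any partition is dominated by a telescoping sum of at
  most \<open>\<theta>\<close>.\<close>

lemma tits_metric_le_angle:
  assumes rays: "\<alpha> \<in> rays" "\<beta> \<in> rays" and lt: "angle \<alpha> \<beta> < pi"
  shows "tits_metric x0 \<alpha> \<beta> \<le> ennreal (angle \<alpha> \<beta>)"
proof -
  define \<theta> where "\<theta> = angle \<alpha> \<beta>"
  obtain \<gamma> where ends: "\<gamma> 0 = \<alpha>" "\<gamma> 1 = \<beta>" and mem: "\<And>s. s \<in> {0..1} \<Longrightarrow> \<gamma> s \<in> rays"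
    and \<gamma>: "\<And>s t. s \<in> {0..1} \<Longrightarrow> t \<in> {0..1} \<Longrightarrow> angle (\<gamma> s) (\<gamma> t) \<le> \<bar>s - t\<bar> * \<theta>"
    using ex_angle_geodesic[OF assms] unfolding \<theta>_def by blast
  have \<theta>: "0 \<le> \<theta>"
    using angle_bounds[OF rays] by (simp add: \<theta>_def)
  have path: "metric_path rays angle \<gamma>"
    unfolding metric_path_def
  proof (intro conjI ballI)
    show "\<gamma> ` {0..1} \<subseteq> rays"
      using mem by blast
    fix s :: real assume s: "s \<in> {0..1}"
    show "((\<lambda>u. angle (\<gamma> s) (\<gamma> u)) \<longlongrightarrow> 0) (at s within {0..1})"
    proof (rule tendsto_sandwich[OF _ _ tendsto_const])
      have "((\<lambda>u. \<bar>s - u\<bar> * \<theta>) \<longlongrightarrow> \<bar>s - s\<bar> * \<theta>) (at s within {0..1})"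
        by (intro tendsto_intros)
      then show "((\<lambda>u. \<bar>s - u\<bar> * \<theta>) \<longlongrightarrow> 0) (at s within {0..1})"
        by simp
      show "eventually (\<lambda>u. 0 \<le> angle (\<gamma> s) (\<gamma> u)) (at s within {0..1})"
        using s unfolding eventually_at_filter by (intro always_eventually) (auto intro!: angle_bounds mem)
      show "eventually (\<lambda>u. angle (\<gamma> s) (\<gamma> u) \<le> \<bar>s - u\<bar> * \<theta>) (at s within {0..1})"
        using s unfolding eventually_at_filter by (intro always_eventually) (auto intro!: \<gamma>)
    qed
  qed
  have "metric_path_length angle \<gamma> \<le> ennreal \<theta>"
    unfolding metric_path_length_def
  proof (rule SUP_least, clarify)
    fix n :: nat and s :: "nat \<Rightarrow> real"
    assume mono: "mono s" and range: "range s \<subseteq> {0..1}"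
    have s: "s i \<in> {0..1}" "s i \<le> s (Suc i)" for i
      using range mono by (auto simp: image_subset_iff monoD)
    have "(\<Sum>i<n. ennreal (angle (\<gamma> (s i)) (\<gamma> (s (Suc i))))) =
        ennreal (\<Sum>i<n. angle (\<gamma> (s i)) (\<gamma> (s (Suc i))))"
      by (intro sum_ennreal angle_bounds mem s)
    also have "(\<Sum>i<n. angle (\<gamma> (s i)) (\<gamma> (s (Suc i)))) \<le> (\<Sum>i<n. (s (Suc i) - s i) * \<theta>)"
      using \<gamma>[OF s(1) s(1)] s(2) by (intro sum_mono) (metis abs_minus_commute abs_of_nonneg diff_ge_0_iff_ge)
    also have "\<dots> = (s n - s 0) * \<theta>"
      by (simp add: sum_distrib_right[symmetric] sum_lessThan_telescope)
    also have "\<dots> \<le> 1 * \<theta>"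
      using s(1)[of n] s(1)[of 0] \<theta> by (intro mult_right_mono) auto
    finally show "(\<Sum>i<n. ennreal (angle (\<gamma> (s i)) (\<gamma> (s (Suc i))))) \<le> ennreal \<theta>"
      by (simp add: ennreal_leI)
  qed
  then show ?thesis
    unfolding tits_metric_def induced_path_metric_def \<theta>_def using path ends
    by (intro INF_lower2) auto
qed

text \<open>Below pi the two bounds on the Tits metric agree. At angle pi no geodesic has been
  constructed, but the lower bound alone already makes the minimum equal to pi.\<close>

lemma min_pi_tits_metric:
  assumes rays: "\<alpha> \<in> rays" "\<beta> \<in> rays"
  shows "min (ennreal pi) (tits_metric x0 \<alpha> \<beta>) = ennreal (angle \<alpha> \<beta>)"
proof (cases "angle \<alpha> \<beta> < pi")
  case True
  then have "tits_metric x0 \<alpha> \<beta> = ennreal (angle \<alpha> \<beta>)"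
    using tits_metric_le_angle[OF rays] angle_le_tits_metric by (simp add: antisym)
  with True show ?thesis
    by (simp add: min_absorb2 ennreal_leI)
next
  case False
  then have "angle \<alpha> \<beta> = pi"
    using angle_bounds[OF rays] by simp
  then show ?thesis
    using angle_le_tits_metric[of \<alpha> \<beta>] by (simp add: min_def)
qed

end

section \<open>Cones over ultraproducts\<close>

lemma cone_pt_eq: "z \<in> Z \<Longrightarrow> 0 \<le> t \<Longrightarrow> cone_pt Z t z = (if t = 0 then cone_apex Z else {(t, z)})"
  by (auto simp: cone_pt_def cone_rel_def cone_apex_def)

lemma cone_pt_mem: "z \<in> Z \<Longrightarrow> 0 \<le> t \<Longrightarrow> cone_pt Z t z \<in> euclidean_cone Z"
  by (auto simp: euclidean_cone_def cone_pt_def intro!: quotientI)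

lemma cone_pt_self: "z \<in> Z \<Longrightarrow> 0 \<le> t \<Longrightarrow> (t, z) \<in> cone_pt Z t z"
  by (simp add: cone_pt_def cone_rel_def)

lemma euclidean_cone_empty: "euclidean_cone {} = {{}}"
  by (simp add: euclidean_cone_def cone_apex_def)

lemma euclidean_coneE:
  assumes "C \<in> euclidean_cone Z" "Z \<noteq> {}"
  obtains t z where "0 \<le> t" "z \<in> Z" "C = cone_pt Z t z"
proof (cases "C = cone_apex Z")
  case True
  obtain z where "z \<in> Z" using assms by blast
  with True show thesis
    using that[of 0 z] by (simp add: cone_pt_eq)
next
  case False
  with assms(1) obtain t z where "0 \<le> t" "z \<in> Z" "C = cone_pt Z t z"
    by (auto simp: euclidean_cone_def cone_pt_def quotient_def)
  then show thesis by (rule that)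
qed

lemma cone_pre_dist_eq:
  "cone_pre_dist D (t, z) (t', z') = euclidean_side t t' (enn2real (min (ennreal pi) (D z z')))"
  by (simp add: cone_pre_dist_def euclidean_side_def)

lemma cone_dist_empty [simp]: "cone_dist D {} C = 0"
  by (simp add: cone_dist_def)

text \<open>The description in \<open>cone_dist\<close> is well defined: classes have several
  representatives only at radius 0, and there the angle drops out of the formula.\<close>

lemma cone_dist_cone_pt:
  assumes z: "z \<in> Z" "z' \<in> Z" and t: "0 \<le> t" "0 \<le> t'"
    and \<theta>: "0 \<le> \<theta>" "min (ennreal pi) (D z z') = ennreal \<theta>"
  shows "cone_dist D (cone_pt Z t z) (cone_pt Z t' z') = euclidean_side t t' \<theta>"
proof -
  have "(THE r. \<exists>p\<in>cone_pt Z t z. \<exists>q\<in>cone_pt Z t' z'. r = cone_pre_dist D p q) = euclidean_side t t' \<theta>"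
  proof (rule the_equality)
    have "euclidean_side t t' \<theta> = cone_pre_dist D (t, z) (t', z')"
      using \<theta> by (simp add: cone_pre_dist_eq)
    then show "\<exists>p\<in>cone_pt Z t z. \<exists>q\<in>cone_pt Z t' z'. euclidean_side t t' \<theta> = cone_pre_dist D p q"
      using cone_pt_self[OF z(1) t(1)] cone_pt_self[OF z(2) t(2)] by blast
  next
    fix r assume "\<exists>p\<in>cone_pt Z t z. \<exists>q\<in>cone_pt Z t' z'. r = cone_pre_dist D p q"
    then obtain w w' where "(t, w) \<in> cone_pt Z t z" "(t', w') \<in> cone_pt Z t' z'"
      "r = cone_pre_dist D (t, w) (t', w')"
      using z t by (auto simp: cone_pt_eq cone_apex_def split: if_splits)
    then show "r = euclidean_side t t' \<theta>"
      using z t \<theta> by (auto simp: cone_pt_eq cone_pre_dist_eq split: if_splits)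
  qed
  moreover have "cone_pt Z t z \<noteq> {}" "cone_pt Z t' z' \<noteq> {}"
    using cone_pt_self[OF z(1) t(1)] cone_pt_self[OF z(2) t(2)] by auto
  ultimately show ?thesis
    by (simp add: cone_dist_def)
qed

section \<open>The cone over the ultraproduct of the boundary and the ultraproduct of the Tits
  cone\<close>

context proper_CAT0_basepoint
begin

sublocale boundary: pseudometric_ultraproduct \<omega> "\<lambda>_. rays" "\<lambda>_. angle" "\<lambda>_. SOME \<alpha>. \<alpha> \<in> rays"
  by unfold_locales
    (auto intro: ultrafilter someI[of "\<lambda>\<alpha>. \<alpha> \<in> rays"] angle_bounds angle_self
      angle_metric_commute angle_triangle)

lemma boundary_seqs_iff: "\<alpha> \<in> boundary.seqs \<longleftrightarrow> (\<forall>n. \<alpha> n \<in> rays)"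
proof
  assume \<alpha>: "\<forall>n. \<alpha> n \<in> rays"
  then have "(SOME \<alpha>. \<alpha> \<in> rays) \<in> rays"
    by (intro someI[of "\<lambda>\<alpha>. \<alpha> \<in> rays" "\<alpha> 0"]) simp
  with \<alpha> show "\<alpha> \<in> boundary.seqs"
    by (auto simp: ultra_seqs_def intro!: exI[of _ pi] angle_bounds)
qed (simp add: ultra_seqs_def)

lemma omega_bdry_empty_iff: "omega_bdry \<omega> x0 = {} \<longleftrightarrow> rays = {}"
proof -
  have "rays = {}" if "boundary.seqs = {}"
  proof (rule ccontr)
    assume "rays \<noteq> {}"
    then obtain \<alpha> where "\<alpha> \<in> rays" by blast
    then have "(\<lambda>_. \<alpha>) \<in> boundary.seqs" by (simp add: boundary_seqs_iff)
    with that show False by simp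
  qed
  moreover have "boundary.seqs = {}" if "rays = {}"
    using that boundary.seqs_mem by (metis empty_iff equals0I)
  ultimately show ?thesis
    unfolding omega_bdry_def ultraproduct_def by (metis quotient_is_empty)
qed

abbreviation cone_class :: "real \<Rightarrow> (nat \<Rightarrow> real \<Rightarrow> 'a) \<Rightarrow> (real \<times> (nat \<Rightarrow> real \<Rightarrow> 'a) set) set" where
  "cone_class t \<alpha> \<equiv> cone_pt (omega_bdry \<omega> x0) t (omega_bdry_class \<omega> x0 \<alpha>)"

abbreviation omega_angle :: "(nat \<Rightarrow> real \<Rightarrow> 'a) \<Rightarrow> (nat \<Rightarrow> real \<Rightarrow> 'a) \<Rightarrow> real" where
  "omega_angle \<alpha> \<beta> \<equiv> omega_bdry_dist \<omega> x0 (omega_bdry_class \<omega> x0 \<alpha>) (omega_bdry_class \<omega> x0 \<beta>)"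

lemma omega_bdry_class_mem: "(\<forall>n. \<alpha> n \<in> rays) \<Longrightarrow> omega_bdry_class \<omega> x0 \<alpha> \<in> omega_bdry \<omega> x0"
  by (simp add: omega_bdry_class_def omega_bdry_def boundary_seqs_iff boundary.cls_mem_carrier)

lemma omega_bdryE:
  assumes "A \<in> omega_bdry \<omega> x0"
  obtains \<alpha> where "\<forall>n. \<alpha> n \<in> rays" "A = omega_bdry_class \<omega> x0 \<alpha>"
  using assms unfolding omega_bdry_class_def omega_bdry_def
  by (elim boundary.carrierE) (simp add: boundary_seqs_iff)

text \<open>Separates the degenerate cone over the empty boundary, whose only point is the empty
  class, from points that have a radius and a sequence of rays.\<close>

lemma cone_omega_bdry_cases:
  assumes "C \<in> cone_omega_bdry \<omega> x0"
  obtains (empty) "rays = {}" "C = {}"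
    | (point) t \<alpha> where "0 \<le> t" "\<forall>n. \<alpha> n \<in> rays" "C = cone_class t \<alpha>"
proof (cases "rays = {}")
  case True
  then show thesis
    using assms empty omega_bdry_empty_iff by (simp add: euclidean_cone_empty)
next
  case False
  then obtain t A where "0 \<le> t" "A \<in> omega_bdry \<omega> x0" "C = cone_pt (omega_bdry \<omega> x0) t A"
    using euclidean_coneE[OF assms] omega_bdry_empty_iff by blast
  then show thesis
    by (elim omega_bdryE) (use point in blast)
qed

lemma cone_class_mem: "0 \<le> t \<Longrightarrow> (\<forall>n. \<alpha> n \<in> rays) \<Longrightarrow> cone_class t \<alpha> \<in> cone_omega_bdry \<omega> x0"
  by (simp add: cone_pt_mem omega_bdry_class_mem)

lemma tendsto_omega_angle:
  "(\<forall>n. \<alpha> n \<in> rays) \<Longrightarrow> (\<forall>n. \<beta> n \<in> rays) \<Longrightarrow> ((\<lambda>n. angle (\<alpha> n) (\<beta> n)) \<longlongrightarrow> omega_angle \<alpha> \<beta>) \<omega>"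
  unfolding omega_bdry_class_def omega_bdry_dist_def
  by (simp add: boundary_seqs_iff boundary.tendsto_udist)

lemma omega_angle_bounds:
  assumes "\<forall>n. \<alpha> n \<in> rays" "\<forall>n. \<beta> n \<in> rays"
  shows "0 \<le> omega_angle \<alpha> \<beta>" "omega_angle \<alpha> \<beta> \<le> pi"
  using tendsto_lowerbound[OF tendsto_omega_angle[OF assms] always_eventually not_bot, of 0]
    tendsto_upperbound[OF tendsto_omega_angle[OF assms] always_eventually not_bot, of pi]
  by (simp_all add: angle_bounds assms)

lemma cone_omega_bdry_dist_class:
  assumes "0 \<le> t" "0 \<le> t'" "\<forall>n. \<alpha> n \<in> rays" "\<forall>n. \<beta> n \<in> rays"
  shows "cone_omega_bdry_dist \<omega> x0 (cone_class t \<alpha>) (cone_class t' \<beta>) = euclidean_side t t' (omega_angle \<alpha> \<beta>)"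
  using omega_angle_bounds[OF assms(3,4)]
  by (intro cone_dist_cone_pt omega_bdry_class_mem assms) (auto simp: min_def ennreal_le_iff2)

lemma cone_class_eqI:
  assumes "0 \<le> t" "0 \<le> t'" "\<forall>n. \<alpha> n \<in> rays" "\<forall>n. \<beta> n \<in> rays"
    and "cone_omega_bdry_dist \<omega> x0 (cone_class t \<alpha>) (cone_class t' \<beta>) = 0"
  shows "cone_class t \<alpha> = cone_class t' \<beta>"
proof -
  have t: "t = t'" "t = 0 \<or> omega_angle \<alpha> \<beta> = 0"
    using assms(5) unfolding cone_omega_bdry_dist_class[OF assms(1-4)]
    by (auto simp: euclidean_side_eq_0_iff assms omega_angle_bounds)
  moreover have "omega_bdry_class \<omega> x0 \<alpha> = omega_bdry_class \<omega> x0 \<beta>" if "omega_angle \<alpha> \<beta> = 0"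
    using that assms(3,4) unfolding omega_bdry_class_def omega_bdry_dist_def
    by (simp add: boundary.udist_eq_0_iff boundary.cls_mem_carrier boundary_seqs_iff)
  ultimately show ?thesis
    using assms by (auto simp: cone_pt_eq omega_bdry_class_mem)
qed

text \<open>Evaluates the lifts by unions in \<open>Psi_map\<close> and
  \<open>cone_ultra_map\<close>. Representatives of one cone point differ by a sequence of rays at
  vanishing angle, or arbitrarily if the radius is 0, because the whole base is glued there;
  \<open>F\<close> has to be constant under both changes.\<close>

lemma cone_class_lift:
  assumes \<alpha>: "\<forall>n. \<alpha> n \<in> rays" and t: "0 \<le> t"
    and F: "\<And>\<beta>. (\<forall>n. \<beta> n \<in> rays) \<Longrightarrow> t = 0 \<or> ((\<lambda>n. angle (\<alpha> n) (\<beta> n)) \<longlongrightarrow> 0) \<omega> \<Longrightarrow> F t \<beta> = F t \<alpha>"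
  shows "cone_class t \<alpha> \<noteq> {}" "(\<Union>(s, A)\<in>cone_class t \<alpha>. \<Union>\<beta>\<in>A. F s \<beta>) = F t \<alpha>"
proof -
  have self: "(t, omega_bdry_class \<omega> x0 \<alpha>) \<in> cone_class t \<alpha>"
    by (intro cone_pt_self omega_bdry_class_mem \<alpha> t)
  then show "cone_class t \<alpha> \<noteq> {}" by blast
  have \<alpha>_self: "\<alpha> \<in> omega_bdry_class \<omega> x0 \<alpha>"
    unfolding omega_bdry_class_def using \<alpha> by (simp add: boundary.mem_cls_self boundary_seqs_iff)
  have eq: "s = t \<and> F s \<beta> = F t \<alpha>" if "(s, A) \<in> cone_class t \<alpha>" "\<beta> \<in> A" for s A \<beta>
  proof -
    from that(1) have A: "A \<in> omega_bdry \<omega> x0" "s = t" "t = 0 \<or> A = omega_bdry_class \<omega> x0 \<alpha>"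
      using \<alpha> t omega_bdry_class_mem by (auto simp: cone_pt_eq cone_apex_def split: if_splits)
    have "\<forall>n. \<beta> n \<in> rays"
      using boundary.carrier_mem_eq A(1) that(2) by (auto simp: omega_bdry_def boundary_seqs_iff)
    moreover have "t = 0 \<or> ((\<lambda>n. angle (\<alpha> n) (\<beta> n)) \<longlongrightarrow> 0) \<omega>"
      using A(3) that(2) by (auto simp: omega_bdry_class_def boundary.mem_cls_iff)
    ultimately show ?thesis
      using F A(2) by blast
  qed
  show "(\<Union>(s, A)\<in>cone_class t \<alpha>. \<Union>\<beta>\<in>A. F s \<beta>) = F t \<alpha>"
  proof (intro equalityI subsetI)
    fix x assume "x \<in> (\<Union>(s, A)\<in>cone_class t \<alpha>. \<Union>\<beta>\<in>A. F s \<beta>)"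
    then show "x \<in> F t \<alpha>" using eq by auto
  next
    fix x assume "x \<in> F t \<alpha>"
    then show "x \<in> (\<Union>(s, A)\<in>cone_class t \<alpha>. \<Union>\<beta>\<in>A. F s \<beta>)"
      using self \<alpha>_self by blast
  qed
qed

lemma tits_cone_dist_eq:
  assumes "\<alpha> \<in> rays" "\<beta> \<in> rays" "0 \<le> t" "0 \<le> t'"
  shows "cone_dist (tits_metric x0) (cone_pt rays t \<alpha>) (cone_pt rays t' \<beta>) = euclidean_side t t' (angle \<alpha> \<beta>)"
  by (intro cone_dist_cone_pt assms angle_bounds min_pi_tits_metric)

text \<open>If there are rays, \<open>tits_cone_dist_eq\<close> expresses cone distances by the
  angle metric; the triangle inequality is then the one obtained from distances along rays.\<close>

sublocale tits_cone: pseudometric_ultraproduct \<omega> "\<lambda>_. euclidean_cone rays"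
  "\<lambda>_. cone_dist (tits_metric x0)" "\<lambda>_. cone_apex rays"
proof (cases "rays = {}")
  case True
  then show "pseudometric_ultraproduct \<omega> (\<lambda>_. euclidean_cone rays)
      (\<lambda>_. cone_dist (tits_metric x0)) (\<lambda>_. cone_apex rays)"
    by unfold_locales (auto simp: ultrafilter euclidean_cone_empty cone_apex_def)
next
  case False
  note E = euclidean_coneE[OF _ False]
  show "pseudometric_ultraproduct \<omega> (\<lambda>_. euclidean_cone rays)
      (\<lambda>_. cone_dist (tits_metric x0)) (\<lambda>_. cone_apex rays)"
  proof
    show "nonprincipal_ultrafilter \<omega>" by (rule ultrafilter)
    show "cone_apex rays \<in> euclidean_cone rays"
      by (simp add: euclidean_cone_def)
  next
    fix C C' assume "C \<in> euclidean_cone rays" "C' \<in> euclidean_cone rays"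
    then show "0 \<le> cone_dist (tits_metric x0) C C'"
      "cone_dist (tits_metric x0) C C' = cone_dist (tits_metric x0) C' C"
      by (auto elim!: E simp: tits_cone_dist_eq euclidean_side_nonneg euclidean_side_commute angle_metric_commute)
  next
    fix C assume "C \<in> euclidean_cone rays"
    then show "cone_dist (tits_metric x0) C C = 0"
      by (auto elim!: E simp: tits_cone_dist_eq angle_self euclidean_side_zero)
  next
    fix C C' C'' assume "C \<in> euclidean_cone rays" "C' \<in> euclidean_cone rays" "C'' \<in> euclidean_cone rays"
    then show "cone_dist (tits_metric x0) C C''
        \<le> cone_dist (tits_metric x0) C C' + cone_dist (tits_metric x0) C' C''"
      by (auto elim!: E simp: tits_cone_dist_eq intro!: euclidean_side_angle_triangle)
  qed
qed

lemma tits_cone_seqs: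
  assumes "\<forall>n. \<alpha> n \<in> rays" "\<And>n. 0 \<le> t n" "\<And>n. t n \<le> B"
  shows "(\<lambda>n. cone_pt rays (t n) (\<alpha> n)) \<in> tits_cone.seqs"
proof -
  have "cone_dist (tits_metric x0) (cone_pt rays (t n) (\<alpha> n)) (cone_apex rays) = t n" for n
  proof -
    have "cone_apex rays = cone_pt rays 0 (\<alpha> n)"
      using assms by (simp add: cone_pt_eq)
    then show ?thesis
      using assms by (simp add: tits_cone_dist_eq)
  qed
  with assms show ?thesis
    by (auto simp: ultra_seqs_def cone_pt_mem)
qed

lemma tits_cone_dist_class:
  assumes "0 \<le> t" "0 \<le> t'" "\<forall>n. \<alpha> n \<in> rays" "\<forall>n. \<beta> n \<in> rays"
  shows "omega_tits_cone_dist \<omega> x0 (omega_tits_cone_class \<omega> x0 (\<lambda>n. cone_pt rays t (\<alpha> n)))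
      (omega_tits_cone_class \<omega> x0 (\<lambda>n. cone_pt rays t' (\<beta> n))) = euclidean_side t t' (omega_angle \<alpha> \<beta>)"
  unfolding omega_tits_cone_dist_def omega_tits_cone_class_def
  using assms
  by (intro tits_cone.udist_eq tits_cone_seqs[where B = t] tits_cone_seqs[where B = t'])
    (auto simp: tits_cone_dist_eq intro!: tendsto_intros tendsto_omega_angle)

lemma cone_ultra_map_class:
  assumes t: "0 \<le> t" and \<alpha>: "\<forall>n. \<alpha> n \<in> rays"
  shows "cone_ultra_map \<omega> x0 (cone_class t \<alpha>) = omega_tits_cone_class \<omega> x0 (\<lambda>n. cone_pt rays t (\<alpha> n))"
proof -
  let ?F = "\<lambda>t \<alpha>. omega_tits_cone_class \<omega> x0 (\<lambda>n. cone_pt rays t (\<alpha> n))"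
  have F: "?F t \<beta> = ?F t \<alpha>"
    if \<beta>: "\<forall>n. \<beta> n \<in> rays" and "t = 0 \<or> ((\<lambda>n. angle (\<alpha> n) (\<beta> n)) \<longlongrightarrow> 0) \<omega>" for \<beta>
    using that(2)
  proof
    assume "t = 0"
    with \<alpha> \<beta> show ?thesis by (simp add: cone_pt_eq)
  next
    assume lim: "((\<lambda>n. angle (\<alpha> n) (\<beta> n)) \<longlongrightarrow> 0) \<omega>"
    have "((\<lambda>n. euclidean_side t t (angle (\<alpha> n) (\<beta> n))) \<longlongrightarrow> euclidean_side t t 0) \<omega>"
      by (intro tendsto_intros lim)
    then have "?F t \<alpha> = ?F t \<beta>"
      unfolding omega_tits_cone_class_def using t \<alpha> \<beta>
      by (subst tits_cone.cls_eq_iff) (auto simp: tits_cone_dist_eq euclidean_side_zero intro!: tits_cone_seqs)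
    then show ?thesis by simp
  qed
  show ?thesis
    unfolding cone_ultra_map_def using cone_class_lift[where F = ?F, OF \<alpha> t F] by simp
qed

text \<open>The radii \<open>r n\<close> of a representative vary but stay bounded, so they have an
  \<open>\<omega>\<close>-limit \<open>t\<close>. Moving each point along its own ray to radius
  \<open>t\<close> costs \<open>\<bar>r n - t\<bar>\<close>, which vanishes in the limit. This is
  what makes \<open>cone_ultra_map\<close> surjective.\<close>

lemma omega_tits_coneE:
  assumes X: "X \<in> omega_tits_cone \<omega> x0" and ne: "rays \<noteq> {}"
  obtains t \<alpha> where "0 \<le> t" "\<forall>n. \<alpha> n \<in> rays"
    "X = omega_tits_cone_class \<omega> x0 (\<lambda>n. cone_pt rays t (\<alpha> n))"
proof -
  obtain x where x: "x \<in> tits_cone.seqs" "X = tits_cone.cls x"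
    using X unfolding omega_tits_cone_def by (rule tits_cone.carrierE)
  have "\<forall>n. \<exists>p. 0 \<le> fst p \<and> snd p \<in> rays \<and> x n = cone_pt rays (fst p) (snd p)"
  proof
    fix n
    obtain t z where "0 \<le> t" "z \<in> rays" "x n = cone_pt rays t z"
      using euclidean_coneE[OF tits_cone.seqs_mem[OF x(1)] ne] .
    then show "\<exists>p. 0 \<le> fst p \<and> snd p \<in> rays \<and> x n = cone_pt rays (fst p) (snd p)"
      by (intro exI[of _ "(t, z)"]) simp
  qed
  then obtain p where "\<forall>n. 0 \<le> fst (p n) \<and> snd (p n) \<in> rays \<and> x n = cone_pt rays (fst (p n)) (snd (p n))"
    by (rule choice[THEN exE])
  moreover define r \<alpha> where "r n = fst (p n)" and "\<alpha> n = snd (p n)" for n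
  ultimately have r: "\<And>n. 0 \<le> r n" and \<alpha>: "\<forall>n. \<alpha> n \<in> rays" and x_eq: "\<And>n. x n = cone_pt rays (r n) (\<alpha> n)"
    by auto
  obtain B where B: "\<And>n. cone_dist (tits_metric x0) (x n) (cone_apex rays) \<le> B"
    using x(1) by (auto simp: ultra_seqs_def)
  have rB: "r n \<le> B" for n
  proof -
    have "cone_apex rays = cone_pt rays 0 (\<alpha> n)"
      using \<alpha> by (simp add: cone_pt_eq)
    then show ?thesis
      using B[of n] \<alpha> r[of n] by (simp add: x_eq tits_cone_dist_eq)
  qed
  obtain t where t: "0 \<le> t" "(r \<longlongrightarrow> t) \<omega>"
    by (rule nonprincipal_ultrafilter_bounded[OF ultrafilter, of 0 r B, OF r rB])
  have "((\<lambda>n. \<bar>r n - t\<bar>) \<longlongrightarrow> \<bar>t - t\<bar>) \<omega>"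
    by (intro tendsto_intros t)
  then have "((\<lambda>n. cone_dist (tits_metric x0) (x n) (cone_pt rays t (\<alpha> n))) \<longlongrightarrow> 0) \<omega>"
    using r \<alpha> t by (simp add: x_eq tits_cone_dist_eq angle_self euclidean_side_zero)
  then have "X = tits_cone.cls (\<lambda>n. cone_pt rays t (\<alpha> n))"
    using x t \<alpha> tits_cone_seqs[of \<alpha> "\<lambda>_. t" t] by (simp add: tits_cone.cls_eq_iff)
  then show thesis
    using that[OF t(1) \<alpha>] by (simp add: omega_tits_cone_class_def)
qed

lemma isometry_onto_cone_ultra_map:
  "isometry_onto (cone_omega_bdry \<omega> x0) (cone_omega_bdry_dist \<omega> x0)
     (omega_tits_cone \<omega> x0) (omega_tits_cone_dist \<omega> x0) (cone_ultra_map \<omega> x0)"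
proof (cases "rays = {}")
  case True
  let ?c = "tits_cone.cls (\<lambda>_. {})"
  have seqs: "tits_cone.seqs = {\<lambda>_. {}}"
    using True by (auto simp: ultra_seqs_def euclidean_cone_empty cone_apex_def)
  have "omega_tits_cone \<omega> x0 = {?c}"
    using seqs by (auto simp: omega_tits_cone_def intro!: tits_cone.cls_mem_carrier elim!: tits_cone.carrierE)
  moreover have "cone_ultra_map \<omega> x0 {} = ?c"
    using True by (simp add: cone_ultra_map_def omega_tits_cone_class_def cone_apex_def)
  moreover have "cone_omega_bdry \<omega> x0 = {{}}"
    using True omega_bdry_empty_iff by (simp add: euclidean_cone_empty)
  moreover have "omega_tits_cone_dist \<omega> x0 ?c ?c = 0"
    using seqs by (simp add: omega_tits_cone_dist_def tits_cone.udist_eq)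
  ultimately show ?thesis
    by (simp add: isometry_onto_def bij_betw_def)
next
  case False
  have cases: "\<exists>t \<alpha>. 0 \<le> t \<and> (\<forall>n. \<alpha> n \<in> rays) \<and> C = cone_class t \<alpha>" if "C \<in> cone_omega_bdry \<omega> x0" for C
    using that False by (cases rule: cone_omega_bdry_cases) auto
  have dist: "omega_tits_cone_dist \<omega> x0 (cone_ultra_map \<omega> x0 C) (cone_ultra_map \<omega> x0 C') =
      cone_omega_bdry_dist \<omega> x0 C C'"
    if "C \<in> cone_omega_bdry \<omega> x0" "C' \<in> cone_omega_bdry \<omega> x0" for C C'
    using cases[OF that(1)] cases[OF that(2)]
    by (auto simp: cone_ultra_map_class tits_cone_dist_class cone_omega_bdry_dist_class)
  have map: "cone_ultra_map \<omega> x0 C \<in> omega_tits_cone \<omega> x0" if "C \<in> cone_omega_bdry \<omega> x0" for C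
    using cases[OF that]
    by (auto simp: cone_ultra_map_class omega_tits_cone_class_def omega_tits_cone_def
        intro!: tits_cone.cls_mem_carrier tits_cone_seqs)
  have "inj_on (cone_ultra_map \<omega> x0) (cone_omega_bdry \<omega> x0)"
  proof (rule inj_onI)
    fix C C' assume C: "C \<in> cone_omega_bdry \<omega> x0" "C' \<in> cone_omega_bdry \<omega> x0"
      and eq: "cone_ultra_map \<omega> x0 C = cone_ultra_map \<omega> x0 C'"
    have "omega_tits_cone_dist \<omega> x0 (cone_ultra_map \<omega> x0 C) (cone_ultra_map \<omega> x0 C') = 0"
      using map[OF C(1)] unfolding eq[symmetric] omega_tits_cone_def omega_tits_cone_dist_def
      by (simp add: tits_cone.udist_eq_0_iff)
    then have "cone_omega_bdry_dist \<omega> x0 C C' = 0"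
      using dist[OF C] by simp
    moreover obtain t \<alpha> where "0 \<le> t" "\<forall>n. \<alpha> n \<in> rays" "C = cone_class t \<alpha>"
      using cases[OF C(1)] by blast
    moreover obtain t' \<beta> where "0 \<le> t'" "\<forall>n. \<beta> n \<in> rays" "C' = cone_class t' \<beta>"
      using cases[OF C(2)] by blast
    ultimately show "C = C'"
      using cone_class_eqI by blast
  qed
  moreover have "X \<in> cone_ultra_map \<omega> x0 ` cone_omega_bdry \<omega> x0" if mem: "X \<in> omega_tits_cone \<omega> x0" for X
  proof -
    obtain t \<alpha> where t: "0 \<le> t" and \<alpha>: "\<forall>n. \<alpha> n \<in> rays"
      and X: "X = omega_tits_cone_class \<omega> x0 (\<lambda>n. cone_pt rays t (\<alpha> n))"
      by (rule omega_tits_coneE[OF mem False])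
    show ?thesis
      unfolding X cone_ultra_map_class[OF t \<alpha>, symmetric] by (intro imageI cone_class_mem t \<alpha>)
  qed
  ultimately show ?thesis
    using map dist by (auto simp: isometry_onto_def bij_betw_def)
qed

end

section \<open>Asymptotic cones and their inverse limit\<close>

lemma ultra_dist_commute:
  assumes "\<And>n x y. D n x y = D n y x"
  shows "ultra_dist \<omega> D A B = ultra_dist \<omega> D B A"
proof -
  have "(\<lambda>n. D n (x n) (y n)) = (\<lambda>n. D n (y n) (x n))" for x y
    by (intro ext assms)
  then have "(\<exists>x\<in>A. \<exists>y\<in>B. ((\<lambda>n. D n (x n) (y n)) \<longlongrightarrow> r) \<omega>) \<longleftrightarrow>
      (\<exists>y\<in>B. \<exists>x\<in>A. ((\<lambda>n. D n (y n) (x n)) \<longlongrightarrow> r) \<omega>)" for r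
    by metis
  then show ?thesis
    by (simp add: ultra_dist_def)
qed

context CAT0_basepoint
begin

text \<open>Uniqueness of geodesics in CAT(0) spaces makes the description in \<open>Xi_map\<close>
  well defined; at full length the truncating branch returns the endpoint itself.\<close>

lemma Xi_map_geodesic:
  assumes c: "is_geodesic c x0 x" and t: "0 \<le> t" "t \<le> dist x0 x"
  shows "Xi_map x0 x t = c t"
proof (cases "t = dist x0 x")
  case True
  with c show ?thesis by (simp add: Xi_map_def is_geodesic_def)
next
  case False
  have "(THE y. \<exists>c. is_geodesic c x0 x \<and> y = c t) = c t"
  proof (rule the_equality)
    show "\<exists>c'. is_geodesic c' x0 x \<and> c t = c' t"
      using c by blast
    fix y assume "\<exists>c. is_geodesic c x0 x \<and> y = c t"
    then show "y = c t"
      using CAT0_geodesic_unique[OF CAT0 _ c, of _ t] t by auto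
  qed
  with t False show ?thesis by (simp add: Xi_map_def)
qed

lemma dist_base_Xi_map:
  assumes "0 \<le> t"
  shows "dist x0 (Xi_map x0 x t) = min t (dist x0 x)"
proof (cases "dist x0 x \<le> t")
  case True
  then show ?thesis by (simp add: Xi_map_def)
next
  case False
  obtain c where c: "is_geodesic c x0 x"
    using CAT0_ex_geodesic[OF CAT0] .
  with False assms show ?thesis
    using is_geodesic_dist_start[OF c, of t] by (simp add: Xi_map_geodesic[OF c])
qed

lemma dist_Xi_map_le:
  assumes u: "0 \<le> u" "u \<le> 1"
  shows "dist (Xi_map x0 x (u * dist x x0)) (Xi_map x0 y (u * dist y x0)) \<le> u * dist x y"
proof -
  obtain c where c: "is_geodesic c x0 x"
    using CAT0_ex_geodesic[OF CAT0] .
  obtain c' where c': "is_geodesic c' x0 y"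
    using CAT0_ex_geodesic[OF CAT0] .
  show ?thesis
    using CAT0_contraction[OF CAT0 c c' u] u
    by (simp add: Xi_map_geodesic[OF c] Xi_map_geodesic[OF c'] dist_commute[of _ x0] mult_left_le_one_le)
qed

lemma Xi_map_ray: "\<alpha> \<in> rays \<Longrightarrow> 0 \<le> s \<Longrightarrow> s \<le> t \<Longrightarrow> Xi_map x0 (\<alpha> t) s = \<alpha> s"
  by (intro Xi_map_geodesic ray_is_geodesic) (auto simp: dist_base_ray)

end

section \<open>Asymptotic cones for varying scaling sequences and their connecting maps\<close>

context proper_CAT0_basepoint
begin

abbreviation scalings where "scalings \<equiv> scaling_seqs \<omega>"
abbreviation scaled_seqs where "scaled_seqs d \<equiv> ultra_seqs (\<lambda>_. UNIV) (\<lambda>n x y. dist x y / d n) (\<lambda>_. x0)"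
abbreviation acone where "acone \<equiv> asym_cone \<omega> x0"
abbreviation aclass where "aclass \<equiv> asym_cone_class \<omega> x0"
abbreviation adist :: "(nat \<Rightarrow> real) \<Rightarrow> (nat \<Rightarrow> 'a) set \<Rightarrow> (nat \<Rightarrow> 'a) set \<Rightarrow> real"
  where "adist \<equiv> asym_cone_dist \<omega>"

lemma scaling_pos: "d \<in> scalings \<Longrightarrow> 0 < d n"
  by (simp add: scaling_seqs_def)

lemma asym_cone_ultraproduct:
  assumes "d \<in> scalings"
  shows "pseudometric_ultraproduct \<omega> (\<lambda>_. UNIV) (\<lambda>n x y :: 'a. dist x y / d n) (\<lambda>_. x0)"
proof
  fix n and x y z :: 'a
  show "dist x z / d n \<le> dist x y / d n + dist y z / d n"
    using scaling_pos[OF assms, of n]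
    by (simp add: add_divide_distrib[symmetric] divide_right_mono dist_triangle)
  show "0 \<le> dist x y / d n"
    using scaling_pos[OF assms, of n] by simp
qed (auto simp: ultrafilter dist_commute)

text \<open>Several scaling sequences occur in one statement, so the facts are provided for an
  arbitrary \<open>d\<close> rather than by interpreting the locale for a fixed one.\<close>

lemmas aclass_eq_iff = pseudometric_ultraproduct.cls_eq_iff
    [OF asym_cone_ultraproduct, folded asym_cone_class_def]
  and aclass_eqI = pseudometric_ultraproduct.cls_eqI
    [OF asym_cone_ultraproduct, folded asym_cone_class_def]
  and aclass_mem = pseudometric_ultraproduct.cls_mem_carrier
    [OF asym_cone_ultraproduct, folded asym_cone_class_def asym_cone_def]
  and acone_mem_eq = pseudometric_ultraproduct.carrier_mem_eq
    [OF asym_cone_ultraproduct, folded asym_cone_class_def asym_cone_def]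
  and aconeE = pseudometric_ultraproduct.carrierE
    [OF asym_cone_ultraproduct, folded asym_cone_class_def asym_cone_def]
  and mem_aclass_iff = pseudometric_ultraproduct.mem_cls_iff
    [OF asym_cone_ultraproduct, folded asym_cone_class_def]
  and adist_eq = pseudometric_ultraproduct.udist_eq
    [OF asym_cone_ultraproduct, folded asym_cone_class_def asym_cone_dist_def]
  and tendsto_adist = pseudometric_ultraproduct.tendsto_udist
    [OF asym_cone_ultraproduct, folded asym_cone_class_def asym_cone_dist_def]
  and adist_nonneg = pseudometric_ultraproduct.udist_nonneg
    [OF asym_cone_ultraproduct, folded asym_cone_def asym_cone_dist_def]
  and adist_eq_0_iff = pseudometric_ultraproduct.udist_eq_0_iff
    [OF asym_cone_ultraproduct, folded asym_cone_def asym_cone_dist_def]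
  and adist_triangle = pseudometric_ultraproduct.udist_triangle
    [OF asym_cone_ultraproduct, folded asym_cone_def asym_cone_dist_def]
  and adist_Cauchy_convergent = pseudometric_ultraproduct.udist_Cauchy_convergent
    [OF asym_cone_ultraproduct, folded asym_cone_def asym_cone_dist_def]

lemma adist_commute: "adist d A B = adist d B A"
  unfolding asym_cone_dist_def by (rule ultra_dist_commute) (simp add: dist_commute)

lemma base_scaled_seqs: "(\<lambda>_. x0) \<in> scaled_seqs d"
  by (auto simp: ultra_seqs_def)

lemma ray_scaled_seqs:
  assumes "d \<in> scalings" "0 \<le> t" "\<forall>n. \<alpha> n \<in> rays"
  shows "(\<lambda>n. \<alpha> n (t * d n)) \<in> scaled_seqs d"
proof -
  have "dist (\<alpha> n (t * d n)) x0 / d n = t" for n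
    using scaling_pos[OF assms(1), of n] assms(2,3) by (simp add: dist_commute[of _ x0] dist_base_ray)
  then show ?thesis
    by (auto simp: ultra_seqs_def)
qed

abbreviation shrink :: "(nat \<Rightarrow> real) \<Rightarrow> (nat \<Rightarrow> real) \<Rightarrow> (nat \<Rightarrow> 'a) \<Rightarrow> nat \<Rightarrow> 'a" where
  "shrink d d' x \<equiv> \<lambda>n. Xi_map x0 (x n) (d' n / d n * dist (x n) x0)"

text \<open>The first bound holds at every index, even where \<open>d' n\<close> exceeds
  \<open>d n\<close>, because \<open>Xi_map\<close> never moves a point beyond its original
  position; it shows that shrunk sequences are bounded. The equality is confined to indices with
  \<open>d' n \<le> d n\<close>, which is enough for limits.\<close>

lemma dist_shrink_base:
  assumes d: "d \<in> scalings" "d' \<in> scalings"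
  shows "dist (shrink d d' x n) x0 / d' n \<le> dist (x n) x0 / d n"
    and "d' n \<le> d n \<Longrightarrow> dist (shrink d d' x n) x0 / d' n = dist (x n) x0 / d n"
proof -
  note pos = scaling_pos[OF d(1), of n] scaling_pos[OF d(2), of n]
  have eq: "dist (shrink d d' x n) x0 = min (d' n / d n * dist (x n) x0) (dist (x n) x0)"
    using pos dist_base_Xi_map[of "d' n / d n * dist (x n) x0" "x n"] by (simp add: dist_commute[of _ x0])
  have "dist (shrink d d' x n) x0 \<le> d' n / d n * dist (x n) x0"
    unfolding eq by simp
  then show "dist (shrink d d' x n) x0 / d' n \<le> dist (x n) x0 / d n"
    using pos by (simp add: field_simps)
  assume "d' n \<le> d n"
  then have "d' n / d n * dist (x n) x0 \<le> dist (x n) x0"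
    using pos by (intro mult_left_le_one_le) auto
  then show "dist (shrink d d' x n) x0 / d' n = dist (x n) x0 / d n"
    unfolding eq using pos by simp
qed

lemma shrink_scaled_seqs:
  assumes d: "d \<in> scalings" "d' \<in> scalings" and x: "x \<in> scaled_seqs d"
  shows "shrink d d' x \<in> scaled_seqs d'"
proof -
  obtain B where "\<And>n. dist (x n) x0 / d n \<le> B"
    using x by (auto simp: ultra_seqs_def)
  then have "dist (shrink d d' x n) x0 / d' n \<le> B" for n
    using dist_shrink_base(1)[OF d, of x n] order_trans by blast
  then show ?thesis
    by (auto simp: ultra_seqs_def)
qed

lemma dist_shrink_le:
  assumes d: "d \<in> scalings" "d' \<in> scalings" and le: "d' n \<le> d n"
  shows "dist (shrink d d' x n) (shrink d d' y n) / d' n \<le> dist (x n) (y n) / d n"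
proof -
  note pos = scaling_pos[OF d(1), of n] scaling_pos[OF d(2), of n]
  have "dist (shrink d d' x n) (shrink d d' y n) \<le> d' n / d n * dist (x n) (y n)"
    using pos le by (intro dist_Xi_map_le) auto
  then show ?thesis
    using pos by (simp add: field_simps)
qed

lemma adist_shrink_le:
  assumes d: "d \<in> scalings" "d' \<in> scalings" and le: "scaling_le \<omega> d' d"
    and xy: "x \<in> scaled_seqs d" "y \<in> scaled_seqs d"
  shows "adist d' (aclass d' (shrink d d' x)) (aclass d' (shrink d d' y)) \<le> adist d (aclass d x) (aclass d y)"
proof (rule tendsto_le[OF not_bot tendsto_adist tendsto_adist])
  show "eventually (\<lambda>n. dist (shrink d d' x n) (shrink d d' y n) / d' n \<le> dist (x n) (y n) / d n) \<omega>"
    using le unfolding scaling_le_def by eventually_elim (rule dist_shrink_le[OF d])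
qed (intro d xy shrink_scaled_seqs)+

text \<open>Non-expansiveness sends representatives at limit distance 0 to representatives at limit
  distance 0, so all classes in the union coincide.\<close>

lemma Theta_map_class:
  assumes d: "d \<in> scalings" "d' \<in> scalings" and le: "scaling_le \<omega> d' d" and x: "x \<in> scaled_seqs d"
  shows "Theta_map \<omega> x0 d d' (aclass d x) = aclass d' (shrink d d' x)"
proof -
  have "aclass d' (shrink d d' y) = aclass d' (shrink d d' x)" if "y \<in> aclass d x" for y
  proof -
    have y: "y \<in> scaled_seqs d" "aclass d y = aclass d x"
      using acone_mem_eq[OF d(1) aclass_mem[OF d(1) x] that] by auto
    note mem = aclass_mem[OF d(2) shrink_scaled_seqs[OF d y(1)]] aclass_mem[OF d(2) shrink_scaled_seqs[OF d x]]
    have "adist d (aclass d y) (aclass d x) = 0"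
      using y x d by (simp add: adist_eq_0_iff aclass_mem)
    then have "adist d' (aclass d' (shrink d d' y)) (aclass d' (shrink d d' x)) = 0"
      using adist_shrink_le[OF d le y(1) x] adist_nonneg[OF d(2) mem] by simp
    then show ?thesis
      using adist_eq_0_iff[OF d(2) mem] by simp
  qed
  moreover have "x \<in> aclass d x"
    using x d by (simp add: mem_aclass_iff)
  ultimately show ?thesis
    unfolding Theta_map_def by blast
qed

lemma Theta_map_mem:
  assumes d: "d \<in> scalings" "d' \<in> scalings" and le: "scaling_le \<omega> d' d" and A: "A \<in> acone d"
  shows "Theta_map \<omega> x0 d d' A \<in> acone d'"
proof -
  obtain x where "x \<in> scaled_seqs d" "A = aclass d x"
    using aconeE[OF d(1) A] .
  then show ?thesis
    using Theta_map_class[OF d le] aclass_mem[OF d(2) shrink_scaled_seqs[OF d]] by simp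
qed

lemma Theta_map_nonexpansive:
  assumes d: "d \<in> scalings" "d' \<in> scalings" and le: "scaling_le \<omega> d' d"
    and A: "A \<in> acone d" and B: "B \<in> acone d"
  shows "adist d' (Theta_map \<omega> x0 d d' A) (Theta_map \<omega> x0 d d' B) \<le> adist d A B"
proof -
  obtain x where x: "x \<in> scaled_seqs d" "A = aclass d x"
    using aconeE[OF d(1) A] .
  obtain y where y: "y \<in> scaled_seqs d" "B = aclass d y"
    using aconeE[OF d(1) B] .
  show ?thesis
    using adist_shrink_le[OF d le x(1) y(1)] Theta_map_class[OF d le] x y by simp
qed

lemma adist_Theta_map_base:
  assumes d: "d \<in> scalings" "d' \<in> scalings" and le: "scaling_le \<omega> d' d" and A: "A \<in> acone d"
  shows "adist d' (Theta_map \<omega> x0 d d' A) (aclass d' (\<lambda>_. x0)) = adist d A (aclass d (\<lambda>_. x0))"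
proof -
  obtain x where x: "x \<in> scaled_seqs d" "A = aclass d x"
    using aconeE[OF d(1) A] .
  have "eventually (\<lambda>n. dist (x n) x0 / d n = dist (shrink d d' x n) x0 / d' n) \<omega>"
    using le unfolding scaling_le_def by eventually_elim (rule dist_shrink_base(2)[OF d, symmetric])
  with tendsto_adist[OF d(1) x(1) base_scaled_seqs]
  have "((\<lambda>n. dist (shrink d d' x n) x0 / d' n) \<longlongrightarrow> adist d A (aclass d (\<lambda>_. x0))) \<omega>"
    unfolding x(2) by (rule Lim_transform_eventually)
  then show ?thesis
    unfolding x(2) Theta_map_class[OF d le x(1)]
    by (rule adist_eq[OF d(2) shrink_scaled_seqs[OF d x(1)] base_scaled_seqs])
qed

section \<open>The inverse limit as a complete metric space\<close>

abbreviation climit where "climit \<equiv> cone_limit \<omega> x0"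
abbreviation cdist :: "((nat \<Rightarrow> real) \<Rightarrow> (nat \<Rightarrow> 'a) set) \<Rightarrow> ((nat \<Rightarrow> real) \<Rightarrow> (nat \<Rightarrow> 'a) set) \<Rightarrow> real"
  where "cdist \<equiv> cone_limit_dist \<omega>"

lemma climit_iff:
  "\<xi> \<in> climit \<longleftrightarrow> \<xi> \<in> (\<Pi>\<^sub>E d\<in>scalings. acone d) \<and>
    (\<forall>d\<in>scalings. \<forall>d'\<in>scalings. scaling_le \<omega> d' d \<longrightarrow> \<xi> d' = Theta_map \<omega> x0 d d' (\<xi> d))"
  by (simp add: cone_limit_def inverse_limit_def)

lemma climit_mem: "\<xi> \<in> climit \<Longrightarrow> d \<in> scalings \<Longrightarrow> \<xi> d \<in> acone d"
  by (auto simp: climit_iff)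

lemma climit_Theta:
  "\<xi> \<in> climit \<Longrightarrow> d \<in> scalings \<Longrightarrow> d' \<in> scalings \<Longrightarrow> scaling_le \<omega> d' d \<Longrightarrow> Theta_map \<omega> x0 d d' (\<xi> d) = \<xi> d'"
  by (simp add: climit_iff)

lemma scaling_le_total: "scaling_le \<omega> d d' \<or> scaling_le \<omega> d' d"
proof (rule disjCI)
  assume "\<not> scaling_le \<omega> d' d"
  then have "eventually (\<lambda>n. \<not> d' n \<le> d n) \<omega>"
    using nonprincipal_ultrafilter_dichotomy[OF ultrafilter] unfolding scaling_le_def by blast
  then show "scaling_le \<omega> d d'"
    unfolding scaling_le_def by eventually_elim simp
qed

text \<open>Provides one reference scale at which distances to the base point can be measured, and a
  minorant for constructing fast-growing scales. The successor keeps it positive at index 0.\<close>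

lemma real_Suc_scaling: "(\<lambda>n. real (Suc n)) \<in> scalings"
  unfolding scaling_seqs_def
  using nonprincipal_ultrafilter_tendsto[OF ultrafilter
      filterlim_compose[OF filterlim_real_sequentially filterlim_Suc]] by simp

text \<open>The connecting maps preserve the distance to the base point, which bounds the supremum.\<close>

lemma climit_base_dist:
  assumes "\<xi> \<in> climit" "d \<in> scalings" "d' \<in> scalings"
  shows "adist d (\<xi> d) (aclass d (\<lambda>_. x0)) = adist d' (\<xi> d') (aclass d' (\<lambda>_. x0))"
  using scaling_le_total[of d d']
    adist_Theta_map_base[OF assms(2,3) _ climit_mem[OF assms(1,2)]] climit_Theta[OF assms(1,2,3)]
    adist_Theta_map_base[OF assms(3,2) _ climit_mem[OF assms(1,3)]] climit_Theta[OF assms(1,3,2)]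
  by auto

lemma cone_limit_edist_finite:
  assumes "\<xi> \<in> climit" "\<eta> \<in> climit"
  shows "cone_limit_edist \<omega> \<xi> \<eta> < \<infinity>"
proof -
  let ?o = "\<lambda>d. aclass d (\<lambda>_. x0)"
  define d0 where "d0 n = real (Suc n)" for n
  have d0: "d0 \<in> scalings"
    unfolding d0_def by (rule real_Suc_scaling)
  define B where "B = adist d0 (\<xi> d0) (?o d0) + adist d0 (\<eta> d0) (?o d0)"
  have "adist d (\<xi> d) (\<eta> d) \<le> B" if d: "d \<in> scalings" for d
    using adist_triangle[OF d climit_mem[OF assms(1) d] aclass_mem[OF d base_scaled_seqs] climit_mem[OF assms(2) d]]
      climit_base_dist[OF assms(1) d d0] climit_base_dist[OF assms(2) d d0] adist_commute[of d "?o d" "\<eta> d"]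
    by (simp add: B_def)
  then have "cone_limit_edist \<omega> \<xi> \<eta> \<le> ennreal B"
    unfolding cone_limit_edist_def inverse_limit_edist_def by (intro SUP_least ennreal_leI)
  then show ?thesis
    by (simp add: le_less_trans)
qed

lemma cdist_nonneg: "0 \<le> cdist \<xi> \<eta>"
  by (simp add: cone_limit_dist_def)

lemma cdist_commute: "cdist \<xi> \<eta> = cdist \<eta> \<xi>"
  by (simp add: cone_limit_dist_def cone_limit_edist_def inverse_limit_edist_def adist_commute)

text \<open>Finiteness of the supremum is essential here: \<open>enn2real\<close> sends an infinite
  value to 0.\<close>

lemma adist_le_cdist:
  assumes "\<xi> \<in> climit" "\<eta> \<in> climit" "d \<in> scalings"
  shows "adist d (\<xi> d) (\<eta> d) \<le> cdist \<xi> \<eta>"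
proof -
  have "ennreal (adist d (\<xi> d) (\<eta> d)) \<le> cone_limit_edist \<omega> \<xi> \<eta>"
    unfolding cone_limit_edist_def inverse_limit_edist_def using assms(3) by (rule SUP_upper)
  also have "\<dots> = ennreal (cdist \<xi> \<eta>)"
    using cone_limit_edist_finite[OF assms(1,2)] by (simp add: cone_limit_dist_def)
  finally show ?thesis
    by (simp add: ennreal_le_iff cdist_nonneg)
qed

lemma cdist_leI:
  assumes "\<And>d. d \<in> scalings \<Longrightarrow> adist d (\<xi> d) (\<eta> d) \<le> r" "0 \<le> r"
  shows "cdist \<xi> \<eta> \<le> r"
  unfolding cone_limit_dist_def cone_limit_edist_def inverse_limit_edist_def
  using assms by (intro enn2real_leI SUP_least ennreal_leI)

lemma Metric_space_climit: "Metric_space climit cdist"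
proof
  fix \<xi> \<eta> \<zeta>
  show "0 \<le> cdist \<xi> \<eta>" by (rule cdist_nonneg)
  show "cdist \<xi> \<eta> = cdist \<eta> \<xi>" by (rule cdist_commute)
  assume \<xi>: "\<xi> \<in> climit" and \<eta>: "\<eta> \<in> climit"
  show "cdist \<xi> \<eta> = 0 \<longleftrightarrow> \<xi> = \<eta>"
  proof
    assume 0: "cdist \<xi> \<eta> = 0"
    show "\<xi> = \<eta>"
    proof (rule PiE_ext)
      show "\<xi> \<in> (\<Pi>\<^sub>E d\<in>scalings. acone d)" "\<eta> \<in> (\<Pi>\<^sub>E d\<in>scalings. acone d)"
        using \<xi> \<eta> by (auto simp: climit_iff)
      fix d assume d: "d \<in> scalings"
      then have "adist d (\<xi> d) (\<eta> d) = 0"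
        using adist_le_cdist[OF \<xi> \<eta> d] adist_nonneg[OF d climit_mem[OF \<xi> d] climit_mem[OF \<eta> d]] 0 by simp
      then show "\<xi> d = \<eta> d"
        using adist_eq_0_iff[OF d climit_mem[OF \<xi> d] climit_mem[OF \<eta> d]] by simp
    qed
  next
    assume "\<xi> = \<eta>"
    then have "cdist \<xi> \<eta> \<le> 0"
      using adist_eq_0_iff[OF _ climit_mem[OF \<xi>] climit_mem[OF \<xi>]] by (intro cdist_leI) simp_all
    then show "cdist \<xi> \<eta> = 0"
      using cdist_nonneg[of \<xi> \<eta>] by simp
  qed
  assume \<zeta>: "\<zeta> \<in> climit"
  show "cdist \<xi> \<zeta> \<le> cdist \<xi> \<eta> + cdist \<eta> \<zeta>"
  proof (rule cdist_leI)
    fix d assume d: "d \<in> scalings"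
    show "adist d (\<xi> d) (\<zeta> d) \<le> cdist \<xi> \<eta> + cdist \<eta> \<zeta>"
      using adist_triangle[OF d climit_mem[OF \<xi> d] climit_mem[OF \<eta> d] climit_mem[OF \<zeta> d]]
        adist_le_cdist[OF \<xi> \<eta> d] adist_le_cdist[OF \<eta> \<zeta> d] by linarith
  qed (simp add: cdist_nonneg)
qed

lemma mcomplete_climit: "Metric_space.mcomplete climit cdist"
proof -
  interpret C: Metric_space climit cdist
    by (rule Metric_space_climit)
  show ?thesis
    unfolding C.mcomplete_def
  proof (intro allI impI)
    fix \<sigma> assume "C.MCauchy \<sigma>"
    then have \<sigma>: "\<And>k. \<sigma> k \<in> climit"
      and Cauchy: "\<And>\<epsilon>. \<epsilon> > 0 \<Longrightarrow> \<exists>N. \<forall>i\<ge>N. \<forall>j\<ge>N. cdist (\<sigma> i) (\<sigma> j) < \<epsilon>"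
      by (auto simp: C.MCauchy_def)
    have "\<exists>L. L \<in> acone d \<and> (\<lambda>k. adist d (\<sigma> k d) L) \<longlonglongrightarrow> 0" if d: "d \<in> scalings" for d
    proof -
      have "\<exists>N. \<forall>i\<ge>N. \<forall>j\<ge>N. adist d (\<sigma> i d) (\<sigma> j d) < \<epsilon>" if "\<epsilon> > 0" for \<epsilon>
        using Cauchy[OF that] adist_le_cdist[OF \<sigma> \<sigma> d] by (meson le_less_trans)
      with climit_mem[OF \<sigma> d] show ?thesis
        by (rule adist_Cauchy_convergent[OF d, of "\<lambda>k. \<sigma> k d"]) blast+
    qed
    then have "\<forall>d\<in>scalings. \<exists>L. L \<in> acone d \<and> (\<lambda>k. adist d (\<sigma> k d) L) \<longlonglongrightarrow> 0"
      by blast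
    then obtain L where L0: "\<forall>d\<in>scalings. L d \<in> acone d \<and> (\<lambda>k. adist d (\<sigma> k d) (L d)) \<longlonglongrightarrow> 0"
      by (rule bchoice[THEN exE])
    then have L: "\<And>d. d \<in> scalings \<Longrightarrow> L d \<in> acone d"
      and lim: "\<And>d. d \<in> scalings \<Longrightarrow> (\<lambda>k. adist d (\<sigma> k d) (L d)) \<longlonglongrightarrow> 0"
      by auto
    \<comment> \<open>Both sides are limits of \<open>\<sigma> k d'\<close>: the left by the choice
      of \<open>L\<close>, the right because \<open>Theta_map\<close> is non-expansive and sends
      \<open>\<sigma> k d\<close> to \<open>\<sigma> k d'\<close>.\<close>
    have Theta_L: "L d' = Theta_map \<omega> x0 d d' (L d)"
      if d: "d \<in> scalings" "d' \<in> scalings" and le: "scaling_le \<omega> d' d" for d d'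
    proof -
      note T = Theta_map_mem[OF d le L[OF d(1)]]
      have "adist d' (L d') (Theta_map \<omega> x0 d d' (L d)) \<le> adist d' (\<sigma> k d') (L d') + adist d (\<sigma> k d) (L d)" for k
        using adist_triangle[OF d(2) L[OF d(2)] climit_mem[OF \<sigma> d(2)] T, of k]
          Theta_map_nonexpansive[OF d le climit_mem[OF \<sigma> d(1)] L[OF d(1)], of k]
          climit_Theta[OF \<sigma> d le, of k] adist_commute[of d' "L d'" "\<sigma> k d'"] by simp
      moreover have "(\<lambda>k. adist d' (\<sigma> k d') (L d') + adist d (\<sigma> k d) (L d)) \<longlonglongrightarrow> 0 + 0"
        by (intro tendsto_add lim d)
      ultimately have "adist d' (L d') (Theta_map \<omega> x0 d d' (L d)) \<le> 0 + 0"
        by (intro tendsto_lowerbound[OF _ always_eventually]) auto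
      then show ?thesis
        using adist_nonneg[OF d(2) L[OF d(2)] T] adist_eq_0_iff[OF d(2) L[OF d(2)] T] by simp
    qed
    define \<eta> where "\<eta> = restrict L scalings"
    have \<eta>: "\<eta> \<in> climit"
      using L Theta_L by (simp add: climit_iff \<eta>_def)
    have "\<exists>N. \<forall>k\<ge>N. \<sigma> k \<in> climit \<and> cdist (\<sigma> k) \<eta> < \<epsilon>" if pos: "\<epsilon> > 0" for \<epsilon>
    proof -
      obtain N where N: "\<And>i j. i \<ge> N \<Longrightarrow> j \<ge> N \<Longrightarrow> cdist (\<sigma> i) (\<sigma> j) < \<epsilon> / 2"
        using Cauchy[OF half_gt_zero[OF pos]] by blast
      have "cdist (\<sigma> k) \<eta> \<le> \<epsilon> / 2" if k: "k \<ge> N" for k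
      proof (rule cdist_leI)
        fix d assume d: "d \<in> scalings"
        \<comment> \<open>The threshold \<open>N\<close> does not depend on \<open>d\<close>.
          Letting \<open>j\<close> grow in each component separately therefore gives a bound uniform
          over all scales.\<close>
        have "eventually (\<lambda>j. adist d (\<sigma> k d) (L d) \<le> \<epsilon> / 2 + adist d (\<sigma> j d) (L d)) sequentially"
          using eventually_ge_at_top[of N]
        proof eventually_elim
          case (elim j)
          then show ?case
            using adist_triangle[OF d climit_mem[OF \<sigma> d] climit_mem[OF \<sigma> d] L[OF d], of k j]
              adist_le_cdist[OF \<sigma> \<sigma> d, of k j] N[OF k elim] by linarith
        qed
        moreover have "(\<lambda>j. \<epsilon> / 2 + adist d (\<sigma> j d) (L d)) \<longlonglongrightarrow> \<epsilon> / 2 + 0"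
          by (intro tendsto_add tendsto_const lim d)
        ultimately have "adist d (\<sigma> k d) (L d) \<le> \<epsilon> / 2 + 0"
          by (intro tendsto_lowerbound) auto
        then show "adist d (\<sigma> k d) (\<eta> d) \<le> \<epsilon> / 2"
          using d by (simp add: \<eta>_def)
      qed (use pos in simp)
      then have "cdist (\<sigma> k) \<eta> < \<epsilon>" if "k \<ge> N" for k
        using that pos by (smt (verit) field_sum_of_halves)
      then show ?thesis
        using \<sigma> by blast
    qed
    then have "limitin C.mtopology \<sigma> \<eta> sequentially"
      using \<eta> by (simp add: C.limit_metric_sequentially)
    then show "\<exists>x. limitin C.mtopology \<sigma> x sequentially"
      by blast
  qed
qed

section \<open>The canonical embedding\<close>

text \<open>\<open>dist_rays_le\<close> bounds the scaled distance by the cone distance at every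
  scale. Rays at vanishing angle hence give the same class, which is the compatibility that
  \<open>cone_class_lift\<close> asks for.\<close>

lemma Psi_map_class:
  assumes d: "d \<in> scalings" and t: "0 \<le> t" and \<alpha>: "\<forall>n. \<alpha> n \<in> rays"
  shows "Psi_map \<omega> x0 d (cone_class t \<alpha>) = aclass d (\<lambda>n. \<alpha> n (t * d n))"
proof -
  let ?F = "\<lambda>t \<alpha>. aclass d (\<lambda>n. \<alpha> n (t * d n))"
  have F: "?F t \<beta> = ?F t \<alpha>"
    if \<beta>: "\<forall>n. \<beta> n \<in> rays" and "t = 0 \<or> ((\<lambda>n. angle (\<alpha> n) (\<beta> n)) \<longlongrightarrow> 0) \<omega>" for \<beta>
    using that(2)
  proof
    assume "t = 0"
    with \<alpha> \<beta> show ?thesis by (simp add: ray_zero)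
  next
    assume lim: "((\<lambda>n. angle (\<alpha> n) (\<beta> n)) \<longlongrightarrow> 0) \<omega>"
    have "((\<lambda>n. euclidean_side t t (angle (\<alpha> n) (\<beta> n))) \<longlongrightarrow> euclidean_side t t 0) \<omega>"
      by (intro tendsto_intros lim)
    then have "((\<lambda>n. euclidean_side t t (angle (\<alpha> n) (\<beta> n))) \<longlongrightarrow> 0) \<omega>"
      by (simp add: euclidean_side_zero)
    then have "((\<lambda>n. dist (\<alpha> n (t * d n)) (\<beta> n (t * d n)) / d n) \<longlongrightarrow> 0) \<omega>"
    proof (rule tendsto_zero_le)
      fix n
      show "0 \<le> dist (\<alpha> n (t * d n)) (\<beta> n (t * d n)) / d n"
        using scaling_pos[OF d, of n] by simp
      show "dist (\<alpha> n (t * d n)) (\<beta> n (t * d n)) / d n \<le> euclidean_side t t (angle (\<alpha> n) (\<beta> n))"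
        using scaling_pos[OF d, of n] dist_rays_le[of "\<alpha> n" "\<beta> n" t t "d n"] \<alpha> \<beta> t
        by (simp add: field_simps)
    qed
    then have "?F t \<alpha> = ?F t \<beta>"
      using d t \<alpha> \<beta> by (simp add: aclass_eq_iff ray_scaled_seqs)
    then show ?thesis by simp
  qed
  have "cone_class t \<alpha> \<noteq> {}" "(\<Union>(s, A)\<in>cone_class t \<alpha>. \<Union>\<beta>\<in>A. ?F s \<beta>) = ?F t \<alpha>"
    by (rule cone_class_lift[where F = ?F, OF \<alpha> t], rule F, assumption+)+
  then show ?thesis
    by (simp add: Psi_map_def)
qed

lemma canonical_map_class:
  assumes t: "0 \<le> t" and \<alpha>: "\<forall>n. \<alpha> n \<in> rays"
  shows "canonical_map \<omega> x0 (cone_class t \<alpha>) = (\<lambda>d\<in>scalings. aclass d (\<lambda>n. \<alpha> n (t * d n)))"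
  unfolding canonical_map_def using Psi_map_class[OF _ t \<alpha>] by (intro restrict_ext)

lemma canonical_map_mem:
  assumes "C \<in> cone_omega_bdry \<omega> x0"
  shows "canonical_map \<omega> x0 C \<in> climit"
  using assms
proof (cases rule: cone_omega_bdry_cases)
  case empty
  then have "canonical_map \<omega> x0 C = (\<lambda>d\<in>scalings. aclass d (\<lambda>_. x0))"
    by (simp add: canonical_map_def Psi_map_def)
  moreover have "shrink d d' (\<lambda>_. x0) = (\<lambda>_. x0)" for d d'
    by (simp add: Xi_map_def)
  ultimately show ?thesis
    by (simp add: climit_iff aclass_mem base_scaled_seqs Theta_map_class)
next
  case (point t \<alpha>)
  have "Theta_map \<omega> x0 d d' (aclass d (\<lambda>n. \<alpha> n (t * d n))) = aclass d' (\<lambda>n. \<alpha> n (t * d' n))"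
    if d: "d \<in> scalings" "d' \<in> scalings" and le: "scaling_le \<omega> d' d" for d d'
  proof -
    let ?x = "\<lambda>n. \<alpha> n (t * d n)"
    \<comment> \<open>Where \<open>d' n \<le> d n\<close>, shrinking moves the point back along its
      own ray to parameter \<open>t * d' n\<close>; elsewhere \<open>Xi_map\<close> leaves it in
      place. Agreement \<open>\<omega>\<close>-almost surely is enough for equality of
      classes.\<close>
    have "eventually (\<lambda>n. shrink d d' ?x n = \<alpha> n (t * d' n)) \<omega>"
      using le unfolding scaling_le_def
    proof eventually_elim
      case (elim n)
      have pos: "0 < d n" "0 < d' n"
        using scaling_pos d by auto
      have "dist (?x n) x0 = t * d n"
        using point pos by (simp add: dist_commute[of _ x0] dist_base_ray)
      then have "d' n / d n * dist (?x n) x0 = t * d' n"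
        using pos by simp
      then show ?case
        using Xi_map_ray[of "\<alpha> n" "t * d' n" "t * d n"] point elim pos by (simp add: mult_left_mono)
    qed
    then have "aclass d' (shrink d d' ?x) = aclass d' (\<lambda>n. \<alpha> n (t * d' n))"
      using d point by (intro aclass_eqI shrink_scaled_seqs ray_scaled_seqs)
    then show ?thesis
      using Theta_map_class[OF d le] ray_scaled_seqs d point by simp
  qed
  then show ?thesis
    using point by (simp add: canonical_map_class climit_iff aclass_mem ray_scaled_seqs)
qed

text \<open>
  The supremum is attained: \<open>dist (\<alpha> n (t * s)) (\<beta> n (t' * s)) / s\<close> tends to the cone distance of
  the \<open>n\<close>th rays as \<open>s\<close> grows, so the \<open>n\<close>th scale can be chosen such that it is within \<open>1 / (n + 1)\<close>.
\<close>

lemma ex_attaining_scaling: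
  assumes t: "0 \<le> t" "0 \<le> t'" and \<alpha>: "\<forall>n. \<alpha> n \<in> rays" and \<beta>: "\<forall>n. \<beta> n \<in> rays"
  obtains d where "d \<in> scalings"
    "euclidean_side t t' (omega_angle \<alpha> \<beta>) \<le> adist d (aclass d (\<lambda>n. \<alpha> n (t * d n))) (aclass d (\<lambda>n. \<beta> n (t' * d n)))"
proof -
  let ?e = "\<lambda>n. euclidean_side t t' (angle (\<alpha> n) (\<beta> n))"
  have "\<exists>s. real (Suc n) \<le> s \<and> ?e n - 1 / real (Suc n) < dist (\<alpha> n (t * s)) (\<beta> n (t' * s)) / s" for n
  proof -
    have "eventually (\<lambda>s. ?e n - 1 / real (Suc n) < dist (\<alpha> n (t * s)) (\<beta> n (t' * s)) / s) at_top"
      using \<alpha> \<beta> t by (intro order_tendstoD(1)[OF dist_rays_tendsto]) auto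
    then show ?thesis
      using eventually_happens'[OF _ eventually_conj[OF eventually_ge_at_top[of "real (Suc n)"]]] by simp
  qed
  then have "\<forall>n. \<exists>s. real (Suc n) \<le> s \<and> ?e n - 1 / real (Suc n) < dist (\<alpha> n (t * s)) (\<beta> n (t' * s)) / s"
    by blast
  then obtain d where "\<forall>n. real (Suc n) \<le> d n \<and>
      ?e n - 1 / real (Suc n) < dist (\<alpha> n (t * d n)) (\<beta> n (t' * d n)) / d n"
    by (rule choice[THEN exE])
  then have d_ge: "\<And>n. real (Suc n) \<le> d n"
    and near: "\<And>n. ?e n - 1 / real (Suc n) \<le> dist (\<alpha> n (t * d n)) (\<beta> n (t' * d n)) / d n"
    by (auto intro: less_imp_le)
  have "filterlim d at_top \<omega>"
    by (rule filterlim_at_top_mono[of "\<lambda>n. real (Suc n)"])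
      (use real_Suc_scaling d_ge in \<open>auto simp: scaling_seqs_def\<close>)
  moreover have "0 < d n" for n
    using d_ge[of n] by simp
  ultimately have d: "d \<in> scalings"
    by (simp add: scaling_seqs_def)
  have "((\<lambda>n. ?e n - 1 / real (Suc n)) \<longlongrightarrow> euclidean_side t t' (omega_angle \<alpha> \<beta>) - 0) \<omega>"
    using nonprincipal_ultrafilter_tendsto[OF ultrafilter LIMSEQ_Suc[OF lim_1_over_n]]
    by (intro tendsto_intros tendsto_omega_angle \<alpha> \<beta>)
  then have "euclidean_side t t' (omega_angle \<alpha> \<beta>) - 0
      \<le> adist d (aclass d (\<lambda>n. \<alpha> n (t * d n))) (aclass d (\<lambda>n. \<beta> n (t' * d n)))"
    using tendsto_le[OF not_bot tendsto_adist[OF d ray_scaled_seqs[OF d t(1) \<alpha>] ray_scaled_seqs[OF d t(2) \<beta>]]]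
      near by simp
  then show thesis
    using that[OF d] by simp
qed

lemma cdist_canonical_map:
  assumes t: "0 \<le> t" "0 \<le> t'" and \<alpha>: "\<forall>n. \<alpha> n \<in> rays" and \<beta>: "\<forall>n. \<beta> n \<in> rays"
  shows "cdist (canonical_map \<omega> x0 (cone_class t \<alpha>)) (canonical_map \<omega> x0 (cone_class t' \<beta>)) =
    euclidean_side t t' (omega_angle \<alpha> \<beta>)"
proof (rule antisym)
  show "cdist (canonical_map \<omega> x0 (cone_class t \<alpha>)) (canonical_map \<omega> x0 (cone_class t' \<beta>))
      \<le> euclidean_side t t' (omega_angle \<alpha> \<beta>)"
  proof (rule cdist_leI)
    fix d assume d: "d \<in> scalings"
    have "adist d (aclass d (\<lambda>n. \<alpha> n (t * d n))) (aclass d (\<lambda>n. \<beta> n (t' * d n)))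
        \<le> euclidean_side t t' (omega_angle \<alpha> \<beta>)"
    proof (rule tendsto_le[OF not_bot _ tendsto_adist])
      show "((\<lambda>n. euclidean_side t t' (angle (\<alpha> n) (\<beta> n))) \<longlongrightarrow> euclidean_side t t' (omega_angle \<alpha> \<beta>)) \<omega>"
        by (intro tendsto_intros tendsto_omega_angle \<alpha> \<beta>)
      have "dist (\<alpha> n (t * d n)) (\<beta> n (t' * d n)) / d n \<le> euclidean_side t t' (angle (\<alpha> n) (\<beta> n))" for n
        using scaling_pos[OF d, of n] dist_rays_le[of "\<alpha> n" "\<beta> n" t t' "d n"] \<alpha> \<beta> t
        by (simp add: field_simps)
      then show "eventually (\<lambda>n. dist (\<alpha> n (t * d n)) (\<beta> n (t' * d n)) / d n
          \<le> euclidean_side t t' (angle (\<alpha> n) (\<beta> n))) \<omega>"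
        by simp
    qed (intro d t \<alpha> \<beta> ray_scaled_seqs)+
    then show "adist d (canonical_map \<omega> x0 (cone_class t \<alpha>) d) (canonical_map \<omega> x0 (cone_class t' \<beta>) d)
        \<le> euclidean_side t t' (omega_angle \<alpha> \<beta>)"
      using d t \<alpha> \<beta> by (simp add: canonical_map_class)
  qed (use t in \<open>simp add: euclidean_side_nonneg\<close>)
next
  obtain d where d: "d \<in> scalings"
    and le: "euclidean_side t t' (omega_angle \<alpha> \<beta>) \<le>
      adist d (aclass d (\<lambda>n. \<alpha> n (t * d n))) (aclass d (\<lambda>n. \<beta> n (t' * d n)))"
    using ex_attaining_scaling[OF t \<alpha> \<beta>] .
  then have "euclidean_side t t' (omega_angle \<alpha> \<beta>) \<le>
      adist d (canonical_map \<omega> x0 (cone_class t \<alpha>) d) (canonical_map \<omega> x0 (cone_class t' \<beta>) d)"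
    using t \<alpha> \<beta> by (simp add: canonical_map_class)
  also have "\<dots> \<le> cdist (canonical_map \<omega> x0 (cone_class t \<alpha>)) (canonical_map \<omega> x0 (cone_class t' \<beta>))"
    using d t \<alpha> \<beta> by (intro adist_le_cdist canonical_map_mem cone_class_mem)
  finally show "euclidean_side t t' (omega_angle \<alpha> \<beta>) \<le>
      cdist (canonical_map \<omega> x0 (cone_class t \<alpha>)) (canonical_map \<omega> x0 (cone_class t' \<beta>))" .
qed

lemma isometric_embedding_canonical_map:
  "isometric_embedding (cone_omega_bdry \<omega> x0) (cone_omega_bdry_dist \<omega> x0) climit cdist (canonical_map \<omega> x0)"
proof -
  have "cdist (canonical_map \<omega> x0 C) (canonical_map \<omega> x0 C') = cone_omega_bdry_dist \<omega> x0 C C'"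
    if C: "C \<in> cone_omega_bdry \<omega> x0" and C': "C' \<in> cone_omega_bdry \<omega> x0" for C C'
    using C
  proof (cases rule: cone_omega_bdry_cases)
    case empty
    then have "C' = {}"
      using C' omega_bdry_empty_iff by (simp add: euclidean_cone_empty)
    moreover have "cdist \<xi> \<xi> = 0" if "\<xi> \<in> climit" for \<xi>
      using that Metric_space.zero[OF Metric_space_climit] by blast
    ultimately show ?thesis
      using empty canonical_map_mem[OF C] by simp
  next
    case (point t \<alpha>)
    from C' show ?thesis
    proof (cases rule: cone_omega_bdry_cases)
      case empty
      with point show ?thesis by simp
    next
      case (point t' \<beta>)
      with \<open>0 \<le> t\<close> \<open>\<forall>n. \<alpha> n \<in> rays\<close> \<open>C = cone_class t \<alpha>\<close> show ?thesis
        by (simp add: cdist_canonical_map cone_omega_bdry_dist_class)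
    qed
  qed
  then show ?thesis
    using canonical_map_mem by (auto simp: isometric_embedding_def)
qed

end

text \<open>Transports the canonical embedding from the cone over the ultraproduct to the
  ultraproduct of the Tits cone.\<close>

lemma isometric_embedding_inv_into:
  assumes f: "isometry_onto M d M' d' f" and g: "isometric_embedding M d N e g"
  shows "isometric_embedding M' d' N e (g \<circ> inv_into M f)"
proof -
  have bij: "bij_betw f M M'" and iso: "\<And>x y. x \<in> M \<Longrightarrow> y \<in> M \<Longrightarrow> d' (f x) (f y) = d x y"
    using f by (auto simp: isometry_onto_def)
  have inv: "inv_into M f y \<in> M" "f (inv_into M f y) = y" if "y \<in> M'" for y
    using bij that by (auto simp: bij_betw_def inv_into_into f_inv_into_f)
  have "e (g (inv_into M f x)) (g (inv_into M f y)) = d' x y" if "x \<in> M'" "y \<in> M'" for x y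
    using g iso[of "inv_into M f x" "inv_into M f y"] inv that by (simp add: isometric_embedding_def)
  then show ?thesis
    using g inv by (auto simp: isometric_embedding_def)
qed

theorem theorem2:
  fixes x0 :: "'a::metric_space" and \<omega> :: "nat filter"
  assumes "proper_space TYPE('a)"
    and "cocompact_space TYPE('a)"
    and "CAT0_space TYPE('a)"
    and "nonprincipal_ultrafilter \<omega>"
  shows
    "(\<forall>\<xi>\<in>cone_limit \<omega> x0. \<forall>\<eta>\<in>cone_limit \<omega> x0. cone_limit_edist \<omega> \<xi> \<eta> < \<infinity>) \<and>
     Metric_space (cone_limit \<omega> x0) (cone_limit_dist \<omega>) \<and>
     Metric_space.mcomplete (cone_limit \<omega> x0) (cone_limit_dist \<omega>) \<and>
     isometric_embedding (cone_omega_bdry \<omega> x0) (cone_omega_bdry_dist \<omega> x0)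
       (cone_limit \<omega> x0) (cone_limit_dist \<omega>) (canonical_map \<omega> x0) \<and>
     (\<forall>t\<ge>0. \<forall>\<alpha>. (\<forall>n. \<alpha> n \<in> bdry x0) \<longrightarrow>
       canonical_map \<omega> x0 (cone_pt (omega_bdry \<omega> x0) t (omega_bdry_class \<omega> x0 \<alpha>)) =
         (\<lambda>d\<in>scaling_seqs \<omega>. asym_cone_class \<omega> x0 d (\<lambda>n. \<alpha> n (t * d n)))) \<and>
     isometry_onto (cone_omega_bdry \<omega> x0) (cone_omega_bdry_dist \<omega> x0)
       (omega_tits_cone \<omega> x0) (omega_tits_cone_dist \<omega> x0) (cone_ultra_map \<omega> x0) \<and>
     (\<forall>t\<ge>0. \<forall>\<alpha>. (\<forall>n. \<alpha> n \<in> bdry x0) \<longrightarrow>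
       cone_ultra_map \<omega> x0 (cone_pt (omega_bdry \<omega> x0) t (omega_bdry_class \<omega> x0 \<alpha>)) =
         omega_tits_cone_class \<omega> x0 (\<lambda>n. cone_pt (bdry x0) t (\<alpha> n))) \<and>
     isometric_embedding (omega_tits_cone \<omega> x0) (omega_tits_cone_dist \<omega> x0)
       (cone_limit \<omega> x0) (cone_limit_dist \<omega>)
       (canonical_map \<omega> x0 \<circ> inv_into (cone_omega_bdry \<omega> x0) (cone_ultra_map \<omega> x0))"
proof -
  interpret proper_CAT0_basepoint x0 \<omega>
    using assms by unfold_locales
  have "canonical_map \<omega> x0 (cone_class t \<alpha>) = (\<lambda>d\<in>scalings. aclass d (\<lambda>n. \<alpha> n (t * d n)))"
    "cone_ultra_map \<omega> x0 (cone_class t \<alpha>) = omega_tits_cone_class \<omega> x0 (\<lambda>n. cone_pt rays t (\<alpha> n))"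
    if "0 \<le> t" "\<forall>n. \<alpha> n \<in> rays" for t \<alpha>
    using that by (rule canonical_map_class cone_ultra_map_class)+
  then show ?thesis
    using cone_limit_edist_finite Metric_space_climit mcomplete_climit isometric_embedding_canonical_map
      isometry_onto_cone_ultra_map
      isometric_embedding_inv_into[OF isometry_onto_cone_ultra_map isometric_embedding_canonical_map]
    by (intro conjI ballI allI impI) blast+
qed

end
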